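(* There exist constants $K_b, K_a>0$, independent of $v_h$, of $h$ and of how $\Gamma$ intersects $\Omega_h^\Gamma$, such that for every $v_h\in V_h$ with its unique decomposition $v_h=v_h^0+v_h^\Gamma$, $v_h^0\in V_h^0$, $v_h^\Gamma\in V_h^\Gamma$, one has $$\|v_h^0\|_b^2+\|v_h^\Gamma\|_b^2\le K_b\,\|v_h\|_b^2,\qquad \|v_h^0\|_a^2+\|v_h^\Gamma\|_a^2\le K_a\,\|v_h\|_a^2 .$$
   Context: Geometry and mesh. Let $d\in\{2,3\}$, $\Omega\subset\mathbb{R}^d$ an open connected Lipschitz domain, $\Gamma=\partial\Omega$ with outward unit normal $n_\Gamma$. Let $\Omega^\ast\supset\Omega$ be a polygonal (polyhedral) domain with a family $\{\mathcal{T}_h^\ast\}_{h>0}$ of shape regular (not necessarily quasi-uniform) simplicial triangulations; $h_T$, $h_F$ denote the diameters of a simplex $T$, a face $F$. Define $\mathcal{T}_h=\{T\in\mathcal{T}_h^\ast : \mathrm{meas}_{d-1}(T\cap\Omega)>0\}$, the fictitious domain $\Omega_h=\bigcup_{T\in\mathcal{T}_h}T$, $\mathcal{T}_h^\Gamma=\{T\in\mathcal{T}_h: T\cap\Gamma\ne\emptyset\}$, $\Omega_h^\Gamma=\bigcup_{T\in\mathcal{T}_h^\Gamma}T$, $\Omega_h^0=\Omega_h\setminus\Omega_h^\Gamma$. Standing assumption ($\Gamma$ sufficiently resolved, $h$ sufficiently small): $\mathcal{T}_h^\Gamma=\{T\in\mathcal{T}_h: T\cap\partial\Omega_h\neq\emptyset\}$.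 Finite element spaces. For fixed $k\ge1$, $V_h=\{v_h\in C(\Omega_h): v_h|_T\in\mathcal{P}_k\ \forall T\in\mathcal{T}_h\}$ with nodal (Lagrange) basis $\phi_i$ and nodes $\xi_i$, $1\le i\le N$, ordered so that $\xi_i\in\partial\Omega_h$ iff $i>N_0$. $V_h^0=\mathrm{span}\{\phi_i: i\le N_0\}=\{v_h\in V_h: v_h|_{\partial\Omega_h}=0\}$ and $V_h^\Gamma=\mathrm{span}\{\phi_i: N_0+1\le i\le N\}$, so $V_h=V_h^0\oplus V_h^\Gamma$. Norms. $(\cdot,\cdot)_\omega$ and $\|\cdot\|_\omega$ are the $L^2(\omega)$ scalar product and norm. $(h^{-1}u,v)_\Gamma:=\sum_{T\in\mathcal{T}_h^\Gamma}h_T^{-1}(u,v)_{T\cap\Gamma}$. Let $\gamma,\beta>0$ be fixed, $\mathcal{F}_g$ the set of faces $F$ of simplices $T\in\mathcal{T}_h^\Gamma$ with $F\not\subset\partial\Omega_h$, $[\![\cdot]\!]$ the jump across $F$, $\partial_n$ the derivative normal to $F$. Define $$a_h(u,v)=(\nabla u,\nabla v)_\Omega-(n_\Gamma\cdot\nabla u,v)_\Gamma-(u,n_\Gamma\cdot\nabla v)_\Gamma+\gamma(h^{-1}u,v)_\Gamma+\beta\sum_{\ell=1}^k\sum_{F\in\mathcal{F}_g}h_F^{2\ell-1}([\![\partial_n^\ell u]\!],[\![\partial_n^\ell v]\!])_F,$$ $$b_h(u,v)=(\nabla u,\nabla v)_{\Omega_h}+\gamma(h^{-1}u,v)_\Gamma,$$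 $\|v\|_a=a_h(v,v)^{1/2}$, $\|v\|_b=b_h(v,v)^{1/2}$. Standing assumption: $\gamma$ is sufficiently large; then, by a known result from the literature taken as background, $\|v_h\|_a$ and $\|v_h\|_b$ are equivalent on $V_h$ with constants independent of $h$ and of how $\Gamma$ cuts the triangulation (in particular $a_h$ is positive definite on $V_h$). Constants "independent of $h$ and of how $\Gamma$ intersects the triangulation" may depend only on fixed data such as $d,k,\gamma,\beta$, $\Omega$ and the shape regularity of the family. *)

theory Defs
  imports "HOL-Analysis.Analysis"
begin

section \<open>Hausdorff measure\<close>

text \<open>The factor \<open>unit_ball_vol n / 2 ^ n\<close> normalises the measure so that it is the usual
  surface measure on \<open>n\<close>-dimensional Lipschitz surfaces and Lebesgue measure on flat pieces.\<close>

definition hausdorff_size :: "nat \<Rightarrow> 'a::metric_space set \<Rightarrow> ennreal" where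
  "hausdorff_size n C =
     (if C = {} then 0 else ennreal (unit_ball_vol (real n) / 2 ^ n * diameter C ^ n))"

definition hausdorff_pre :: "nat \<Rightarrow> real \<Rightarrow> 'a::metric_space set \<Rightarrow> ennreal" where
  "hausdorff_pre n \<delta> A =
     Inf {(\<Sum>i. hausdorff_size n (C i)) | C :: nat \<Rightarrow> 'a set.
            A \<subseteq> (\<Union>i. C i) \<and> (\<forall>i. bounded (C i) \<and> diameter (C i) \<le> \<delta>)}"

definition hausdorff_outer :: "nat \<Rightarrow> 'a::metric_space set \<Rightarrow> ennreal" where
  "hausdorff_outer n A = (SUP \<delta>\<in>{0<..}. hausdorff_pre n \<delta> A)"

definition hausdorff_measure :: "nat \<Rightarrow> 'a::metric_space measure" where
  "hausdorff_measure n = measure_of UNIV (sets borel) (hausdorff_outer n)"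

abbreviation surface_measure :: "'a::euclidean_space measure" where
  "surface_measure \<equiv> hausdorff_measure (DIM('a) - 1)"


section \<open>Domains\<close>

definition lipschitz_domain :: "'a::euclidean_space set \<Rightarrow> bool" where
  "lipschitz_domain \<Omega> \<longleftrightarrow> \<Omega> \<noteq> {} \<and> open \<Omega> \<and> connected \<Omega> \<and>
     (\<forall>x\<in>frontier \<Omega>. \<exists>U e L g. open U \<and> x \<in> U \<and> norm e = 1 \<and> L-lipschitz_on {y. y \<bullet> e = 0} g \<and>
        \<Omega> \<inter> U = {y\<in>U. y \<bullet> e < g (y - (y \<bullet> e) *\<^sub>R e)})"

definition polyhedral_domain :: "'a::euclidean_space set \<Rightarrow> bool" where
  "polyhedral_domain W \<longleftrightarrow> W \<noteq> {} \<and> open W \<and> connected W \<and> bounded W \<and>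
     (\<exists>\<P>. finite \<P> \<and> (\<forall>P\<in>\<P>. polytope P \<and> aff_dim P = int DIM('a) - 1) \<and> frontier W = \<Union>\<P>)"

text \<open>The outward unit normal at \<open>x\<close>: the domain coincides near \<open>x\<close>, outside every double cone
  around the tangent plane, with a half space.  On a Lipschitz boundary it exists at almost every
  point (precisely where a local graph function is differentiable).\<close>

definition outward_normal :: "'a::euclidean_space set \<Rightarrow> 'a \<Rightarrow> 'a" where
  "outward_normal \<Omega> x = (THE \<nu>. norm \<nu> = 1 \<and>
     (\<forall>\<epsilon>>0. \<forall>\<^sub>F y in at x.
        ((y - x) \<bullet> \<nu> < - \<epsilon> * norm (y - x) \<longrightarrow> y \<in> \<Omega>) \<and>
        ((y - x) \<bullet> \<nu> > \<epsilon> * norm (y - x) \<longrightarrow> y \<notin> \<Omega>)))"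


section \<open>Meshes\<close>

definition mesh_of :: "'a::euclidean_space set \<Rightarrow> 'a set set \<Rightarrow> bool" where
  "mesh_of W \<T> \<longleftrightarrow>
     triangulation \<T> \<and> (\<forall>T\<in>\<T>. int DIM('a) simplex T) \<and> \<Union>\<T> = closure W"

definition inball_diameter :: "'a::euclidean_space set \<Rightarrow> real" where
  "inball_diameter T = Sup {2 * r | c r. 0 \<le> r \<and> cball c r \<subseteq> T}"

definition shape_regular :: "real \<Rightarrow> 'a::euclidean_space set set \<Rightarrow> bool" where
  "shape_regular \<sigma> \<T> \<longleftrightarrow> (\<forall>T\<in>\<T>. diameter T \<le> \<sigma> * inball_diameter T)"

text \<open>Below, \<open>\<T>\<close> is the triangulation of the surrounding polyhedral domain; the active
  mesh, the fictitious domain and the cut elements are derived from it and from \<open>\<Omega>\<close>.\<close>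

definition active_mesh :: "'a::euclidean_space set \<Rightarrow> 'a set set \<Rightarrow> 'a set set" where
  "active_mesh \<Omega> \<T> = {T\<in>\<T>. 0 < emeasure surface_measure (T \<inter> \<Omega>)}"

definition fict_domain :: "'a::euclidean_space set \<Rightarrow> 'a set set \<Rightarrow> 'a set" where
  "fict_domain \<Omega> \<T> = \<Union>(active_mesh \<Omega> \<T>)"

definition cut_mesh :: "'a::euclidean_space set \<Rightarrow> 'a set set \<Rightarrow> 'a set set" where
  "cut_mesh \<Omega> \<T> = {T\<in>active_mesh \<Omega> \<T>. T \<inter> frontier \<Omega> \<noteq> {}}"

definition boundary_resolved :: "'a::euclidean_space set \<Rightarrow> 'a set set \<Rightarrow> bool" where
  "boundary_resolved \<Omega> \<T> \<longleftrightarrow>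
     cut_mesh \<Omega> \<T> = {T\<in>active_mesh \<Omega> \<T>. T \<inter> frontier (fict_domain \<Omega> \<T>) \<noteq> {}}"

definition ghost_faces :: "'a::euclidean_space set \<Rightarrow> 'a set set \<Rightarrow> 'a set set" where
  "ghost_faces \<Omega> \<T> =
     {F. (\<exists>T\<in>cut_mesh \<Omega> \<T>. F facet_of T) \<and> \<not> F \<subseteq> frontier (fict_domain \<Omega> \<T>)}"


section \<open>Finite element spaces\<close>

definition polys :: "nat \<Rightarrow> ('a::euclidean_space \<Rightarrow> real) set" where
  "polys k = {p. \<exists>c. p = (\<lambda>x.
     \<Sum>\<alpha>\<in>{\<alpha> \<in> Basis \<rightarrow>\<^sub>E {..k}. (\<Sum>b\<in>Basis. \<alpha> b) \<le> k}. c \<alpha> * (\<Prod>b\<in>Basis. (x \<bullet> b) ^ \<alpha> b))}"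

text \<open>Functions on the fictitious domain are represented by their extension by zero.\<close>

definition fe_space :: "nat \<Rightarrow> 'a::euclidean_space set \<Rightarrow> 'a set set \<Rightarrow> ('a \<Rightarrow> real) set" where
  "fe_space k \<Omega> \<T> = {v. (\<forall>x. x \<notin> fict_domain \<Omega> \<T> \<longrightarrow> v x = 0) \<and>
     continuous_on (fict_domain \<Omega> \<T>) v \<and>
     (\<forall>T\<in>active_mesh \<Omega> \<T>. \<exists>p\<in>polys k. \<forall>x\<in>T. v x = p x)}"

text \<open>The principal lattice of a simplex: points whose barycentric coordinates are multiples
  of \<open>1 / k\<close>.\<close>

definition lagrange_nodes :: "nat \<Rightarrow> 'a::euclidean_space set \<Rightarrow> 'a set" where
  "lagrange_nodes k T = {(\<Sum>z | z extreme_point_of T. (real (\<alpha> z) / real k) *\<^sub>R z) | \<alpha> :: 'a \<Rightarrow> nat.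
     (\<Sum>z | z extreme_point_of T. \<alpha> z) = k}"

definition fe_nodes :: "nat \<Rightarrow> 'a::euclidean_space set \<Rightarrow> 'a set set \<Rightarrow> 'a set" where
  "fe_nodes k \<Omega> \<T> = (\<Union>T\<in>active_mesh \<Omega> \<T>. lagrange_nodes k T)"

definition nodal_basis ::
    "nat \<Rightarrow> 'a::euclidean_space set \<Rightarrow> 'a set set \<Rightarrow> 'a \<Rightarrow> 'a \<Rightarrow> real" where
  "nodal_basis k \<Omega> \<T> \<xi> = (THE \<phi>. \<phi> \<in> fe_space k \<Omega> \<T> \<and>
     (\<forall>\<eta>\<in>fe_nodes k \<Omega> \<T>. \<phi> \<eta> = (if \<eta> = \<xi> then 1 else 0)))"

definition nodal_span ::
    "nat \<Rightarrow> 'a::euclidean_space set \<Rightarrow> 'a set set \<Rightarrow> 'a set \<Rightarrow> ('a \<Rightarrow> real) set" where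
  "nodal_span k \<Omega> \<T> N = {v. \<exists>c. v = (\<lambda>x. \<Sum>\<xi>\<in>N. c \<xi> * nodal_basis k \<Omega> \<T> \<xi> x)}"

definition fe_interior :: "nat \<Rightarrow> 'a::euclidean_space set \<Rightarrow> 'a set set \<Rightarrow> ('a \<Rightarrow> real) set" where
  "fe_interior k \<Omega> \<T> = nodal_span k \<Omega> \<T> (fe_nodes k \<Omega> \<T> - frontier (fict_domain \<Omega> \<T>))"

definition fe_boundary :: "nat \<Rightarrow> 'a::euclidean_space set \<Rightarrow> 'a set set \<Rightarrow> ('a \<Rightarrow> real) set" where
  "fe_boundary k \<Omega> \<T> = nodal_span k \<Omega> \<T> (fe_nodes k \<Omega> \<T> \<inter> frontier (fict_domain \<Omega> \<T>))"


section \<open>Bilinear forms and norms\<close>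

text \<open>The gradient is taken relative to a set.  At boundary points of \<open>\<Omega>\<close>, the gradient within
  \<open>\<Omega>\<close> of a finite element function is its trace from \<open>\<Omega>\<close>; it exists almost everywhere on the
  boundary, also when parts of the boundary lie in interelement faces.\<close>

definition gradient_within :: "('a::euclidean_space \<Rightarrow> real) \<Rightarrow> 'a set \<Rightarrow> 'a \<Rightarrow> 'a" where
  "gradient_within u S x = (SOME D. (u has_derivative (\<lambda>h. D \<bullet> h)) (at x within S))"

definition grad_prod ::
    "'a::euclidean_space set \<Rightarrow> ('a \<Rightarrow> real) \<Rightarrow> ('a \<Rightarrow> real) \<Rightarrow> real" where
  "grad_prod S u v = (LINT x:S|lebesgue. gradient_within u S x \<bullet> gradient_within v S x)"

definition flux_prod ::
    "'a::euclidean_space set \<Rightarrow> ('a \<Rightarrow> real) \<Rightarrow> ('a \<Rightarrow> real) \<Rightarrow> real" where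
  "flux_prod \<Omega> u v =
     (LINT x:frontier \<Omega>|surface_measure. (outward_normal \<Omega> x \<bullet> gradient_within u \<Omega> x) * v x)"

definition weighted_bdry_prod ::
    "'a::euclidean_space set \<Rightarrow> 'a set set \<Rightarrow> ('a \<Rightarrow> real) \<Rightarrow> ('a \<Rightarrow> real) \<Rightarrow> real" where
  "weighted_bdry_prod \<Omega> \<T> u v =
     (\<Sum>T\<in>cut_mesh \<Omega> \<T>. inverse (diameter T) *
        (LINT x:T \<inter> frontier \<Omega>|surface_measure. u x * v x))"

definition face_normal :: "'a::euclidean_space set \<Rightarrow> 'a" where
  "face_normal F = (SOME n. norm n = 1 \<and> (\<forall>x\<in>F. \<forall>y\<in>F. n \<bullet> (x - y) = 0))"

definition adjacent_simplex ::
    "'a::euclidean_space set \<Rightarrow> 'a set set \<Rightarrow> 'a set \<Rightarrow> 'a \<Rightarrow> 'a set" where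
  "adjacent_simplex \<Omega> \<T> F n =
     (THE T. T \<in> active_mesh \<Omega> \<T> \<and> F facet_of T \<and> (\<forall>x\<in>F. \<forall>y\<in>T. 0 \<le> (y - x) \<bullet> n))"

definition poly_on ::
    "nat \<Rightarrow> ('a::euclidean_space \<Rightarrow> real) \<Rightarrow> 'a set \<Rightarrow> 'a \<Rightarrow> real" where
  "poly_on k u T = (SOME p. p \<in> polys k \<and> (\<forall>x\<in>T. u x = p x))"

definition dir_deriv :: "nat \<Rightarrow> 'a::euclidean_space \<Rightarrow> ('a \<Rightarrow> real) \<Rightarrow> 'a \<Rightarrow> real" where
  "dir_deriv l n p x = (deriv ^^ l) (\<lambda>t. p (x + t *\<^sub>R n)) 0"

text \<open>The sign of the jump depends on the choice of the face normal; products of two jumps,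
  the only way they are used, do not.\<close>

definition normal_jump ::
    "nat \<Rightarrow> 'a::euclidean_space set \<Rightarrow> 'a set set \<Rightarrow> nat \<Rightarrow> 'a set \<Rightarrow> ('a \<Rightarrow> real) \<Rightarrow> 'a \<Rightarrow> real" where
  "normal_jump k \<Omega> \<T> l F u x = (let n = face_normal F in
     dir_deriv l n (poly_on k u (adjacent_simplex \<Omega> \<T> F n)) x -
     dir_deriv l n (poly_on k u (adjacent_simplex \<Omega> \<T> F (- n))) x)"

definition ghost_penalty ::
    "nat \<Rightarrow> 'a::euclidean_space set \<Rightarrow> 'a set set \<Rightarrow> ('a \<Rightarrow> real) \<Rightarrow> ('a \<Rightarrow> real) \<Rightarrow> real" where
  "ghost_penalty k \<Omega> \<T> u v =
     (\<Sum>l=1..k. \<Sum>F\<in>ghost_faces \<Omega> \<T>. diameter F ^ (2 * l - 1) *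
        (LINT x:F|surface_measure. normal_jump k \<Omega> \<T> l F u x * normal_jump k \<Omega> \<T> l F v x))"

definition a_form :: "nat \<Rightarrow> real \<Rightarrow> real \<Rightarrow> 'a::euclidean_space set \<Rightarrow> 'a set set \<Rightarrow>
    ('a \<Rightarrow> real) \<Rightarrow> ('a \<Rightarrow> real) \<Rightarrow> real" where
  "a_form k \<gamma> \<beta> \<Omega> \<T> u v =
     grad_prod \<Omega> u v - flux_prod \<Omega> u v - flux_prod \<Omega> v u
       + \<gamma> * weighted_bdry_prod \<Omega> \<T> u v + \<beta> * ghost_penalty k \<Omega> \<T> u v"

definition b_form :: "real \<Rightarrow> 'a::euclidean_space set \<Rightarrow> 'a set set \<Rightarrow>
    ('a \<Rightarrow> real) \<Rightarrow> ('a \<Rightarrow> real) \<Rightarrow> real" where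
  "b_form \<gamma> \<Omega> \<T> u v = grad_prod (fict_domain \<Omega> \<T>) u v + \<gamma> * weighted_bdry_prod \<Omega> \<T> u v"

definition a_norm :: "nat \<Rightarrow> real \<Rightarrow> real \<Rightarrow> 'a::euclidean_space set \<Rightarrow> 'a set set \<Rightarrow>
    ('a \<Rightarrow> real) \<Rightarrow> real" where
  "a_norm k \<gamma> \<beta> \<Omega> \<T> v = sqrt (a_form k \<gamma> \<beta> \<Omega> \<T> v v)"

definition b_norm :: "real \<Rightarrow> 'a::euclidean_space set \<Rightarrow> 'a set set \<Rightarrow> ('a \<Rightarrow> real) \<Rightarrow> real" where
  "b_norm \<gamma> \<Omega> \<T> v = sqrt (b_form \<gamma> \<Omega> \<T> v v)"

text \<open>What the requirement that \<open>\<gamma>\<close> be sufficiently large provides.  The lower bound also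
  excludes negative values of \<open>a_form k \<gamma> \<beta> \<Omega> \<T> v v\<close>, since \<open>sqrt\<close> is negative on negative
  arguments.\<close>

definition norms_equivalent :: "real \<Rightarrow> real \<Rightarrow> nat \<Rightarrow> real \<Rightarrow> real \<Rightarrow>
    'a::euclidean_space set \<Rightarrow> 'a set set \<Rightarrow> bool" where
  "norms_equivalent c C k \<gamma> \<beta> \<Omega> \<T> \<longleftrightarrow> (\<forall>v\<in>fe_space k \<Omega> \<T>.
     c * b_norm \<gamma> \<Omega> \<T> v \<le> a_norm k \<gamma> \<beta> \<Omega> \<T> v \<and> a_norm k \<gamma> \<beta> \<Omega> \<T> v \<le> C * b_norm \<gamma> \<Omega> \<T> v)"

end

theory Submission
  imports Defs
begin

text \<open>The bound for \<open>a_norm\<close> follows from the one for \<open>b_norm\<close> by equivalence of norms.  The boundary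
  part of \<open>v\<close> is supported on the cut cells, where it is controlled by the nodal values of \<open>v\<close>, so it
  suffices to bound \<open>h\<^sup>d\<^sup>-\<^sup>2 max v\<^sup>2\<close> on each cut cell by the \<open>b_norm\<close> contributions of boundedly
  many cells.  The intersection of a cut cell with the boundary may be arbitrarily small.  But near the
  cell the boundary is a Lipschitz graph, and the domain below it is star-shaped with respect to a ball,
  so short paths inside the domain lead from the cell to a piece of the boundary of measure comparable
  to \<open>h\<^sup>d\<^sup>-\<^sup>1\<close>.  These paths can be chosen to avoid the vertices of the mesh, and then they stay within
  cells of comparable size.  Comparing point values along these cells by a Poincare-type estimate gives
  the bound.\<close>

section \<open>Barycentric coordinates\<close>

text \<open>A function with nodal values of size m on a cell of diameter h contributes about h^(d-2)
  m^2 both to the energy and to the weighted trace, so one bound on h^(d-2) max v^2 serves both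
  terms; the interior part is then treated as v minus the boundary part. The obstacle is that cells
  meeting only at a vertex may have unrelated diameters, so closeness to a cell says nothing about
  size. That a short path stays in comparable cells is proved with a cut-off: it is one on the cell
  T, zero on every cell not linked to T through edges at one of the vertices of T, and has slope of
  order 1/h. Along a path shorter than a small multiple of h it cannot drop from one to zero. The
  cut-off is ambiguous at mesh vertices, which is why paths must avoid them; each path consists of
  two segments through an apex in general position. The length of the paths is also limited by the
  radius of the boundary charts. As all diameters are bounded by that of the surrounding domain, the
  admissible length is still at least a fixed multiple of h.\<close>

abbreviation verts :: "'a::euclidean_space set \<Rightarrow> 'a set" where
  "verts T \<equiv> {z. z extreme_point_of T}"

text \<open>An affine function on the whole space, so that its slope and its values off
  \<open>T\<close> make sense. For a vertex of a full simplex the choice is unique, because the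
  vertices affinely span the space; for other arguments it is arbitrary.\<close>

definition bary :: "'a::euclidean_space set \<Rightarrow> 'a \<Rightarrow> 'a \<Rightarrow> real" where
  "bary T z = (SOME f. (\<exists>g c. f = (\<lambda>x. g \<bullet> x + c)) \<and> f z = 1 \<and> (\<forall>w\<in>verts T - {z}. f w = 0))"

lemma simplex_verts:
  fixes T :: "'a::euclidean_space set"
  assumes "int DIM('a) simplex T"
  shows "finite (verts T)" "card (verts T) = Suc DIM('a)" "T = convex hull verts T"
    "\<not> affine_dependent (verts T)" "affine hull verts T = UNIV" "verts T \<subseteq> T"
proof -
  obtain C where C: "\<not> affine_dependent C" "int (card C) = int DIM('a) + 1" "T = convex hull C"
    using assms unfolding simplex_def by blast
  then have "verts T = C"
    by (auto simp: extreme_point_of_convex_hull_affine_independent)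
  moreover have "finite C" using C(1) aff_independent_finite by blast
  moreover have "card C = Suc DIM('a)" using C(2) by simp
  ultimately show "finite (verts T)" "card (verts T) = Suc DIM('a)" "T = convex hull verts T"
    "\<not> affine_dependent (verts T)" "affine hull verts T = UNIV" "verts T \<subseteq> T"
    using C affine_independent_span_eq[of C] by (auto simp: hull_inc)
qed

text \<open>Translating another point \<open>w0\<close> of \<open>V\<close> to the origin turns
  affine into linear independence; a linear functional with prescribed values on the differences
  exists, and its adjoint represents it.\<close>

lemma affine_independent_functional:
  fixes V :: "'a::euclidean_space set"
  assumes "\<not> affine_dependent V" "z \<in> V"
  obtains g c where "g \<bullet> z + c = 1" "\<And>w. w \<in> V - {z} \<Longrightarrow> g \<bullet> w + c = 0"
proof (cases "V = {z}")
  case True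
  then show ?thesis using that[of 0 1] by auto
next
  case False
  with assms(2) obtain w0 where w0: "w0 \<in> V" "w0 \<noteq> z" by blast
  then have ind: "\<not> dependent ((\<lambda>x. -w0 + x) ` (V - {w0}))"
    using affine_dependent_iff_dependent2[OF w0(1)] assms(1) by blast
  obtain l :: "'a \<Rightarrow> real" where l: "linear l"
    "\<forall>x\<in>(\<lambda>x. -w0 + x) ` (V - {w0}). l x = (if x = -w0 + z then 1 else 0)"
    using linear_independent_extend[OF ind, of "\<lambda>x. if x = -w0 + z then 1 else 0"] by blast
  have eq: "l x = adjoint l 1 \<bullet> x" for x
    using adjoint_works[OF l(1), of x 1] by (simp add: inner_commute)
  have l0: "l (-w0 + w) = adjoint l 1 \<bullet> w - adjoint l 1 \<bullet> w0" for w
    by (simp add: eq inner_diff_right inner_add_right)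
  show ?thesis
  proof (rule that[of "adjoint l 1" "- (adjoint l 1 \<bullet> w0)"])
    show "adjoint l 1 \<bullet> z + - (adjoint l 1 \<bullet> w0) = 1"
      using l(2) w0 assms(2) l0[of z] by auto
    show "adjoint l 1 \<bullet> w + - (adjoint l 1 \<bullet> w0) = 0" if "w \<in> V - {z}" for w
      using l(2) that l0[of w] by (cases "w = w0") auto
  qed
qed

locale full_simplex =
  fixes T :: "'a::euclidean_space set"
  assumes simp: "int DIM('a) simplex T"
begin

lemmas verts = simplex_verts[OF simp]

lemma bary_ex:
  assumes "z \<in> verts T"
  shows "(\<exists>g c. bary T z = (\<lambda>x. g \<bullet> x + c)) \<and> bary T z z = 1 \<and> (\<forall>w\<in>verts T - {z}. bary T z w = 0)"
proof -
  obtain g c where "g \<bullet> z + c = 1" "\<And>w. w \<in> verts T - {z} \<Longrightarrow> g \<bullet> w + c = 0"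
    using affine_independent_functional[OF verts(4) assms] by metis
  then show ?thesis unfolding bary_def
    by (intro someI[of "\<lambda>f. (\<exists>g c. f = (\<lambda>x. g \<bullet> x + c)) \<and> f z = 1 \<and> (\<forall>w\<in>verts T - {z}. f w = 0)"
          "\<lambda>x. g \<bullet> x + c"]) auto
qed

lemma bary_affine:
  assumes "z \<in> verts T"
  obtains g c where "bary T z = (\<lambda>x. g \<bullet> x + c)"
  using bary_ex[OF assms] by blast

lemma bary_vertex: "z \<in> verts T \<Longrightarrow> w \<in> verts T \<Longrightarrow> bary T z w = (if w = z then 1 else 0)"
  using bary_ex by auto

lemma bary_affine_sum:
  assumes "z \<in> verts T" "(\<Sum>i\<in>I. u i) = 1"
  shows "bary T z (\<Sum>i\<in>I. u i *\<^sub>R p i) = (\<Sum>i\<in>I. u i * bary T z (p i))"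
proof -
  obtain g c where gc: "bary T z = (\<lambda>x. g \<bullet> x + c)" using bary_affine[OF assms(1)] .
  have "(\<Sum>i\<in>I. u i * (g \<bullet> p i + c)) = (\<Sum>i\<in>I. u i * (g \<bullet> p i)) + (\<Sum>i\<in>I. u i) * c"
    by (simp add: distrib_left sum.distrib sum_distrib_right)
  then show ?thesis using assms(2) by (simp add: gc inner_sum_right)
qed

lemma bary_verts_sum:
  assumes "z \<in> verts T" "(\<Sum>w\<in>verts T. u w) = 1"
  shows "bary T z (\<Sum>w\<in>verts T. u w *\<^sub>R w) = u z"
proof -
  have "bary T z (\<Sum>w\<in>verts T. u w *\<^sub>R w) = (\<Sum>w\<in>verts T. u w * bary T z w)"
    using bary_affine_sum[OF assms] .
  also have "\<dots> = (\<Sum>w\<in>verts T. if w = z then u w else 0)"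
    using assms(1) by (intro sum.cong) (auto simp: bary_vertex)
  also have "\<dots> = u z" using assms(1) verts(1) by simp
  finally show ?thesis .
qed

lemma bary_repr: "(\<Sum>z\<in>verts T. bary T z x) = 1" "(\<Sum>z\<in>verts T. bary T z x *\<^sub>R z) = x"
proof -
  have "x \<in> affine hull verts T" using verts(5) by simp
  then obtain u where u: "(\<Sum>w\<in>verts T. u w) = 1" "(\<Sum>w\<in>verts T. u w *\<^sub>R w) = x"
    using affine_hull_finite[OF verts(1)] by auto
  have "bary T z x = u z" if "z \<in> verts T" for z
    using bary_verts_sum[OF that u(1)] u(2) by simp
  with u show "(\<Sum>z\<in>verts T. bary T z x) = 1" "(\<Sum>z\<in>verts T. bary T z x *\<^sub>R z) = x"
    by simp_all
qed

lemma in_simplex_iff: "x \<in> T \<longleftrightarrow> (\<forall>z\<in>verts T. 0 \<le> bary T z x)"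
proof
  assume "x \<in> T"
  then have "x \<in> convex hull verts T" using verts(3) by simp
  then obtain u where u: "\<forall>w\<in>verts T. 0 \<le> u w" "(\<Sum>w\<in>verts T. u w) = 1"
      "(\<Sum>w\<in>verts T. u w *\<^sub>R w) = x"
    using convex_hull_finite[OF verts(1)] by auto
  then show "\<forall>z\<in>verts T. 0 \<le> bary T z x" using bary_verts_sum by force
next
  assume "\<forall>z\<in>verts T. 0 \<le> bary T z x"
  then have "x \<in> convex hull verts T"
    using bary_repr[of x] convex_hull_finite[OF verts(1)] by auto
  then show "x \<in> T" using verts(3) by simp
qed

lemma bary_nonneg: "x \<in> T \<Longrightarrow> z \<in> verts T \<Longrightarrow> 0 \<le> bary T z x"
  using in_simplex_iff by blast

lemma bary_le_1:
  assumes "x \<in> T" "z \<in> verts T" shows "bary T z x \<le> 1"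
proof -
  have "bary T z x \<le> (\<Sum>z\<in>verts T. bary T z x)"
    using assms verts(1) by (intro member_le_sum) (auto intro: bary_nonneg)
  then show ?thesis using bary_repr by simp
qed

text \<open>A step of length \<open>r\<close> from \<open>c\<close> along the gradient stays in
  \<open>T\<close>, where the coordinate lies between 0 and 1; hence the gradient has norm at most
  \<open>1 / r\<close>. The slope bounds for polynomials and for the cut-off rest on this.\<close>

lemma bary_lipschitz:
  assumes r: "0 < r" "cball c r \<subseteq> T" and z: "z \<in> verts T"
  shows "\<bar>bary T z x - bary T z y\<bar> \<le> norm (x - y) / r"
proof -
  obtain g c0 where gc: "bary T z = (\<lambda>x. g \<bullet> x + c0)" using bary_affine[OF z] .
  have "norm g \<le> 1 / r"
  proof (cases "g = 0")
    case False
    define u where "u = (r / norm g) *\<^sub>R g"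
    have nu: "norm u = r" using False r by (simp add: u_def)
    have "c + u \<in> T" "c \<in> T" using r nu by (auto simp: subset_eq dist_norm)
    then have "bary T z (c + u) - bary T z c \<le> 1"
      using bary_le_1[OF _ z] bary_nonneg[OF _ z] by (smt (verit))
    then have "g \<bullet> u \<le> 1" by (simp add: gc inner_add_right)
    moreover have "g \<bullet> u = r * norm g"
      using False by (simp add: u_def dot_square_norm power2_eq_square)
    ultimately show ?thesis using r by (simp add: field_simps)
  qed (use r in auto)
  moreover have "\<bar>bary T z x - bary T z y\<bar> = \<bar>g \<bullet> (x - y)\<bar>" by (simp add: gc inner_diff_right)
  moreover have "\<bar>g \<bullet> (x - y)\<bar> \<le> norm g * norm (x - y)" by (rule Cauchy_Schwarz_ineq2)
  ultimately have "\<bar>bary T z x - bary T z y\<bar> \<le> 1 / r * norm (x - y)"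
    by (metis mult_right_mono norm_ge_zero order_trans)
  then show ?thesis by simp
qed

text \<open>The coordinate of \<open>z\<close> drops from 1 to 0 between the two vertices, with
  slope at most \<open>1 / r\<close>. This bounds edge lengths from below.\<close>

lemma verts_far:
  assumes r: "0 < r" "cball c r \<subseteq> T" and "z \<in> verts T" "w \<in> verts T" "z \<noteq> w"
  shows "r \<le> norm (z - w)"
  using bary_lipschitz[OF r assms(3), of z w] assms by (auto simp: bary_vertex field_simps)

lemma face_verts:
  assumes "F face_of T"
  shows "verts F = verts T \<inter> F" "F = convex hull verts F"
proof -
  show "verts F = verts T \<inter> F" using extreme_point_of_face[OF assms] by auto
  have "compact T" "convex T" using simp compact_simplex convex_simplex by auto
  then show "F = convex hull verts F"
    using Krein_Milman_Minkowski face_of_imp_compact face_of_imp_convex assms by blast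
qed

text \<open>A representation of \<open>x\<close> by the vertices of \<open>F\<close>, padded with
  zero weights, is one by the vertices of \<open>T\<close>, and such a representation is
  unique.\<close>

lemma bary_face:
  assumes F: "F face_of T" "x \<in> F"
  shows "z \<in> verts T \<Longrightarrow> z \<notin> F \<Longrightarrow> bary T z x = 0"
    and "\<exists>u. (\<forall>w\<in>verts F. 0 \<le> u w) \<and> sum u (verts F) = 1 \<and> (\<Sum>w\<in>verts F. u w *\<^sub>R w) = x"
    and "\<And>u. sum u (verts F) = 1 \<Longrightarrow> (\<Sum>w\<in>verts F. u w *\<^sub>R w) = x \<Longrightarrow> z \<in> verts T \<Longrightarrow> z \<in> F \<Longrightarrow> bary T z x = u z"
proof -
  have fin: "finite (verts F)" using face_verts(1)[OF F(1)] verts(1) by simp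
  show ex: "\<exists>u. (\<forall>w\<in>verts F. 0 \<le> u w) \<and> sum u (verts F) = 1 \<and> (\<Sum>w\<in>verts F. u w *\<^sub>R w) = x"
    using F(2) face_verts(2)[OF F(1)] convex_hull_finite[OF fin] by auto
  have *: "bary T z x = (if z \<in> F then u z else 0)" if z: "z \<in> verts T" and
     u: "sum u (verts F) = 1" "(\<Sum>w\<in>verts F. u w *\<^sub>R w) = x" for u z
  proof -
    have "bary T z x = (\<Sum>w\<in>verts F. u w * bary T z w)"
      using bary_affine_sum[OF z u(1), of "\<lambda>w. w"] u(2) by simp
    also have "\<dots> = (\<Sum>w\<in>verts F. if w = z then u w else 0)"
      using z face_verts(1)[OF F(1)] by (intro sum.cong) (auto simp: bary_vertex)
    also have "\<dots> = (if z \<in> F then u z else 0)" using z face_verts(1)[OF F(1)] fin by auto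
    finally show ?thesis .
  qed
  show "z \<in> verts T \<Longrightarrow> z \<notin> F \<Longrightarrow> bary T z x = 0" using ex * by metis
  show "\<And>u. sum u (verts F) = 1 \<Longrightarrow> (\<Sum>w\<in>verts F. u w *\<^sub>R w) = x \<Longrightarrow> z \<in> verts T \<Longrightarrow> z \<in> F \<Longrightarrow> bary T z x = u z"
    using * by simp
qed

end

text \<open>Both sides are coefficients of one representation of \<open>x\<close> by the vertices of
  the common face. This makes functions defined cell by cell from barycentric coordinates agree
  across faces.\<close>

lemma bary_common_face:
  assumes "full_simplex T" "full_simplex T'" "T \<inter> T' face_of T" "T \<inter> T' face_of T'"
    and "x \<in> T" "x \<in> T'" "z \<in> verts T"
  shows "bary T z x = (if z \<in> verts T' then bary T' z x else 0)"
proof (cases "z \<in> T'")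
  case True
  have z: "z \<in> T" using full_simplex.verts(6)[OF assms(1)] assms(7) by auto
  have "z \<in> verts (T \<inter> T')" using full_simplex.face_verts(1)[OF assms(1,3)] assms(7) z True by auto
  then have z': "z \<in> verts T'" using full_simplex.face_verts(1)[OF assms(2,4)] by auto
  obtain u where u: "sum u (verts (T \<inter> T')) = 1" "(\<Sum>w\<in>verts (T \<inter> T'). u w *\<^sub>R w) = x"
    using full_simplex.bary_face(2)[OF assms(1,3)] assms(5,6) by blast
  show ?thesis
    using full_simplex.bary_face(3)[OF assms(1,3) _ u assms(7)]
      full_simplex.bary_face(3)[OF assms(2,4) _ u z'] z z' True assms(5,6) by auto
next
  case False
  then have "z \<notin> verts T'" using full_simplex.verts(6)[OF assms(2)] by auto
  then show ?thesis using full_simplex.bary_face(1)[OF assms(1,3)] assms(5-7) False by auto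
qed

section \<open>Polynomials of bounded degree\<close>

lemma polysI:
  assumes "\<And>x. p x = (\<Sum>\<alpha>\<in>{\<alpha> \<in> Basis \<rightarrow>\<^sub>E {..k}. (\<Sum>b\<in>Basis. \<alpha> b) \<le> k}.
    c \<alpha> * (\<Prod>b\<in>Basis. (x \<bullet> b) ^ \<alpha> b))"
  shows "p \<in> polys k"
  using assms unfolding polys_def by (auto simp: fun_eq_iff intro!: exI[of _ c])

lemma polys_monomial:
  assumes "(\<Sum>b\<in>Basis. \<alpha> b) \<le> k"
  shows "(\<lambda>x::'a::euclidean_space. \<Prod>b\<in>Basis. (x \<bullet> b) ^ \<alpha> b) \<in> polys k"
proof -
  let ?I = "{\<alpha> \<in> (Basis::'a set) \<rightarrow>\<^sub>E {..k}. (\<Sum>b\<in>Basis. \<alpha> b) \<le> k}"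
  have le: "\<alpha> b \<le> k" if "b \<in> Basis" for b
    using assms member_le_sum[OF that, of \<alpha>] by simp
  have fin: "finite ?I" by (rule finite_subset[OF _ finite_PiE[of Basis "\<lambda>_. {..k}"]]) auto
  have mem: "restrict \<alpha> Basis \<in> ?I" using assms le by auto
  have "(\<Prod>b\<in>Basis. (x \<bullet> b) ^ \<alpha> b) =
    (\<Sum>\<beta>\<in>?I. (if \<beta> = restrict \<alpha> Basis then 1 else 0) * (\<Prod>b\<in>Basis. (x \<bullet> b) ^ \<beta> b))" for x :: 'a
  proof -
    have "(\<Sum>\<beta>\<in>?I. (if \<beta> = restrict \<alpha> Basis then 1 else 0) * (\<Prod>b\<in>Basis. (x \<bullet> b) ^ \<beta> b))
       = (\<Sum>\<beta>\<in>?I. if \<beta> = restrict \<alpha> Basis then (\<Prod>b\<in>Basis. (x \<bullet> b) ^ \<beta> b) else 0)"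
      by (intro sum.cong) auto
    also have "\<dots> = (\<Prod>b\<in>Basis. (x \<bullet> b) ^ restrict \<alpha> Basis b)"
      using fin mem by simp
    also have "\<dots> = (\<Prod>b\<in>Basis. (x \<bullet> b) ^ \<alpha> b)" by (intro prod.cong) auto
    finally show ?thesis by simp
  qed
  then show ?thesis by (rule polysI)
qed

lemma polys_add:
  assumes "p \<in> polys k" "q \<in> polys k"
  shows "(\<lambda>x. p x + q x) \<in> polys k"
proof -
  obtain c d where cd:
    "p = (\<lambda>x. \<Sum>\<alpha>\<in>{\<alpha> \<in> Basis \<rightarrow>\<^sub>E {..k}. (\<Sum>b\<in>Basis. \<alpha> b) \<le> k}. c \<alpha> * (\<Prod>b\<in>Basis. (x \<bullet> b) ^ \<alpha> b))"
    "q = (\<lambda>x. \<Sum>\<alpha>\<in>{\<alpha> \<in> Basis \<rightarrow>\<^sub>E {..k}. (\<Sum>b\<in>Basis. \<alpha> b) \<le> k}. d \<alpha> * (\<Prod>b\<in>Basis. (x \<bullet> b) ^ \<alpha> b))"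
    using assms unfolding polys_def by blast
  show ?thesis
    by (rule polysI[where c = "\<lambda>\<alpha>. c \<alpha> + d \<alpha>"]) (simp add: cd distrib_right sum.distrib)
qed

lemma polys_cmult:
  assumes "p \<in> polys k"
  shows "(\<lambda>x. a * p x) \<in> polys k"
proof -
  obtain c where c:
    "p = (\<lambda>x. \<Sum>\<alpha>\<in>{\<alpha> \<in> Basis \<rightarrow>\<^sub>E {..k}. (\<Sum>b\<in>Basis. \<alpha> b) \<le> k}. c \<alpha> * (\<Prod>b\<in>Basis. (x \<bullet> b) ^ \<alpha> b))"
    using assms unfolding polys_def by blast
  show ?thesis
    by (rule polysI[where c = "\<lambda>\<alpha>. a * c \<alpha>"]) (simp add: c sum_distrib_left mult.assoc)
qed

lemma polys_zero: "(\<lambda>x. 0) \<in> polys k"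
  using polys_cmult[of "\<lambda>x. \<Prod>b\<in>Basis. (x \<bullet> b) ^ (0::nat)" k 0] polys_monomial[of "\<lambda>_. 0" k] by simp

lemma polys_sum: "(\<And>i. i \<in> I \<Longrightarrow> p i \<in> polys k) \<Longrightarrow> (\<lambda>x. \<Sum>i\<in>I. p i x) \<in> polys k"
  by (induction I rule: infinite_finite_induct) (auto intro: polys_zero polys_add)

lemma polys_diff: "p \<in> polys k \<Longrightarrow> q \<in> polys k \<Longrightarrow> (\<lambda>x. p x - q x) \<in> polys k"
  using polys_add[of p k "\<lambda>x. (-1) * q x"] polys_cmult[of q k "-1"] by simp

lemma polys_induct [consumes 1, case_names monomial add cmult]:
  fixes p :: "'a::euclidean_space \<Rightarrow> real"
  assumes "p \<in> polys k"
    and mon: "\<And>\<alpha>. (\<Sum>b\<in>Basis. \<alpha> b) \<le> k \<Longrightarrow> P (\<lambda>x. \<Prod>b\<in>Basis. (x \<bullet> b) ^ \<alpha> b)"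
    and add: "\<And>p q. P p \<Longrightarrow> P q \<Longrightarrow> P (\<lambda>x. p x + q x)"
    and cm: "\<And>a p. P p \<Longrightarrow> P (\<lambda>x. a * p x)"
  shows "P p"
proof -
  let ?I = "{\<alpha> \<in> (Basis::'a set) \<rightarrow>\<^sub>E {..k}. (\<Sum>b\<in>Basis. \<alpha> b) \<le> k}"
  obtain c where p: "p = (\<lambda>x. \<Sum>\<alpha>\<in>?I. c \<alpha> * (\<Prod>b\<in>Basis. (x \<bullet> b) ^ \<alpha> b))"
    using assms(1) unfolding polys_def by blast
  have z: "P (\<lambda>x. 0)" using cm[OF mon[of "\<lambda>_. 0"], of 0] by simp
  have "P (\<lambda>x. \<Sum>\<alpha>\<in>J. c \<alpha> * (\<Prod>b\<in>Basis. (x \<bullet> b) ^ \<alpha> b))" if "J \<subseteq> ?I" for J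
    using that
  proof (induction J rule: infinite_finite_induct)
    case (insert \<alpha> J)
    have "P (\<lambda>x. c \<alpha> * (\<Prod>b\<in>Basis. (x \<bullet> b) ^ \<alpha> b))" using insert(4) by (intro cm mon) auto
    from add[OF this insert(3)] show ?case using insert by simp
  qed (use z in auto)
  then show ?thesis using p by simp
qed

lemma monomial_coord_mult:
  assumes "b0 \<in> Basis"
  shows "(x \<bullet> b0) * (\<Prod>b\<in>Basis. (x \<bullet> b) ^ \<alpha> b) = (\<Prod>b\<in>Basis. (x \<bullet> b) ^ (\<alpha>(b0 := Suc (\<alpha> b0))) b)"
    and "(\<Sum>b\<in>Basis. (\<alpha>(b0 := Suc (\<alpha> b0))) b) = Suc (\<Sum>b\<in>Basis. \<alpha> b)"
  using assms by (simp_all add: prod.remove[of Basis b0] sum.remove[of Basis b0])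

text \<open>The degree is an argument of \<open>P\<close>, so that an induction that multiplies by
  one coordinate at a time can track the exact degree instead of a fixed bound
  \<open>k\<close>.\<close>

lemma monomial_induct [case_names zero Suc]:
  fixes P :: "nat \<Rightarrow> ('a::euclidean_space \<Rightarrow> real) \<Rightarrow> bool"
  assumes zero: "P 0 (\<lambda>x. 1)"
    and Suc: "\<And>\<alpha> b. b \<in> Basis \<Longrightarrow> P (\<Sum>b\<in>Basis. \<alpha> b) (\<lambda>x. \<Prod>b\<in>Basis. (x \<bullet> b) ^ \<alpha> b) \<Longrightarrow>
       P (Suc (\<Sum>b\<in>Basis. \<alpha> b)) (\<lambda>x. (x \<bullet> b) * (\<Prod>b\<in>Basis. (x \<bullet> b) ^ \<alpha> b))"
  shows "P (\<Sum>b\<in>Basis. \<alpha> b) (\<lambda>x. \<Prod>b\<in>Basis. (x \<bullet> b) ^ \<alpha> b)"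
proof (induction "\<Sum>b\<in>(Basis::'a set). \<alpha> b" arbitrary: \<alpha>)
  case 0
  then have "\<forall>b\<in>(Basis::'a set). \<alpha> b = 0" by simp
  then show ?case using zero by simp
next
  case (Suc m)
  then obtain b0 where b0: "b0 \<in> Basis" "\<alpha> b0 > 0"
    by (metis Zero_not_Suc bot_nat_0.not_eq_extremum sum.neutral)
  define \<beta> where "\<beta> = \<alpha>(b0 := \<alpha> b0 - 1)"
  have \<alpha>: "\<alpha> = \<beta>(b0 := Suc (\<beta> b0))" using b0 by (auto simp: \<beta>_def)
  have s: "(\<Sum>b\<in>Basis. \<alpha> b) = Suc (\<Sum>b\<in>Basis. \<beta> b)"
    using monomial_coord_mult(2)[OF b0(1), of \<beta>] \<alpha> by simp
  then have "P (\<Sum>b\<in>Basis. \<beta> b) (\<lambda>x. \<Prod>b\<in>Basis. (x \<bullet> b) ^ \<beta> b)"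
    using Suc(1)[of \<beta>] Suc(2) by simp
  from assms(2)[OF b0(1) this] show ?case
    using monomial_coord_mult(1)[OF b0(1), of _ \<beta>] \<alpha> s by simp
qed

lemma polys_coord_mult:
  assumes "p \<in> polys k" "b0 \<in> Basis"
  shows "(\<lambda>x. (x \<bullet> b0) * p x) \<in> polys (Suc k)"
  using assms(1)
proof (induction rule: polys_induct)
  case (monomial \<alpha>)
  show ?case unfolding monomial_coord_mult(1)[OF assms(2)]
    by (rule polys_monomial) (use monomial monomial_coord_mult(2)[OF assms(2), of \<alpha>] in simp)
next
  case (add p q)
  then show ?case using polys_add by (fastforce simp: distrib_left)
next
  case (cmult a p)
  then show ?case using polys_cmult[of _ _ a] by (fastforce simp: mult.left_commute)
qed

lemma polys_mono: "p \<in> polys k \<Longrightarrow> k \<le> m \<Longrightarrow> p \<in> polys m"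
  by (induction rule: polys_induct) (auto intro: polys_monomial polys_add polys_cmult)

lemma polys_const: "(\<lambda>x. a) \<in> polys k"
  using polys_cmult[OF polys_monomial[of "\<lambda>_. 0" k], of a] by simp

lemma polys_affine_mult:
  fixes p :: "'a::euclidean_space \<Rightarrow> real"
  assumes "p \<in> polys k"
  shows "(\<lambda>x. (g \<bullet> x + c) * p x) \<in> polys (Suc k)"
proof -
  have "(g \<bullet> x + c) * p x = (\<Sum>b\<in>Basis. (g \<bullet> b) * ((x \<bullet> b) * p x)) + c * p x" for x
    by (simp add: euclidean_inner[of g x] distrib_right sum_distrib_right mult.assoc)
  moreover have "(\<lambda>x. (\<Sum>b\<in>Basis. (g \<bullet> b) * ((x \<bullet> b) * p x)) + c * p x) \<in> polys (Suc k)"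
    by (intro polys_add polys_sum polys_cmult polys_coord_mult assms polys_mono[OF assms]) auto
  ultimately show ?thesis by simp
qed

text \<open>The components are kept in \<open>polys k\<close> without lowering the degree, so that
  estimates for \<open>polys k\<close> apply to a function and to its gradient with the same
  constant.\<close>

lemma polys_has_gradient:
  fixes p :: "'a::euclidean_space \<Rightarrow> real"
  assumes "p \<in> polys k"
  obtains G where "\<And>x. (p has_derivative (\<lambda>h. G x \<bullet> h)) (at x)"
    "\<And>b. b \<in> Basis \<Longrightarrow> (\<lambda>x. G x \<bullet> b) \<in> polys k"
proof -
  let ?P = "\<lambda>k p. p \<in> polys k \<and> (\<exists>G. (\<forall>x. (p has_derivative (\<lambda>h. G x \<bullet> h)) (at x)) \<and> (\<forall>b\<in>Basis. (\<lambda>x. G x \<bullet> b) \<in> polys k))"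
  have "?P k p"
    using assms
  proof (induction rule: polys_induct)
    case (monomial \<alpha>)
    have "?P (\<Sum>b\<in>Basis. \<alpha> b) (\<lambda>x::'a. \<Prod>b\<in>Basis. (x \<bullet> b) ^ \<alpha> b)"
    proof (induction rule: monomial_induct)
      case zero
      have "(\<bullet>) (0::'a) = (\<lambda>h. 0)" by (simp add: fun_eq_iff)
      then show ?case by (auto intro!: polys_const exI[of _ "\<lambda>_. 0"])
    next
      case (Suc \<alpha> b)
      let ?m = "\<lambda>x::'a. \<Prod>b\<in>Basis. (x \<bullet> b) ^ \<alpha> b"
      obtain G where G: "\<And>x. (?m has_derivative (\<lambda>h. G x \<bullet> h)) (at x)"
        "\<And>b. b \<in> Basis \<Longrightarrow> (\<lambda>x. G x \<bullet> b) \<in> polys (\<Sum>b\<in>Basis. \<alpha> b)" and m: "?m \<in> polys (\<Sum>b\<in>Basis. \<alpha> b)"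
        using Suc(2) by auto
      have "((\<lambda>x. (x \<bullet> b) * ?m x) has_derivative (\<lambda>h. ((x \<bullet> b) *\<^sub>R G x + ?m x *\<^sub>R b) \<bullet> h)) (at x)" for x
      proof -
        have "((\<lambda>x. x \<bullet> b) has_derivative (\<lambda>h. h \<bullet> b)) (at x)"
          by (rule bounded_linear_imp_has_derivative) (rule bounded_linear_inner_left)
        from has_derivative_mult[OF this G(1)[of x]] show ?thesis
          by (rule has_derivative_eq_rhs) (simp add: fun_eq_iff inner_add_left inner_commute[of b])
      qed
      moreover have "(\<lambda>x. ((x \<bullet> b) *\<^sub>R G x + ?m x *\<^sub>R b) \<bullet> b') \<in> polys (Suc (\<Sum>b\<in>Basis. \<alpha> b))" if "b' \<in> Basis" for b'
      proof -
        have "(\<lambda>x. (x \<bullet> b) * (G x \<bullet> b') + (b \<bullet> b') * ?m x) \<in> polys (Suc (\<Sum>b\<in>Basis. \<alpha> b))"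
          by (intro polys_add polys_coord_mult G(2) Suc(1) that polys_cmult polys_mono[OF m]) simp
        then show ?thesis by (simp add: inner_add_left mult.commute)
      qed
      ultimately show ?case using polys_coord_mult[OF m Suc(1)]
        by (auto intro!: exI[of _ "\<lambda>x. (x \<bullet> b) *\<^sub>R G x + ?m x *\<^sub>R b"])
    qed
    then obtain G where "\<forall>x. ((\<lambda>x::'a. \<Prod>b\<in>Basis. (x \<bullet> b) ^ \<alpha> b) has_derivative (\<lambda>h. G x \<bullet> h)) (at x)"
      "\<forall>b\<in>Basis. (\<lambda>x. G x \<bullet> b) \<in> polys (\<Sum>b\<in>Basis. \<alpha> b)"
      by blast
    then show ?case
      using polys_mono[OF _ monomial] polys_monomial[OF monomial] by (intro conjI exI[of _ G]) auto
  next
    case (add p q)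
    then obtain G H where G: "\<And>x. (p has_derivative (\<lambda>h. G x \<bullet> h)) (at x)" "\<And>b. b \<in> Basis \<Longrightarrow> (\<lambda>x. G x \<bullet> b) \<in> polys k"
      and H: "\<And>x. (q has_derivative (\<lambda>h. H x \<bullet> h)) (at x)" "\<And>b. b \<in> Basis \<Longrightarrow> (\<lambda>x. H x \<bullet> b) \<in> polys k"
      by blast
    have "((\<lambda>x. p x + q x) has_derivative (\<lambda>h. (G x + H x) \<bullet> h)) (at x)" for x
      using has_derivative_add[OF G(1)[of x] H(1)[of x]] by (simp add: inner_add_left)
    moreover have "(\<lambda>x. (G x + H x) \<bullet> b) \<in> polys k" if "b \<in> Basis" for b
      using polys_add[OF G(2) H(2), OF that that] by (simp add: inner_add_left)
    ultimately show ?case using add polys_add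
      by (auto intro!: exI[of _ "\<lambda>x. G x + H x"])
  next
    case (cmult a p)
    then obtain G where G: "\<And>x. (p has_derivative (\<lambda>h. G x \<bullet> h)) (at x)" "\<And>b. b \<in> Basis \<Longrightarrow> (\<lambda>x. G x \<bullet> b) \<in> polys k"
      by blast
    have "((\<lambda>x. a * p x) has_derivative (\<lambda>h. (a *\<^sub>R G x) \<bullet> h)) (at x)" for x
      using has_derivative_mult_right[OF G(1)[of x], of a] by simp
    moreover have "(\<lambda>x. (a *\<^sub>R G x) \<bullet> b) \<in> polys k" if "b \<in> Basis" for b
      using polys_cmult[OF G(2), OF that] by simp
    ultimately show ?case using cmult polys_cmult
      by (auto intro!: exI[of _ "\<lambda>x. a *\<^sub>R G x"])
  qed
  then show ?thesis using that by blast
qed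

section \<open>Interpolation on the principal lattice\<close>

text \<open>At a lattice node \<open>real k * bary T z \<xi>\<close> is a natural number and the
  rounding is exact. A vanishing coordinate gives index zero, which matters for nodes on
  faces.\<close>

definition lattice_index :: "nat \<Rightarrow> 'a::euclidean_space set \<Rightarrow> 'a \<Rightarrow> 'a \<Rightarrow> nat" where
  "lattice_index k T \<xi> z = nat \<lfloor>real k * bary T z \<xi>\<rfloor>"

text \<open>At a lattice node the generalised binomials become ordinary binomial coefficients, which
  vanish as soon as an index of the node is smaller than the corresponding entry of
  \<alpha>.\<close>

definition newton_poly :: "nat \<Rightarrow> 'a::euclidean_space set \<Rightarrow> ('a \<Rightarrow> nat) \<Rightarrow> 'a \<Rightarrow> real" where
  "newton_poly k T \<alpha> x = (\<Prod>z\<in>verts T. (real k * bary T z x) gchoose \<alpha> z)"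

text \<open>The classical nodal basis of the principal lattice, usually written as a product of
  factors (k \<lambda> - i) / (i + 1) in the barycentric coordinates \<lambda>.\<close>

definition lagrange_poly :: "nat \<Rightarrow> 'a::euclidean_space set \<Rightarrow> 'a \<Rightarrow> 'a \<Rightarrow> real" where
  "lagrange_poly k T \<xi> = newton_poly k T (lattice_index k T \<xi>)"

text \<open>\<open>k\<close> is the resolution of the lattice and \<open>m\<close> a bound for the
  degree. They are separate because spanning is shown by raising the degree one factor at a time on
  a fixed lattice.\<close>

inductive_set newton_span :: "nat \<Rightarrow> 'a::euclidean_space set \<Rightarrow> nat \<Rightarrow> ('a \<Rightarrow> real) set"
  for k T m where
  newton: "sum \<alpha> (verts T) \<le> m \<Longrightarrow> newton_poly k T \<alpha> \<in> newton_span k T m"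
| add: "p \<in> newton_span k T m \<Longrightarrow> q \<in> newton_span k T m \<Longrightarrow> (\<lambda>x. p x + q x) \<in> newton_span k T m"
| cmult: "p \<in> newton_span k T m \<Longrightarrow> (\<lambda>x. a * p x) \<in> newton_span k T m"

lemma newton_span_sum:
  assumes "\<And>i. i \<in> I \<Longrightarrow> p i \<in> newton_span k T m"
  shows "(\<lambda>x. \<Sum>i\<in>I. p i x) \<in> newton_span k T m"
proof -
  have z: "(\<lambda>x. 0 * newton_poly k T (\<lambda>_. 0) x) \<in> newton_span k T m"
    by (intro newton_span.cmult newton_span.newton) simp
  show ?thesis
    using assms
  proof (induction I rule: infinite_finite_induct)
    case (insert i I)
    then have "(\<lambda>x. p i x + (\<Sum>i\<in>I. p i x)) \<in> newton_span k T m"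
      by (intro newton_span.add) auto
    then show ?case using insert by simp
  qed (use z in auto)
qed

context full_simplex
begin

lemma lattice_index_sum:
  assumes "sum \<alpha> (verts T) = k" "1 \<le> k" "z \<in> verts T"
  shows "real k * bary T z (\<Sum>z\<in>verts T. (real (\<alpha> z) / real k) *\<^sub>R z) = real (\<alpha> z)"
proof -
  have "(\<Sum>z\<in>verts T. real (\<alpha> z) / real k) = 1"
    using assms by (simp flip: sum_divide_distrib of_nat_sum)
  from bary_verts_sum[OF assms(3) this] show ?thesis using assms by simp
qed

lemma lagrange_nodes_iff:
  assumes "1 \<le> k"
  shows "\<xi> \<in> lagrange_nodes k T \<longleftrightarrow> \<xi> \<in> T \<and> (\<forall>z\<in>verts T. real k * bary T z \<xi> \<in> \<nat>)"
proof
  assume "\<xi> \<in> lagrange_nodes k T"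
  then obtain \<alpha> :: "'a \<Rightarrow> nat" where \<alpha>: "sum \<alpha> (verts T) = k" "\<xi> = (\<Sum>z\<in>verts T. (real (\<alpha> z) / real k) *\<^sub>R z)"
    unfolding lagrange_nodes_def by auto
  have b: "real k * bary T z \<xi> = real (\<alpha> z)" if "z \<in> verts T" for z
    using lattice_index_sum[OF \<alpha>(1) assms that] \<alpha>(2) by simp
  then have "0 \<le> bary T z \<xi>" if "z \<in> verts T" for z
    using that assms by (metis of_nat_0_le_iff of_nat_0_less_iff zero_le_mult_iff less_le_trans zero_less_one less_numeral_extra(1) not_le)
  then show "\<xi> \<in> T \<and> (\<forall>z\<in>verts T. real k * bary T z \<xi> \<in> \<nat>)"
    using b in_simplex_iff by auto
next
  assume *: "\<xi> \<in> T \<and> (\<forall>z\<in>verts T. real k * bary T z \<xi> \<in> \<nat>)"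
  then have "\<forall>z\<in>verts T. \<exists>n. real k * bary T z \<xi> = real n" by (auto elim: Nats_cases)
  then obtain \<alpha> where \<alpha>: "\<forall>z\<in>verts T. real k * bary T z \<xi> = real (\<alpha> z)"
    using bchoice by metis
  have "real (sum \<alpha> (verts T)) = real k * (\<Sum>z\<in>verts T. bary T z \<xi>)"
    using \<alpha> by (simp add: sum_distrib_left)
  then have s: "sum \<alpha> (verts T) = k"
    unfolding bary_repr(1) mult_1_right of_nat_eq_iff .
  have "\<xi> = (\<Sum>z\<in>verts T. bary T z \<xi> *\<^sub>R z)" using bary_repr(2) by simp
  also have "\<dots> = (\<Sum>z\<in>verts T. (real (\<alpha> z) / real k) *\<^sub>R z)"
    using \<alpha> assms by (intro sum.cong) (auto simp: field_simps)
  finally show "\<xi> \<in> lagrange_nodes k T" unfolding lagrange_nodes_def using s by auto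
qed

lemma lattice_index:
  assumes "1 \<le> k" "\<xi> \<in> lagrange_nodes k T"
  shows "z \<in> verts T \<Longrightarrow> real (lattice_index k T \<xi> z) = real k * bary T z \<xi>"
    and "sum (lattice_index k T \<xi>) (verts T) = k"
proof -
  show *: "real (lattice_index k T \<xi> z) = real k * bary T z \<xi>" if "z \<in> verts T" for z
  proof -
    have "real k * bary T z \<xi> \<in> \<nat>" using lagrange_nodes_iff[OF assms(1)] assms(2) that by blast
    then show ?thesis unfolding lattice_index_def by (auto elim!: Nats_cases)
  qed
  have "real (sum (lattice_index k T \<xi>) (verts T)) = real k * (\<Sum>z\<in>verts T. bary T z \<xi>)"
    using * by (simp add: sum_distrib_left)
  then show "sum (lattice_index k T \<xi>) (verts T) = k"
    unfolding bary_repr(1) mult_1_right of_nat_eq_iff .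
qed

lemma lattice_index_le:
  assumes "1 \<le> k" "\<xi> \<in> lagrange_nodes k T" "z \<in> verts T"
  shows "lattice_index k T \<xi> z \<le> k"
  using lattice_index(2)[OF assms(1,2)] member_le_sum[OF assms(3), of "lattice_index k T \<xi>"] verts(1) by simp

lemma lattice_index_inj:
  assumes "1 \<le> k" "\<xi> \<in> lagrange_nodes k T" "\<eta> \<in> lagrange_nodes k T"
    "\<And>z. z \<in> verts T \<Longrightarrow> lattice_index k T \<xi> z = lattice_index k T \<eta> z"
  shows "\<xi> = \<eta>"
proof -
  have "bary T z \<xi> = bary T z \<eta>" if "z \<in> verts T" for z
    using lattice_index(1)[OF assms(1,2) that] lattice_index(1)[OF assms(1,3) that] assms(1,4) that by simp
  then have "(\<Sum>z\<in>verts T. bary T z \<xi> *\<^sub>R z) = (\<Sum>z\<in>verts T. bary T z \<eta> *\<^sub>R z)" by simp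
  then show ?thesis unfolding bary_repr(2) .
qed

lemma lagrange_nodes_finite:
  assumes "1 \<le> k"
  shows "finite (lagrange_nodes k T)" "card (lagrange_nodes k T) \<le> Suc k ^ Suc DIM('a)"
proof -
  let ?f = "\<lambda>\<xi>. restrict (lattice_index k T \<xi>) (verts T)"
  have inj: "inj_on ?f (lagrange_nodes k T)"
  proof (rule inj_onI)
    fix \<xi> \<eta> assume *: "\<xi> \<in> lagrange_nodes k T" "\<eta> \<in> lagrange_nodes k T" "?f \<xi> = ?f \<eta>"
    have "lattice_index k T \<xi> z = lattice_index k T \<eta> z" if "z \<in> verts T" for z
      using fun_cong[OF *(3), of z] that by simp
    then show "\<xi> = \<eta>" using lattice_index_inj[OF assms *(1,2)] by blast
  qed
  have sub: "?f ` lagrange_nodes k T \<subseteq> verts T \<rightarrow>\<^sub>E {..k}"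
    using lattice_index_le[OF assms] by (intro image_subsetI) (simp add: PiE_iff)
  have fin: "finite (verts T \<rightarrow>\<^sub>E {..k})" using verts(1) by (intro finite_PiE) auto
  show "finite (lagrange_nodes k T)" using finite_subset[OF sub fin] finite_imageD[OF _ inj] by blast
  have "card (lagrange_nodes k T) \<le> card (verts T \<rightarrow>\<^sub>E {..k})"
    using card_inj_on_le[OF inj sub fin] .
  also have "\<dots> = Suc k ^ Suc DIM('a)" using verts(1,2) by (simp add: card_PiE)
  finally show "card (lagrange_nodes k T) \<le> Suc k ^ Suc DIM('a)" .
qed

lemma newton_poly_at_node:
  assumes "1 \<le> k" "\<xi> \<in> lagrange_nodes k T"
  shows "newton_poly k T \<alpha> \<xi> = (\<Prod>z\<in>verts T. real (lattice_index k T \<xi> z choose \<alpha> z))"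
  unfolding newton_poly_def using lattice_index(1)[OF assms]
  by (intro prod.cong) (auto simp: binomial_gbinomial)

text \<open>Of two different indices with the same total, the one of the node is strictly below
  \<alpha> in some entry, and there the binomial factor is zero.\<close>

lemma newton_poly_at_other_node:
  assumes "1 \<le> k" "\<xi> \<in> lagrange_nodes k T" "sum \<alpha> (verts T) = k" "z \<in> verts T" "lattice_index k T \<xi> z \<noteq> \<alpha> z"
  shows "newton_poly k T \<alpha> \<xi> = 0"
proof -
  have "\<exists>z\<in>verts T. lattice_index k T \<xi> z < \<alpha> z"
  proof (rule ccontr)
    assume "\<not> ?thesis"
    then have "\<forall>z\<in>verts T. \<alpha> z \<le> lattice_index k T \<xi> z" by auto
    moreover then have "\<alpha> z < lattice_index k T \<xi> z" using assms(4,5) by force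
    ultimately have "sum \<alpha> (verts T) < sum (lattice_index k T \<xi>) (verts T)"
      using verts(1) assms(4) by (intro sum_strict_mono_ex1) auto
    then show False using lattice_index(2)[OF assms(1,2)] assms(3) by simp
  qed
  then show ?thesis using newton_poly_at_node[OF assms(1,2)] verts(1) by (auto simp: binomial_eq_0)
qed

lemma lagrange_poly_at_node:
  assumes "1 \<le> k" "\<xi> \<in> lagrange_nodes k T" "\<eta> \<in> lagrange_nodes k T"
  shows "lagrange_poly k T \<xi> \<eta> = (if \<eta> = \<xi> then 1 else 0)"
proof (cases "\<eta> = \<xi>")
  case True
  then show ?thesis using newton_poly_at_node[OF assms(1,2)] by (simp add: lagrange_poly_def)
next
  case False
  then obtain z where "z \<in> verts T" "lattice_index k T \<eta> z \<noteq> lattice_index k T \<xi> z"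
    using lattice_index_inj[OF assms(1,3,2)] by blast
  then show ?thesis using newton_poly_at_other_node[OF assms(1,3) lattice_index(2)[OF assms(1,2)]] False
    by (simp add: lagrange_poly_def)
qed

lemma newton_poly_mult:
  assumes z: "z \<in> verts T"
  shows "(real k * bary T z x) * newton_poly k T \<alpha> x =
    real (\<alpha> z) * newton_poly k T \<alpha> x + real (Suc (\<alpha> z)) * newton_poly k T (\<alpha>(z := Suc (\<alpha> z))) x"
proof -
  let ?r = "\<Prod>w\<in>verts T - {z}. (real k * bary T w x) gchoose \<alpha> w"
  have n: "newton_poly k T \<beta> x = ((real k * bary T z x) gchoose \<beta> z) * ?r"
    if "\<And>w. w \<noteq> z \<Longrightarrow> \<beta> w = \<alpha> w" for \<beta>
  proof -
    have "newton_poly k T \<beta> x = ((real k * bary T z x) gchoose \<beta> z) *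
       (\<Prod>w\<in>verts T - {z}. (real k * bary T w x) gchoose \<beta> w)"
      unfolding newton_poly_def by (rule prod.remove[OF verts(1) z])
    also have "(\<Prod>w\<in>verts T - {z}. (real k * bary T w x) gchoose \<beta> w) = ?r"
      using that by (intro prod.cong) auto
    finally show ?thesis .
  qed
  let ?t = "real k * bary T z x"
  have "?t * newton_poly k T \<alpha> x = (?t * (?t gchoose \<alpha> z)) * ?r"
    by (simp only: n[of \<alpha>, OF refl] mult.assoc)
  also have "\<dots> = (real (\<alpha> z) * (?t gchoose \<alpha> z) + real (Suc (\<alpha> z)) * (?t gchoose Suc (\<alpha> z))) * ?r"
    by (simp only: gbinomial_mult_1)
  also have "\<dots> = real (\<alpha> z) * newton_poly k T \<alpha> x + real (Suc (\<alpha> z)) * newton_poly k T (\<alpha>(z := Suc (\<alpha> z))) x"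
    using n[of "\<alpha>(z := Suc (\<alpha> z))"] by (simp only: n[of \<alpha>, OF refl] distrib_right mult.assoc) simp
  finally show ?thesis .
qed

text \<open>Summing the previous identity over the vertices raises the degree, because the
  barycentric coordinates add up to one.\<close>

lemma newton_poly_raise:
  "(real k - real (sum \<alpha> (verts T))) * newton_poly k T \<alpha> x =
    (\<Sum>z\<in>verts T. real (Suc (\<alpha> z)) * newton_poly k T (\<alpha>(z := Suc (\<alpha> z))) x)"
proof -
  have "(\<Sum>z\<in>verts T. (real k * bary T z x) * newton_poly k T \<alpha> x) = real k * newton_poly k T \<alpha> x"
    by (simp only: sum_distrib_right[symmetric], simp only: sum_distrib_left[symmetric], simp add: bary_repr(1))
  moreover have "(\<Sum>z\<in>verts T. (real k * bary T z x) * newton_poly k T \<alpha> x) =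
     real (sum \<alpha> (verts T)) * newton_poly k T \<alpha> x +
     (\<Sum>z\<in>verts T. real (Suc (\<alpha> z)) * newton_poly k T (\<alpha>(z := Suc (\<alpha> z))) x)"
    by (simp add: newton_poly_mult sum.distrib sum_distrib_right del: of_nat_Suc)
  ultimately show ?thesis by (simp add: algebra_simps)
qed

lemma sum_upd: "z \<in> verts T \<Longrightarrow> sum (\<alpha>(z := Suc (\<alpha> z))) (verts T) = Suc (sum \<alpha> (verts T))"
  using verts(1) by (simp add: sum.remove)

text \<open>Downward induction on the degree. At total degree \<open>k\<close> the polynomial is
  itself a nodal basis function; below, \<open>newton_poly_raise\<close> writes it as a combination,
  with coefficients independent of \<open>x\<close>, of polynomials one degree higher for which the
  formula is known.\<close>

lemma newton_poly_interp:
  assumes "1 \<le> k" "sum \<alpha> (verts T) \<le> k"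
  shows "newton_poly k T \<alpha> x = (\<Sum>\<xi>\<in>lagrange_nodes k T. newton_poly k T \<alpha> \<xi> * lagrange_poly k T \<xi> x)"
  using assms(2)
proof (induction "k - sum \<alpha> (verts T)" arbitrary: \<alpha>)
  case 0
  then have s: "sum \<alpha> (verts T) = k" by simp
  define \<xi>0 where "\<xi>0 = (\<Sum>z\<in>verts T. (real (\<alpha> z) / real k) *\<^sub>R z)"
  have \<xi>0: "\<xi>0 \<in> lagrange_nodes k T" unfolding lagrange_nodes_def \<xi>0_def using s by auto
  have "lattice_index k T \<xi>0 z = \<alpha> z" if "z \<in> verts T" for z
    using lattice_index_sum[OF s assms(1) that] lattice_index(1)[OF assms(1) \<xi>0 that] by (simp add: \<xi>0_def)
  then have eq: "newton_poly k T \<alpha> = lagrange_poly k T \<xi>0"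
    by (auto simp: lagrange_poly_def newton_poly_def fun_eq_iff)
  have "(\<Sum>\<xi>\<in>lagrange_nodes k T. newton_poly k T \<alpha> \<xi> * lagrange_poly k T \<xi> x) =
     (\<Sum>\<xi>\<in>lagrange_nodes k T. if \<xi> = \<xi>0 then lagrange_poly k T \<xi>0 x else 0)"
    by (intro sum.cong) (auto simp: eq lagrange_poly_at_node[OF assms(1) \<xi>0])
  then show ?case using lagrange_nodes_finite(1)[OF assms(1)] \<xi>0 eq by simp
next
  case (Suc m)
  let ?u = "\<lambda>z. \<alpha>(z := Suc (\<alpha> z))"
  let ?I = "\<lambda>f x. \<Sum>\<xi>\<in>lagrange_nodes k T. f \<xi> * lagrange_poly k T \<xi> x"
  have IH: "newton_poly k T (?u z) x = ?I (newton_poly k T (?u z)) x" if "z \<in> verts T" for z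
    by (rule Suc(1)) (use Suc(2,3) sum_upd[OF that, of \<alpha>] in auto)
  let ?c = "real k - real (sum \<alpha> (verts T))"
  have c: "?c \<noteq> 0" using Suc(2) by linarith
  have "?c * newton_poly k T \<alpha> x = (\<Sum>z\<in>verts T. real (Suc (\<alpha> z)) * ?I (newton_poly k T (?u z)) x)"
    unfolding newton_poly_raise by (intro sum.cong refl) (simp only: IH)
  also have "\<dots> = (\<Sum>z\<in>verts T. \<Sum>\<xi>\<in>lagrange_nodes k T. real (Suc (\<alpha> z)) * newton_poly k T (?u z) \<xi> * lagrange_poly k T \<xi> x)"
    by (simp add: sum_distrib_left mult.assoc del: of_nat_Suc)
  also have "\<dots> = (\<Sum>\<xi>\<in>lagrange_nodes k T. \<Sum>z\<in>verts T. real (Suc (\<alpha> z)) * newton_poly k T (?u z) \<xi> * lagrange_poly k T \<xi> x)"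
    by (rule sum.swap)
  also have "\<dots> = (\<Sum>\<xi>\<in>lagrange_nodes k T. (?c * newton_poly k T \<alpha> \<xi>) * lagrange_poly k T \<xi> x)"
    unfolding newton_poly_raise by (simp only: sum_distrib_right)
  also have "\<dots> = ?c * ?I (newton_poly k T \<alpha>) x" by (simp add: sum_distrib_left mult.assoc)
  finally show ?case using c by simp
qed

lemma newton_span_interp:
  assumes "1 \<le> k" "p \<in> newton_span k T k"
  shows "p x = (\<Sum>\<xi>\<in>lagrange_nodes k T. p \<xi> * lagrange_poly k T \<xi> x)"
  using assms(2)
proof (induction arbitrary: x)
  case (newton \<alpha>)
  then show ?case using newton_poly_interp[OF assms(1)] by simp
next
  case (add p q)
  show ?case by (subst add.IH(1), subst add.IH(2)) (simp add: distrib_right sum.distrib)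
next
  case (cmult p a)
  show ?case by (subst cmult.IH) (simp add: sum_distrib_left mult.assoc)
qed

lemma newton_span_mono:
  assumes "p \<in> newton_span k T m" "m \<le> n" shows "p \<in> newton_span k T n"
  using assms by (induction) (auto intro: newton_span.intros)

lemma newton_span_bary_mult:
  assumes "p \<in> newton_span k T m" "z \<in> verts T"
  shows "(\<lambda>x. (real k * bary T z x) * p x) \<in> newton_span k T (Suc m)"
  using assms(1)
proof induction
  case (newton \<alpha>)
  then show ?case unfolding newton_poly_mult[OF assms(2)]
    using sum_upd[OF assms(2), of \<alpha>] by (intro newton_span.intros) auto
next
  case (add p q)
  show ?case using newton_span.add[OF add.IH] by (simp only: distrib_left)
next
  case (cmult p a)
  show ?case using newton_span.cmult[OF cmult.IH, of a] by (simp only: mult.left_commute[of a])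
qed

text \<open>Monomials are built up one coordinate at a time. A coordinate of \<open>x\<close> is the
  barycentric combination of the coordinates of the vertices, and multiplication by a barycentric
  coordinate raises the degree in \<open>newton_span\<close> by one.\<close>

lemma polys_subset_newton_span:
  assumes "1 \<le> k" "p \<in> polys m"
  shows "p \<in> newton_span k T m"
  using assms(2)
proof (induction rule: polys_induct)
  case (monomial \<alpha>)
  have "(\<lambda>x. \<Prod>b\<in>Basis. (x \<bullet> b) ^ \<alpha> b) \<in> newton_span k T (\<Sum>b\<in>Basis. \<alpha> b)"
  proof (induction rule: monomial_induct)
    case zero
    have "newton_poly k T (\<lambda>_. 0) = (\<lambda>x. 1)" by (simp add: newton_poly_def fun_eq_iff)
    then show ?case using newton_span.newton[of "\<lambda>_. 0" T 0 k] by auto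
  next
    case (Suc \<alpha> b)
    let ?m = "\<lambda>x. \<Prod>b\<in>Basis. (x \<bullet> b) ^ \<alpha> b"
    have "(x \<bullet> b) * ?m x = (\<Sum>z\<in>verts T. ((z \<bullet> b) / real k) * ((real k * bary T z x) * ?m x))" for x
    proof -
      have e: "x \<bullet> b = (\<Sum>z\<in>verts T. bary T z x * (z \<bullet> b))"
        by (subst bary_repr(2)[of x, symmetric]) (simp add: inner_sum_left)
      have "(x \<bullet> b) * ?m x = (\<Sum>z\<in>verts T. bary T z x * (z \<bullet> b) * ?m x)"
        unfolding e sum_distrib_right ..
      also have "\<dots> = (\<Sum>z\<in>verts T. ((z \<bullet> b) / real k) * ((real k * bary T z x) * ?m x))"
        using assms(1) by (intro sum.cong) auto
      finally show ?thesis .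
    qed
    moreover have "(\<lambda>x. \<Sum>z\<in>verts T. ((z \<bullet> b) / real k) * ((real k * bary T z x) * ?m x))
       \<in> newton_span k T (Suc (\<Sum>b\<in>Basis. \<alpha> b))"
      by (intro newton_span_sum newton_span.cmult newton_span_bary_mult Suc)
    ultimately show ?case by simp
  qed
  then show ?case using newton_span_mono monomial by blast
qed (auto intro: newton_span.intros)

lemma polys_interp:
  assumes "1 \<le> k" "p \<in> polys k"
  shows "p x = (\<Sum>\<xi>\<in>lagrange_nodes k T. p \<xi> * lagrange_poly k T \<xi> x)"
  using newton_span_interp[OF assms(1) polys_subset_newton_span[OF assms]] .

text \<open>The interpolation formula recovers a polynomial from its nodal values, so the nodes need
  not be counted against the dimension of \<open>polys k\<close>.\<close>

lemma polys_unisolvent: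
  assumes "1 \<le> k" "p \<in> polys k" "q \<in> polys k" "\<And>\<xi>. \<xi> \<in> lagrange_nodes k T \<Longrightarrow> p \<xi> = q \<xi>"
  shows "p = q"
proof
  fix x
  have "p x = (\<Sum>\<xi>\<in>lagrange_nodes k T. p \<xi> * lagrange_poly k T \<xi> x)"
    by (rule polys_interp[OF assms(1,2)])
  also have "\<dots> = (\<Sum>\<xi>\<in>lagrange_nodes k T. q \<xi> * lagrange_poly k T \<xi> x)"
    using assms(4) by simp
  also have "\<dots> = q x" by (rule polys_interp[OF assms(1,3), symmetric])
  finally show "p x = q x" .
qed

end

section \<open>Inverse estimates\<close>

lemma set_integrable_continuous_compact:
  fixes f :: "'a::euclidean_space \<Rightarrow> real"
  assumes "compact S" "continuous_on UNIV f"
  shows "set_integrable lebesgue S f"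
proof -
  have "compact (f ` S)" using assms compact_continuous_image continuous_on_subset by blast
  then obtain B where B: "\<forall>x\<in>S. norm (f x) \<le> B" using compact_imp_bounded bounded_iff by (metis imageI)
  have "f \<in> borel_measurable lborel" using assms(2) borel_measurable_continuous_onI by simp
  then have "f \<in> borel_measurable lebesgue" by (rule measurable_completion)
  moreover have "S \<in> lmeasurable" using assms(1) by (rule lmeasurable_compact)
  ultimately show ?thesis unfolding set_integrable_def
    using B by (intro integrableI_bounded_set_indicator[of _ _ _ B]) (auto simp: fmeasurable_def)
qed

lemma polys_continuous:
  assumes "p \<in> polys k" shows "continuous_on S p"
proof -
  obtain G where "\<And>x. (p has_derivative (\<lambda>h. G x \<bullet> h)) (at x)" using polys_has_gradient[OF assms] by metis
  then show ?thesis by (meson continuous_at_imp_continuous_on has_derivative_continuous)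
qed

text \<open>Each factor of the falling product, divided by \<open>k\<close>, has absolute value at
  most one because \<open>n \<le> k\<close>. A product of such factors is bounded by one, and a
  difference of products by the sum of the differences of the factors.\<close>

lemma gchoose_bounds:
  assumes "0 \<le> t" "t \<le> real k" "0 \<le> s" "s \<le> real k" "n \<le> k"
  shows "\<bar>t gchoose n\<bar> \<le> real k ^ n"
    and "\<bar>(t gchoose n) - (s gchoose n)\<bar> \<le> real k ^ n * (real n * (\<bar>t - s\<bar> / real k))"
proof -
  have "\<bar>t gchoose n\<bar> \<le> real k ^ n \<and> \<bar>(t gchoose n) - (s gchoose n)\<bar> \<le> real k ^ n * (real n * (\<bar>t - s\<bar> / real k))"
  proof (cases "k = 0")
    case False
    let ?f = "\<lambda>t. \<Prod>i<n. ((t - real i) / real k)"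
    have g: "t gchoose n = (real k ^ n / fact n) * ?f t" for t
      using False by (simp add: gbinomial_prod_rev prod_dividef lessThan_atLeast0)
    have le: "\<bar>(t - real i) / real k\<bar> \<le> 1" if "0 \<le> t" "t \<le> real k" "i < n" for t i
      using that False assms(5) by (auto simp: abs_le_iff field_simps)
    have c: "0 \<le> real k ^ n / fact n" "real k ^ n / fact n \<le> real k ^ n"
      by (simp_all add: divide_le_eq mult_le_cancel_left1 fact_ge_1)
    have f: "\<bar>?f t\<bar> \<le> 1" unfolding abs_prod
      by (rule prod_le_1) (use le assms in auto)
    have d: "\<bar>?f t - ?f s\<bar> \<le> real n * (\<bar>t - s\<bar> / real k)"
    proof -
      have "norm (?f t - ?f s) \<le> (\<Sum>i<n. norm ((t - real i) / real k - (s - real i) / real k))"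
        by (rule norm_prod_diff) (use le assms in auto)
      also have "\<dots> = (\<Sum>i<n. \<bar>t - s\<bar> / real k)" by (intro sum.cong) (simp_all flip: diff_divide_distrib)
      finally show ?thesis by simp
    qed
    have "\<bar>t gchoose n\<bar> \<le> real k ^ n * 1"
      unfolding g abs_mult using c f by (intro mult_mono) auto
    moreover have "\<bar>(t gchoose n) - (s gchoose n)\<bar> \<le> real k ^ n * (real n * (\<bar>t - s\<bar> / real k))"
      unfolding g right_diff_distrib[symmetric] abs_mult using c d by (intro mult_mono) auto
    ultimately show ?thesis by simp
  qed (use assms in auto)
  then show "\<bar>t gchoose n\<bar> \<le> real k ^ n"
    "\<bar>(t gchoose n) - (s gchoose n)\<bar> \<le> real k ^ n * (real n * (\<bar>t - s\<bar> / real k))" by auto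
qed

context full_simplex
begin

lemma compact_T: "compact T" and convex_T: "convex T" and closed_T: "closed T"
  using simp compact_simplex convex_simplex closed_simplex by auto

lemma newton_poly_in_polys: "newton_poly k T \<alpha> \<in> polys (sum \<alpha> (verts T))"
proof (induction "sum \<alpha> (verts T)" arbitrary: \<alpha>)
  case 0
  then have "\<forall>z\<in>verts T. \<alpha> z = 0" using verts(1) by simp
  then have "newton_poly k T \<alpha> = (\<lambda>x. 1)" by (auto simp: newton_poly_def)
  then show ?case by (simp add: polys_const)
next
  case (Suc m)
  then obtain z where z: "z \<in> verts T" "\<alpha> z > 0"
    by (metis Zero_not_Suc bot_nat_0.not_eq_extremum sum.neutral)
  define \<beta> where "\<beta> = \<alpha>(z := \<alpha> z - 1)"
  have \<alpha>: "\<alpha> = \<beta>(z := Suc (\<beta> z))" using z by (auto simp: \<beta>_def)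
  have s: "sum \<alpha> (verts T) = Suc (sum \<beta> (verts T))" using sum_upd[OF z(1), of \<beta>] \<alpha> by simp
  then have \<beta>: "newton_poly k T \<beta> \<in> polys (sum \<beta> (verts T))" using Suc by simp
  obtain g c where gc: "bary T z = (\<lambda>x. g \<bullet> x + c)" using bary_affine[OF z(1)] .
  have "newton_poly k T \<alpha> = (\<lambda>x. (1 / real (Suc (\<beta> z))) * (((real k *\<^sub>R g) \<bullet> x + (real k * c - real (\<beta> z))) * newton_poly k T \<beta> x))"
  proof
    fix x
    have "((real k *\<^sub>R g) \<bullet> x + (real k * c - real (\<beta> z))) * newton_poly k T \<beta> x
      = real (Suc (\<beta> z)) * newton_poly k T \<alpha> x"
      using newton_poly_mult[OF z(1), of k x \<beta>] \<alpha> by (simp add: gc algebra_simps)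
    then show "newton_poly k T \<alpha> x = (1 / real (Suc (\<beta> z))) * (((real k *\<^sub>R g) \<bullet> x + (real k * c - real (\<beta> z))) * newton_poly k T \<beta> x)"
      by simp
  qed
  moreover have "(\<lambda>x. (1 / real (Suc (\<beta> z))) * (((real k *\<^sub>R g) \<bullet> x + (real k * c - real (\<beta> z))) * newton_poly k T \<beta> x))
    \<in> polys (Suc (sum \<beta> (verts T)))"
    by (rule polys_cmult, rule polys_affine_mult, rule \<beta>)
  ultimately show ?case using s by simp
qed

lemma lagrange_poly_in_polys: "1 \<le> k \<Longrightarrow> \<xi> \<in> lagrange_nodes k T \<Longrightarrow> lagrange_poly k T \<xi> \<in> polys k"
  using newton_poly_in_polys[of k "lattice_index k T \<xi>"] lattice_index(2) by (simp add: lagrange_poly_def)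

text \<open>After division by powers of \<open>k\<close> all factors are at most one, so the slope
  of the product is at most the sum of their slopes. These are proportional to the entries of the
  index, which add up to \<open>k\<close>.\<close>

lemma lagrange_poly_bounds:
  assumes k: "1 \<le> k" and \<xi>: "\<xi> \<in> lagrange_nodes k T" and x: "x \<in> T" and y: "y \<in> T"
  shows "\<bar>lagrange_poly k T \<xi> x\<bar> \<le> real k ^ k"
    and "0 < r \<Longrightarrow> cball c r \<subseteq> T \<Longrightarrow>
      \<bar>lagrange_poly k T \<xi> x - lagrange_poly k T \<xi> y\<bar> \<le> real k ^ k * (real k * (norm (x - y) / r))"
proof -
  let ?a = "lattice_index k T \<xi>"
  let ?u = "\<lambda>x z. (real k * bary T z x gchoose ?a z) / real k ^ ?a z"
  have t: "0 \<le> real k * bary T z x" "real k * bary T z x \<le> real k" if "z \<in> verts T" "x \<in> T" for z x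
    using bary_nonneg[OF that(2,1)] bary_le_1[OF that(2,1)] by (auto simp: mult_left_le)
  have P: "(\<Prod>z\<in>verts T. real k ^ ?a z) = real k ^ k"
    using lattice_index(2)[OF k \<xi>] by (simp flip: power_sum)
  have l: "lagrange_poly k T \<xi> x = real k ^ k * (\<Prod>z\<in>verts T. ?u x z)" for x
    using k unfolding lagrange_poly_def newton_poly_def P[symmetric] prod.distrib[symmetric] by simp
  have u1: "\<bar>?u x z\<bar> \<le> 1" if "z \<in> verts T" "x \<in> T" for x z
    using gchoose_bounds(1)[OF t[OF that] t[OF that] lattice_index_le[OF k \<xi> that(1)]] k
    by (simp add: divide_le_eq)
  have "\<bar>\<Prod>z\<in>verts T. ?u x z\<bar> \<le> 1" unfolding abs_prod
    by (rule prod_le_1) (use u1 x in auto)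
  then show "\<bar>lagrange_poly k T \<xi> x\<bar> \<le> real k ^ k"
    unfolding l abs_mult by (simp add: mult_left_le)
  assume r: "0 < r" "cball c r \<subseteq> T"
  have u2: "\<bar>?u x z - ?u y z\<bar> \<le> real (?a z) * (norm (x - y) / r)" if z: "z \<in> verts T" for z
  proof -
    have "\<bar>?u x z - ?u y z\<bar> = \<bar>(real k * bary T z x gchoose ?a z) - (real k * bary T z y gchoose ?a z)\<bar> / real k ^ ?a z"
      by (simp flip: diff_divide_distrib)
    also have "\<dots> \<le> real (?a z) * (\<bar>real k * bary T z x - real k * bary T z y\<bar> / real k)"
      using gchoose_bounds(2)[OF t[OF z x] t[OF z y] lattice_index_le[OF k \<xi> z]] k
      by (simp add: divide_le_eq mult.commute)
    also have "\<bar>real k * bary T z x - real k * bary T z y\<bar> / real k = \<bar>bary T z x - bary T z y\<bar>"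
      using k by (simp add: abs_mult right_diff_distrib[symmetric])
    also have "real (?a z) * \<dots> \<le> real (?a z) * (norm (x - y) / r)"
      using bary_lipschitz[OF r z] by (intro mult_left_mono) auto
    finally show ?thesis .
  qed
  have "norm ((\<Prod>z\<in>verts T. ?u x z) - (\<Prod>z\<in>verts T. ?u y z)) \<le> (\<Sum>z\<in>verts T. norm (?u x z - ?u y z))"
    by (rule norm_prod_diff) (use u1 x y in auto)
  also have "\<dots> \<le> (\<Sum>z\<in>verts T. real (?a z) * (norm (x - y) / r))"
    by (intro sum_mono) (use u2 in auto)
  also have "\<dots> = real (sum ?a (verts T)) * (norm (x - y) / r)"
    by (simp only: of_nat_sum sum_distrib_right)
  finally have "\<bar>(\<Prod>z\<in>verts T. ?u x z) - (\<Prod>z\<in>verts T. ?u y z)\<bar> \<le> real k * (norm (x - y) / r)"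
    using lattice_index(2)[OF k \<xi>] by simp
  then show "\<bar>lagrange_poly k T \<xi> x - lagrange_poly k T \<xi> y\<bar> \<le> real k ^ k * (real k * (norm (x - y) / r))"
    unfolding l right_diff_distrib[symmetric] abs_mult by (intro mult_mono) auto
qed

end

text \<open>A bound for the number of nodes times a bound for one basis function; the extra factor
  \<open>k\<close> comes from its slope, so that one constant serves values and differences.\<close>

definition nodal_const :: "nat \<Rightarrow> nat \<Rightarrow> real" where
  "nodal_const k d = real (Suc k ^ Suc d) * (real k ^ k * real k)"

lemma nodal_const_ge_1: "1 \<le> k \<Longrightarrow> 1 \<le> nodal_const k d"
proof -
  assume "1 \<le> k"
  then have "0 < Suc k ^ Suc d * (k ^ k * k)" by simp
  then have "1 \<le> Suc k ^ Suc d * (k ^ k * k)" by linarith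
  then have "real 1 \<le> real (Suc k ^ Suc d * (k ^ k * k))" by (rule of_nat_mono)
  then show ?thesis by (simp add: nodal_const_def)
qed

context full_simplex
begin

lemma nodal_bounds:
  assumes k: "1 \<le> k" and p: "p \<in> polys k" and M: "\<And>\<xi>. \<xi> \<in> lagrange_nodes k T \<Longrightarrow> \<bar>p \<xi>\<bar> \<le> M"
    and x: "x \<in> T" and y: "y \<in> T"
  shows "\<bar>p x\<bar> \<le> nodal_const k DIM('a) * M"
    and "0 < r \<Longrightarrow> cball c r \<subseteq> T \<Longrightarrow> \<bar>p x - p y\<bar> \<le> nodal_const k DIM('a) * M * (norm (x - y) / r)"
proof -
  let ?N = "lagrange_nodes k T"
  \<comment> \<open>Without nodes the hypothesis would say nothing about \<open>M\<close>.
    Interpolation of the constant one rules this out, and \<open>0 \<le> M\<close> follows.\<close>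
  have "?N \<noteq> {}"
  proof
    assume "?N = {}"
    then have "(\<lambda>_. 1::real) x = 0"
      using polys_interp[OF k polys_const[of 1 k], of x] by simp
    then show False by simp
  qed
  then have M0: "0 \<le> M" using M by fastforce
  have sum_le: "\<bar>\<Sum>\<xi>\<in>?N. p \<xi> * f \<xi>\<bar> \<le> real (Suc k ^ Suc DIM('a)) * (M * B)"
    if "\<And>\<xi>. \<xi> \<in> ?N \<Longrightarrow> \<bar>f \<xi>\<bar> \<le> B" "0 \<le> B" for f B
  proof -
    have "\<bar>\<Sum>\<xi>\<in>?N. p \<xi> * f \<xi>\<bar> \<le> (\<Sum>\<xi>\<in>?N. \<bar>p \<xi> * f \<xi>\<bar>)" by (rule sum_abs)
    also have "\<dots> \<le> real (card ?N) * (M * B)"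
      unfolding abs_mult by (rule sum_bounded_above) (intro mult_mono M that abs_ge_zero M0)
    also have "\<dots> \<le> real (Suc k ^ Suc DIM('a)) * (M * B)"
      using lagrange_nodes_finite(2)[OF k] M0 that(2)
      by (intro mult_right_mono) (simp_all only: of_nat_le_iff mult_nonneg_nonneg)
    finally show ?thesis .
  qed
  have "\<bar>p x\<bar> \<le> real (Suc k ^ Suc DIM('a)) * (M * real k ^ k)"
    unfolding polys_interp[OF k p, of x] by (rule sum_le) (use lagrange_poly_bounds(1)[OF k _ x y] in auto)
  also have "\<dots> \<le> real (Suc k ^ Suc DIM('a)) * (M * (real k ^ k * real k))"
    using k M0 by (intro mult_left_mono) (auto simp: mult_le_cancel_left1)
  finally show "\<bar>p x\<bar> \<le> nodal_const k DIM('a) * M" by (simp only: nodal_const_def mult_ac)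
  assume r: "0 < r" "cball c r \<subseteq> T"
  have "p x - p y = (\<Sum>\<xi>\<in>?N. p \<xi> * lagrange_poly k T \<xi> x) - (\<Sum>\<xi>\<in>?N. p \<xi> * lagrange_poly k T \<xi> y)"
    using polys_interp[OF k p] by metis
  also have "\<dots> = (\<Sum>\<xi>\<in>?N. p \<xi> * (lagrange_poly k T \<xi> x - lagrange_poly k T \<xi> y))"
    by (simp add: right_diff_distrib sum_subtractf)
  finally have "\<bar>p x - p y\<bar> \<le> real (Suc k ^ Suc DIM('a)) * (M * (real k ^ k * (real k * (norm (x - y) / r))))"
    using sum_le[of "\<lambda>\<xi>. lagrange_poly k T \<xi> x - lagrange_poly k T \<xi> y" "real k ^ k * (real k * (norm (x - y) / r))"]
      lagrange_poly_bounds(2)[OF k _ x y r] r by simp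
  also have "\<dots> = nodal_const k DIM('a) * M * (norm (x - y) / r)" by (simp add: nodal_const_def mult_ac)
  finally show "\<bar>p x - p y\<bar> \<le> nodal_const k DIM('a) * M * (norm (x - y) / r)" .
qed

end

text \<open>The reciprocal of one quarter of the volume of a ball of radius 1 / (2 A s), with A the
  nodal constant. In a cell of unit inradius, such a ball is where a polynomial keeps half of its
  maximum.\<close>

definition inverse_const :: "nat \<Rightarrow> nat \<Rightarrow> real \<Rightarrow> real" where
  "inverse_const k d s = 4 * (2 * nodal_const k d * s) ^ d / unit_ball_vol (real d)"

lemma inverse_const_pos: "1 \<le> k \<Longrightarrow> 1 \<le> s \<Longrightarrow> 0 < inverse_const k d s"
  using nodal_const_ge_1[of k d] unfolding inverse_const_def by (intro divide_pos_pos mult_pos_pos zero_less_power) auto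

context full_simplex
begin

text \<open>A polynomial keeps half of its maximal size on a ball of comparable radius near a maximum
  point, by the Lipschitz bound; no scaling to a reference simplex is needed.\<close>

lemma inverse_estimate:
  assumes k: "1 \<le> k" and q: "q \<in> polys k" and r: "0 < r" "cball c r \<subseteq> T"
    and s: "1 \<le> s" "diameter T \<le> s * r" and x: "x \<in> T"
  shows "r ^ DIM('a) * (q x)\<^sup>2 \<le> inverse_const k DIM('a) s * (LINT y:T|lebesgue. (q y)\<^sup>2)"
proof -
  let ?A = "nodal_const k DIM('a)"
  have A: "1 \<le> ?A" using nodal_const_ge_1[OF k] .
  have "compact ((\<lambda>x. \<bar>q x\<bar>) ` T)" 
    by (intro compact_continuous_image continuous_on_rabs polys_continuous[OF q] compact_T)
  moreover have "(\<lambda>x. \<bar>q x\<bar>) ` T \<noteq> {}" using x by auto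
  ultimately obtain x0 where x0: "x0 \<in> T" "\<And>y. y \<in> T \<Longrightarrow> \<bar>q y\<bar> \<le> \<bar>q x0\<bar>"
    using compact_attains_sup[of "(\<lambda>x. \<bar>q x\<bar>) ` T"] by auto
  define M where "M = \<bar>q x0\<bar>"
  \<comment> \<open>The homothety with centre \<open>x0\<close> and ratio \<theta> maps the
    inscribed ball to a ball \<open>B\<close> inside \<open>T\<close>. Its points are within
    \<open>\<theta> * s * r\<close> of \<open>x0\<close>, and \<theta> is chosen so that the
    Lipschitz bound allows a drop of at most \<open>M / 2\<close> over this distance.\<close>
  define \<theta> where "\<theta> = 1 / (2 * ?A * s)"
  have "1 \<le> ?A * s" using mult_mono[OF A s(1)] A by simp
  then have \<theta>: "0 < \<theta>" "\<theta> \<le> 1" unfolding \<theta>_def by (simp_all add: divide_le_eq mult.assoc)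
  have nodes: "\<And>\<xi>. \<xi> \<in> lagrange_nodes k T \<Longrightarrow> \<bar>q \<xi>\<bar> \<le> M"
    using x0(2) lagrange_nodes_iff[OF k] by (auto simp: M_def)
  define B where "B = cball (x0 + \<theta> *\<^sub>R (c - x0)) (\<theta> * r)"
  have B: "y \<in> T \<and> M / 2 \<le> \<bar>q y\<bar>" if "y \<in> B" for y
  proof -
    define w where "w = x0 + (1 / \<theta>) *\<^sub>R (y - x0)"
    have y: "y = x0 + \<theta> *\<^sub>R (w - x0)" using \<theta> by (simp add: w_def)
    have "x0 + \<theta> *\<^sub>R (c - x0) - y = \<theta> *\<^sub>R (c - w)" unfolding y by (simp add: algebra_simps)
    then have "\<theta> * norm (c - w) \<le> \<theta> * r"
      using that \<theta> by (simp add: B_def dist_norm)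
    then have "w \<in> cball c r" using \<theta> by (simp add: dist_norm)
    then have w: "w \<in> T" using r by auto
    have "y = (1 - \<theta>) *\<^sub>R x0 + \<theta> *\<^sub>R w" unfolding y by (simp add: algebra_simps)
    then have yT: "y \<in> T" using convexD_alt[OF convex_T x0(1) w] \<theta> by simp
    have "norm (w - x0) \<le> diameter T"
      using diameter_bounded_bound[OF compact_imp_bounded[OF compact_T] w x0(1)] by (simp add: dist_norm)
    then have "norm (w - x0) / r \<le> s" using s(2) r by (simp add: field_simps)
    moreover have "norm (x0 - y) = \<theta> * norm (w - x0)" unfolding y using \<theta> by simp
    ultimately have le: "norm (x0 - y) / r \<le> \<theta> * s"
      using \<theta> by (simp add: mult_left_mono flip: times_divide_eq_right)
    have "\<bar>q x0 - q y\<bar> \<le> ?A * M * (norm (x0 - y) / r)"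
      using nodal_bounds(2)[OF k q nodes x0(1) yT r] .
    also have "\<dots> \<le> ?A * M * (\<theta> * s)"
      using le A by (intro mult_left_mono) (auto simp: M_def)
    also have "\<dots> = M / 2" using A s(1) by (simp add: \<theta>_def)
    finally have "M / 2 \<le> \<bar>q y\<bar>" unfolding M_def by linarith
    then show ?thesis using yT by simp
  qed
  have meas: "measure lebesgue B = unit_ball_vol (real DIM('a)) * (\<theta> * r) ^ DIM('a)"
    unfolding B_def using \<theta> r by (simp add: content_cball)
  have int: "set_integrable lebesgue T (\<lambda>y. (q y)\<^sup>2)"
    by (intro set_integrable_continuous_compact compact_T continuous_intros polys_continuous[OF q])
  have B_le: "(LINT y:B|lebesgue. (M/2)\<^sup>2) \<le> (LINT y:T|lebesgue. (q y)\<^sup>2)"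
    unfolding set_lebesgue_integral_def
  proof (rule integral_mono)
    show "integrable lebesgue (\<lambda>x. indicat_real B x *\<^sub>R (M / 2)\<^sup>2)"
      using set_integrable_continuous_compact[of B "\<lambda>_. (M/2)\<^sup>2"] by (simp add: B_def set_integrable_def)
    show "integrable lebesgue (\<lambda>x. indicat_real T x *\<^sub>R (q x)\<^sup>2)"
      using int by (simp add: set_integrable_def)
    show "indicat_real B y *\<^sub>R (M / 2)\<^sup>2 \<le> indicat_real T y *\<^sub>R (q y)\<^sup>2" for y
    proof (cases "y \<in> B")
      case True
      then have "(M/2)\<^sup>2 \<le> \<bar>q y\<bar>\<^sup>2" using B[OF True] by (intro power_mono) (auto simp: M_def)
      then show ?thesis using B[OF True] True by simp
    qed simp
  qed
  have "(LINT y:B|lebesgue. (M/2)\<^sup>2) = (M/2)\<^sup>2 * (unit_ball_vol (real DIM('a)) * (\<theta> * r) ^ DIM('a))"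
    unfolding set_lebesgue_integral_def using meas by (simp add: B_def)
  also have "\<dots> = (r ^ DIM('a) * M\<^sup>2) / inverse_const k DIM('a) s"
    using A s(1) by (simp add: inverse_const_def \<theta>_def power_mult_distrib power_divide field_simps)
  finally have e: "(LINT y:B|lebesgue. (M/2)\<^sup>2) = (r ^ DIM('a) * M\<^sup>2) / inverse_const k DIM('a) s" .
  have "r ^ DIM('a) * M\<^sup>2 \<le> inverse_const k DIM('a) s * (LINT y:T|lebesgue. (q y)\<^sup>2)"
    using B_le inverse_const_pos[OF k s(1), of "DIM('a)"] unfolding e
    by (simp add: pos_divide_le_eq mult.commute)
  moreover have "r ^ DIM('a) * (q x)\<^sup>2 \<le> r ^ DIM('a) * M\<^sup>2"
    using x0(2)[OF x] r by (intro mult_left_mono) (auto simp: M_def abs_le_square_iff)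
  ultimately show ?thesis by linarith
qed

end

section \<open>Energies\<close>

lemma gradient_within_eq:
  fixes u :: "'a::euclidean_space \<Rightarrow> real"
  assumes "(u has_derivative (\<lambda>h. g \<bullet> h)) (at x)" "x \<in> interior S"
  shows "gradient_within u S x = g"
proof -
  have "(u has_derivative (\<lambda>h. D \<bullet> h)) (at x within S) \<longleftrightarrow> D = g" for D
  proof
    assume "(u has_derivative (\<lambda>h. D \<bullet> h)) (at x within S)"
    then have "(\<lambda>h. D \<bullet> h) = (\<lambda>h. g \<bullet> h)"
      using assms has_derivative_unique at_within_interior by metis
    then have "\<forall>h. D \<bullet> h = g \<bullet> h" by metis
    then show "D = g" using vector_eq_rdot by blast
  qed (use assms(1) in \<open>simp add: at_within_interior[OF assms(2)]\<close>)
  then show ?thesis unfolding gradient_within_def by simp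
qed

lemma set_integral_spike:
  fixes f g :: "'a::euclidean_space \<Rightarrow> real"
  assumes "set_integrable lebesgue T f" "negligible N" "\<And>x. x \<in> T - N \<Longrightarrow> g x = f x"
  shows "set_integrable lebesgue T g" "(LINT x:T|lebesgue. g x) = (LINT x:T|lebesgue. f x)"
proof -
  show *: "set_integrable lebesgue T g" using absolutely_integrable_spike[OF assms] .
  show "(LINT x:T|lebesgue. g x) = (LINT x:T|lebesgue. f x)"
    unfolding set_lebesgue_integral_eq_integral(2)[OF *] set_lebesgue_integral_eq_integral(2)[OF assms(1)]
    by (rule integral_spike[OF assms(2,3), symmetric])
qed

lemma grad_prod_nonneg: "0 \<le> grad_prod S u u"
  unfolding grad_prod_def set_lebesgue_integral_def by (rule Bochner_Integration.integral_nonneg) simp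

text \<open>Difference quotients along \<open>g\<close> itself tend to the square of its norm and
  are at most \<open>L * norm g\<close>.\<close>

lemma gradient_le_lipschitz:
  fixes p :: "'a::euclidean_space \<Rightarrow> real"
  assumes d: "(p has_derivative (\<lambda>h. g \<bullet> h)) (at x)" and x: "x \<in> interior S"
    and L: "\<And>y. y \<in> S \<Longrightarrow> \<bar>p y - p x\<bar> \<le> L * norm (y - x)"
  shows "norm g \<le> L"
proof (cases "g = 0")
  case True
  \<comment> \<open>For a zero gradient the claim is \<open>0 \<le> L\<close>, which takes a second
    point of \<open>S\<close>.\<close>
  obtain e where e: "e > 0" "cball x e \<subseteq> S" using x mem_interior_cball by blast
  obtain b :: 'a where b: "b \<in> Basis" using nonempty_Basis by blast
  have "x + e *\<^sub>R b \<in> S" using e b by (auto simp: subset_eq dist_norm)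
  from L[OF this] have "0 \<le> L * e" using e b by auto
  then show ?thesis using e True by (simp add: zero_le_mult_iff)
next
  case False
  have "((\<lambda>t. p (x + t *\<^sub>R g)) has_derivative (\<lambda>h. g \<bullet> (h *\<^sub>R g))) (at 0)"
    by (rule has_derivative_compose[of "\<lambda>t. x + t *\<^sub>R g" "\<lambda>h. h *\<^sub>R g" _ _ p, simplified])
      (auto intro!: derivative_eq_intros d)
  then have "((\<lambda>t. p (x + t *\<^sub>R g)) has_real_derivative (g \<bullet> g)) (at 0)"
    by (simp add: has_field_derivative_def mult.commute[of _ "g \<bullet> g"])
  then have lim: "((\<lambda>t. (p (x + t *\<^sub>R g) - p x) / t) \<longlongrightarrow> g \<bullet> g) (at 0)"
    by (simp add: has_field_derivative_iff)
  have "((\<lambda>t. x + t *\<^sub>R g) \<longlongrightarrow> x + 0 *\<^sub>R g) (at 0)" by (intro tendsto_intros)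
  then have "\<forall>\<^sub>F t in at 0. x + t *\<^sub>R g \<in> interior S"
    using x by (auto elim!: topological_tendstoD)
  moreover have "\<forall>\<^sub>F t in at (0::real). t \<noteq> 0" by (simp add: eventually_at_filter)
  ultimately have "\<forall>\<^sub>F t in at 0. (p (x + t *\<^sub>R g) - p x) / t \<le> L * norm g"
  proof eventually_elim
    case (elim t)
    then have "\<bar>p (x + t *\<^sub>R g) - p x\<bar> \<le> L * norm g * \<bar>t\<bar>"
      using L[of "x + t *\<^sub>R g"] interior_subset by (fastforce simp: mult_ac)
    then have "\<bar>(p (x + t *\<^sub>R g) - p x) / t\<bar> \<le> L * norm g" using elim by (simp add: divide_le_eq)
    then show ?case by linarith
  qed
  then have "g \<bullet> g \<le> L * norm g" by (rule tendsto_upperbound[OF lim]) simp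
  then show ?thesis using False by (simp add: dot_square_norm power2_eq_square)
qed

context full_simplex
begin

lemma interior_nonempty: "interior T \<noteq> {}"
proof -
  have "affine hull T = UNIV" using hull_mono[OF verts(6), of affine] verts(5) by auto
  moreover have "T \<noteq> {}" using verts(2,6) by (metis card.empty Suc_neq_Zero subset_empty)
  ultimately show ?thesis using rel_interior_interior[of T] rel_interior_eq_empty[OF convex_T] by simp
qed

lemma closure_interior: "closure (interior T) = T"
  using convex_closure_interior[OF convex_T interior_nonempty] closed_T by simp

lemma negligible_boundary: "negligible (T - interior T)"
  using negligible_convex_frontier[OF convex_T] closed_T by (simp add: frontier_def)

text \<open>Inside \<open>T\<close> the gradient relative to any larger set is the polynomial
  gradient. This identifies the integrand over the whole fictitious domain with that over a single
  cell.\<close>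

lemma simplex_gradient:
  assumes "p \<in> polys k" "\<And>x. x \<in> T \<Longrightarrow> u x = p x"
  obtains G where "\<And>x. (p has_derivative (\<lambda>h. G x \<bullet> h)) (at x)"
    "\<And>b. b \<in> Basis \<Longrightarrow> (\<lambda>x. G x \<bullet> b) \<in> polys k"
    "\<And>x S. x \<in> interior T \<Longrightarrow> T \<subseteq> S \<Longrightarrow> gradient_within u S x = G x"
proof -
  obtain G where G: "\<And>x. (p has_derivative (\<lambda>h. G x \<bullet> h)) (at x)"
    "\<And>b. b \<in> Basis \<Longrightarrow> (\<lambda>x. G x \<bullet> b) \<in> polys k" using polys_has_gradient[OF assms(1)] by metis
  have "gradient_within u S x = G x" if "x \<in> interior T" "T \<subseteq> S" for x S
  proof (rule gradient_within_eq)
    show "(u has_derivative (\<lambda>h. G x \<bullet> h)) (at x)"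
      by (rule has_derivative_transform_within_open[OF G(1) open_interior that(1)])
        (use assms(2) interior_subset in \<open>metis subsetD\<close>)
    show "x \<in> interior S" using that interior_mono by blast
  qed
  then show ?thesis using that G by blast
qed

lemma continuous_on_inner_polys:
  assumes "\<And>b. b \<in> Basis \<Longrightarrow> (\<lambda>x. G x \<bullet> b) \<in> polys k" "\<And>b. b \<in> Basis \<Longrightarrow> (\<lambda>x. H x \<bullet> b) \<in> polys k"
  shows "continuous_on UNIV (\<lambda>x. (G x :: 'a) \<bullet> H x)"
proof -
  have "(\<lambda>x. G x \<bullet> H x) = (\<lambda>x. \<Sum>b\<in>Basis. (G x \<bullet> b) * (H x \<bullet> b))"
    by (rule ext, rule euclidean_inner)
  then show ?thesis by (simp only:) (intro continuous_on_sum continuous_on_mult polys_continuous[OF assms(1)] polys_continuous[OF assms(2)])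
qed

lemma grad_prod_integral:
  fixes u w :: "'a \<Rightarrow> real"
  assumes G: "\<And>b. b \<in> Basis \<Longrightarrow> (\<lambda>x. G x \<bullet> b) \<in> polys k" "\<And>x. x \<in> interior T \<Longrightarrow> gradient_within u S x = G x"
    and H: "\<And>b. b \<in> Basis \<Longrightarrow> (\<lambda>x. H x \<bullet> b) \<in> polys k" "\<And>x. x \<in> interior T \<Longrightarrow> gradient_within w S x = H x"
  shows "set_integrable lebesgue T (\<lambda>x. G x \<bullet> H x)"
    "set_integrable lebesgue T (\<lambda>x. gradient_within u S x \<bullet> gradient_within w S x)"
    "(LINT x:T|lebesgue. gradient_within u S x \<bullet> gradient_within w S x) = (LINT x:T|lebesgue. G x \<bullet> H x)"
proof -
  show *: "set_integrable lebesgue T (\<lambda>x. G x \<bullet> H x)"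
    by (intro set_integrable_continuous_compact compact_T continuous_on_inner_polys[OF G(1) H(1)])
  show "set_integrable lebesgue T (\<lambda>x. gradient_within u S x \<bullet> gradient_within w S x)"
    "(LINT x:T|lebesgue. gradient_within u S x \<bullet> gradient_within w S x) = (LINT x:T|lebesgue. G x \<bullet> H x)"
    using set_integral_spike[OF * negligible_boundary, of "\<lambda>x. gradient_within u S x \<bullet> gradient_within w S x"]
      G(2) H(2) by auto
qed

text \<open>The inverse estimate for the components of the gradient bounds the gradient pointwise by
  the energy, and the mean value inequality on the convex set \<open>T\<close> turns this into a
  bound for the oscillation. This is the Poincare-type estimate.\<close>

lemma energy_osc:
  assumes k: "1 \<le> k" and p: "p \<in> polys k" "\<And>x. x \<in> T \<Longrightarrow> u x = p x" and r: "0 < r" "cball c r \<subseteq> T"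
    and s: "1 \<le> s" "diameter T \<le> s * r" and xy: "x \<in> T" "y \<in> T"
  shows "r ^ DIM('a) * (u x - u y)\<^sup>2 \<le> inverse_const k DIM('a) s * (diameter T)\<^sup>2 * grad_prod T u u"
proof -
  obtain G where G: "\<And>x. (p has_derivative (\<lambda>h. G x \<bullet> h)) (at x)"
    "\<And>b. b \<in> Basis \<Longrightarrow> (\<lambda>x. G x \<bullet> b) \<in> polys k"
    "\<And>x S. x \<in> interior T \<Longrightarrow> T \<subseteq> S \<Longrightarrow> gradient_within u S x = G x"
    using simplex_gradient[OF p] by metis
  let ?E = "grad_prod T u u" and ?C = "inverse_const k DIM('a) s"
  have E: "?E = (LINT x:T|lebesgue. G x \<bullet> G x)"
    unfolding grad_prod_def by (rule grad_prod_integral(3)[OF G(2) _ G(2)]) (use G(3) in auto)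
  have sq: "set_integrable lebesgue T (\<lambda>x. (G x \<bullet> b)\<^sup>2)" if "b \<in> Basis" for b
    by (intro set_integrable_continuous_compact compact_T continuous_intros polys_continuous[OF G(2)[OF that]])
  have GG: "G x \<bullet> G x = (\<Sum>b\<in>Basis. (G x \<bullet> b)\<^sup>2)" for x
    by (simp add: euclidean_inner[of "G x" "G x"] power2_eq_square)
  have E2: "?E = (\<Sum>b\<in>Basis. LINT x:T|lebesgue. (G x \<bullet> b)\<^sup>2)"
    unfolding E GG set_lebesgue_integral_def scaleR_sum_right
    by (rule Bochner_Integration.integral_sum) (use sq in \<open>simp add: set_integrable_def\<close>)
  have bd: "r ^ DIM('a) * (norm (G z))\<^sup>2 \<le> ?C * ?E" if "z \<in> T" for z
  proof -
    have "r ^ DIM('a) * (norm (G z))\<^sup>2 = (\<Sum>b\<in>Basis. r ^ DIM('a) * (G z \<bullet> b)\<^sup>2)"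
      by (simp only: power2_norm_eq_inner GG sum_distrib_left)
    also have "\<dots> \<le> (\<Sum>b\<in>Basis. ?C * (LINT x:T|lebesgue. (G x \<bullet> b)\<^sup>2))"
      by (intro sum_mono inverse_estimate[OF k G(2) r s that])
    finally show ?thesis by (simp add: E2 sum_distrib_left)
  qed
  let ?B = "sqrt (?C * ?E / r ^ DIM('a))"
  have B: "norm (G z) \<le> ?B" if "z \<in> T" for z
    using bd[OF that] r by (intro real_le_rsqrt) (simp add: pos_le_divide_eq mult.commute)
  have "norm (p x - p y) \<le> ?B * norm (x - y)"
  proof (rule differentiable_bound[OF convex_T _ _ xy])
    fix z assume z: "z \<in> T"
    show "(p has_derivative (\<lambda>h. G z \<bullet> h)) (at z within T)" using G(1) has_derivative_at_withinI by blast
    show "onorm (\<lambda>h. G z \<bullet> h) \<le> ?B"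
    proof (rule onorm_bound)
      show "0 \<le> ?B" using B[OF z] norm_ge_zero order_trans by blast
      show "norm (G z \<bullet> h) \<le> ?B * norm h" for h
        using Cauchy_Schwarz_ineq2[of "G z" h] mult_right_mono[OF B[OF z] norm_ge_zero[of h]] by simp
    qed
  qed
  then have "(u x - u y)\<^sup>2 \<le> (?B * norm (x - y))\<^sup>2"
    using p(2) xy by (simp add: abs_le_square_iff[symmetric])
  also have "\<dots> = (?C * ?E / r ^ DIM('a)) * (norm (x - y))\<^sup>2"
    using inverse_const_pos[OF k s(1), of "DIM('a)"] grad_prod_nonneg[of T u] r
    by (simp add: power_mult_distrib)
  finally have "r ^ DIM('a) * (u x - u y)\<^sup>2 \<le> ?C * ?E * (norm (x - y))\<^sup>2"
    using r by (simp add: field_simps)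
  also have "\<dots> \<le> ?C * ?E * (diameter T)\<^sup>2"
    using inverse_const_pos[OF k s(1), of "DIM('a)"] grad_prod_nonneg[of T u]
      diameter_bounded_bound[OF compact_imp_bounded[OF compact_T] xy]
    by (intro mult_left_mono power_mono) (auto simp: dist_norm)
  finally show ?thesis by (simp add: mult_ac)
qed

lemma energy_upper:
  assumes k: "1 \<le> k" and p: "p \<in> polys k" "\<And>x. x \<in> T \<Longrightarrow> u x = p x" and r: "0 < r" "cball c r \<subseteq> T"
    and M: "\<And>\<xi>. \<xi> \<in> lagrange_nodes k T \<Longrightarrow> \<bar>u \<xi>\<bar> \<le> M"
  shows "grad_prod T u u \<le> (nodal_const k DIM('a) * M / r)\<^sup>2 * (unit_ball_vol (real DIM('a)) * diameter T ^ DIM('a))"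
proof -
  obtain G where G: "\<And>x. (p has_derivative (\<lambda>h. G x \<bullet> h)) (at x)"
    "\<And>b. b \<in> Basis \<Longrightarrow> (\<lambda>x. G x \<bullet> b) \<in> polys k"
    "\<And>x S. x \<in> interior T \<Longrightarrow> T \<subseteq> S \<Longrightarrow> gradient_within u S x = G x"
    using simplex_gradient[OF p] by metis
  let ?L = "nodal_const k DIM('a) * M / r"
  have M': "\<bar>p \<xi>\<bar> \<le> M" if "\<xi> \<in> lagrange_nodes k T" for \<xi>
    using M[OF that] p(2)[of \<xi>] lagrange_nodes_iff[OF k] that by auto
  have L: "norm (gradient_within u T x) \<le> ?L" if "x \<in> interior T" for x
    unfolding G(3)[OF that order_refl]
  proof (rule gradient_le_lipschitz[OF G(1) that])
    show "\<bar>p y - p x\<bar> \<le> ?L * norm (y - x)" if "y \<in> T" for y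
      using nodal_bounds(2)[OF k p(1) M' that _ r, of x] \<open>x \<in> interior T\<close> interior_subset by auto
  qed
  obtain x0 where x0: "x0 \<in> T" using interior_nonempty interior_subset by blast
  have T_sub: "T \<subseteq> cball x0 (diameter T)"
    using diameter_bounded_bound[OF compact_imp_bounded[OF compact_T] x0] by auto
  have dp: "0 \<le> diameter T" using diameter_ge_0[OF compact_imp_bounded[OF compact_T]] .
  have int: "set_integrable lebesgue T (\<lambda>x. gradient_within u T x \<bullet> gradient_within u T x)"
    by (rule grad_prod_integral(2)[OF G(2) _ G(2)]) (use G(3) in auto)
  \<comment> \<open>The value of \<open>gradient_within\<close> is uncontrolled on the boundary of
    \<open>T\<close>, so the integrand is cut off to the interior before the pointwise
    comparison.\<close>
  let ?f = "\<lambda>x. if x \<in> interior T then gradient_within u T x \<bullet> gradient_within u T x else 0"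
  have f: "set_integrable lebesgue T ?f" "grad_prod T u u = (LINT x:T|lebesgue. ?f x)"
    unfolding grad_prod_def using set_integral_spike[OF int negligible_boundary, of ?f] by auto
  have "grad_prod T u u \<le> (LINT x:T|lebesgue. ?L\<^sup>2)"
    unfolding f(2)
  proof (rule set_integral_mono[OF f(1)])
    show "set_integrable lebesgue T (\<lambda>x. ?L\<^sup>2)" by (intro set_integrable_continuous_compact compact_T) auto
    show "?f x \<le> ?L\<^sup>2" for x
      using L[of x] by (auto simp: dot_square_norm intro!: power_mono)
  qed
  also have "\<dots> = ?L\<^sup>2 * measure lebesgue T"
    using lmeasurable_compact[OF compact_T] by (simp add: set_lebesgue_integral_def)
  also have "\<dots> \<le> ?L\<^sup>2 * measure lebesgue (cball x0 (diameter T))"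
    by (intro mult_left_mono measure_mono_fmeasurable[OF T_sub]) (use lmeasurable_compact compact_T in auto)
  finally show ?thesis using dp by (simp add: content_cball)
qed

lemma energy_diff:
  assumes p: "p \<in> polys k" "\<And>x. x \<in> T \<Longrightarrow> u x = p x" and q: "q \<in> polys k" "\<And>x. x \<in> T \<Longrightarrow> w x = q x"
  shows "grad_prod T (\<lambda>x. u x - w x) (\<lambda>x. u x - w x) \<le> 2 * grad_prod T u u + 2 * grad_prod T w w"
proof -
  obtain G where G: "\<And>x. (p has_derivative (\<lambda>h. G x \<bullet> h)) (at x)"
    "\<And>b. b \<in> Basis \<Longrightarrow> (\<lambda>x. G x \<bullet> b) \<in> polys k"
    "\<And>x S. x \<in> interior T \<Longrightarrow> T \<subseteq> S \<Longrightarrow> gradient_within u S x = G x"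
    using simplex_gradient[OF p] by metis
  obtain H where H: "\<And>x. (q has_derivative (\<lambda>h. H x \<bullet> h)) (at x)"
    "\<And>b. b \<in> Basis \<Longrightarrow> (\<lambda>x. H x \<bullet> b) \<in> polys k"
    "\<And>x S. x \<in> interior T \<Longrightarrow> T \<subseteq> S \<Longrightarrow> gradient_within w S x = H x"
    using simplex_gradient[OF q] by metis
  have D1: "(\<lambda>x. (G x - H x) \<bullet> b) \<in> polys k" if "b \<in> Basis" for b
    using polys_diff[OF G(2)[OF that] H(2)[OF that]] by (simp add: inner_diff_left)
  have D2: "gradient_within (\<lambda>x. u x - w x) T x = G x - H x" if "x \<in> interior T" for x
  proof (rule gradient_within_eq[OF _ that])
    have "((\<lambda>x. p x - q x) has_derivative (\<lambda>h. (G x - H x) \<bullet> h)) (at x)"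
      using has_derivative_diff[OF G(1)[of x] H(1)[of x]] by (simp add: inner_diff_left)
    then show "((\<lambda>x. u x - w x) has_derivative (\<lambda>h. (G x - H x) \<bullet> h)) (at x)"
      by (rule has_derivative_transform_within_open[OF _ open_interior that])
        (use p(2) q(2) interior_subset in \<open>metis subsetD\<close>)
  qed
  note si = set_integrable_continuous_compact[OF compact_T continuous_on_inner_polys]
  note i = si[OF G(2) G(2)] si[OF H(2) H(2)] si[OF D1 D1]
  have "grad_prod T (\<lambda>x. u x - w x) (\<lambda>x. u x - w x) = (LINT x:T|lebesgue. (G x - H x) \<bullet> (G x - H x))"
    unfolding grad_prod_def by (rule grad_prod_integral(3)[OF D1 D2 D1 D2])
  also have "\<dots> \<le> (LINT x:T|lebesgue. 2 * (G x \<bullet> G x) + 2 * (H x \<bullet> H x))"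
  proof (rule set_integral_mono[OF i(3)])
    show "set_integrable lebesgue T (\<lambda>x. 2 * (G x \<bullet> G x) + 2 * (H x \<bullet> H x))"
      using i by (intro set_integral_add set_integrable_mult_right) auto
    show "(G x - H x) \<bullet> (G x - H x) \<le> 2 * (G x \<bullet> G x) + 2 * (H x \<bullet> H x)" for x
      using inner_ge_zero[of "G x + H x"] by (simp add: inner_diff_left inner_diff_right inner_add_left inner_add_right inner_commute)
  qed
  also have "\<dots> = 2 * (LINT x:T|lebesgue. G x \<bullet> G x) + 2 * (LINT x:T|lebesgue. H x \<bullet> H x)"
    using i by (subst set_integral_add) (auto intro: set_integrable_mult_right)
  also have "(LINT x:T|lebesgue. G x \<bullet> G x) = grad_prod T u u"
    unfolding grad_prod_def by (rule grad_prod_integral(3)[OF G(2) _ G(2), symmetric]) (use G(3) in auto)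
  also have "(LINT x:T|lebesgue. H x \<bullet> H x) = grad_prod T w w"
    unfolding grad_prod_def by (rule grad_prod_integral(3)[OF H(2) _ H(2), symmetric]) (use H(3) in auto)
  finally show ?thesis .
qed

end

section \<open>Energies on a triangulation\<close>

locale simplicial_mesh =
  fixes \<A> :: "'a::euclidean_space set set"
  assumes tri: "triangulation \<A>" and full: "\<And>T. T \<in> \<A> \<Longrightarrow> int DIM('a) simplex T"
begin

lemma finite_mesh: "finite \<A>" using tri by (simp add: triangulation_def)

lemma cell: "T \<in> \<A> \<Longrightarrow> full_simplex T" using full by (simp add: full_simplex_def)

lemma common_face: "T \<in> \<A> \<Longrightarrow> T' \<in> \<A> \<Longrightarrow> T \<inter> T' face_of T \<and> T \<inter> T' face_of T'"
  using tri unfolding triangulation_def by (metis Int_commute)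

text \<open>If the cells meet in a proper face of \<open>T'\<close>, that face misses the interior
  of \<open>T'\<close>. Otherwise \<open>T'\<close> is a proper face of \<open>T\<close> and misses
  the interior of \<open>T\<close>, although it is contained in \<open>T\<close> and has interior
  points.\<close>

lemma interior_disjoint:
  assumes "T \<in> \<A>" "T' \<in> \<A>" "T \<noteq> T'" shows "T \<inter> interior T' = {}"
proof (cases "T \<inter> T' = T'")
  case False
  then show ?thesis using face_of_disjoint_interior[of "T \<inter> T'" T'] common_face[OF assms(1,2)] interior_subset by blast
next
  case True
  then have "T' face_of T" using common_face[OF assms(1,2)] by auto
  then have "T' \<inter> interior T = {}" using face_of_disjoint_interior assms(3) by metis
  moreover have "T' \<subseteq> T" using True by auto
  then have "interior T' \<subseteq> interior T" by (rule interior_mono)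
  moreover have "interior T' \<noteq> {}" using full_simplex.interior_nonempty[OF cell[OF assms(2)]] .
  ultimately show ?thesis using interior_subset by blast
qed

lemma negligible_Int:
  assumes "T \<in> \<A>" "T' \<in> \<A>" "T \<noteq> T'" shows "negligible (T \<inter> T')"
  by (rule negligible_subset[OF full_simplex.negligible_boundary[OF cell[OF assms(2)]]])
    (use interior_disjoint[OF assms] in auto)

text \<open>Cells overlap in null sets, and in the interior of a cell the gradient relative to the
  union is the one relative to the cell.\<close>

lemma grad_prod_Union:
  assumes "\<And>T. T \<in> \<A> \<Longrightarrow> \<exists>p\<in>polys k. \<forall>x\<in>T. u x = p x"
  shows "grad_prod (\<Union>\<A>) u u = (\<Sum>T\<in>\<A>. grad_prod T u u)"
proof -
  let ?F = "\<lambda>x. gradient_within u (\<Union>\<A>) x \<bullet> gradient_within u (\<Union>\<A>) x"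
  have *: "set_integrable lebesgue T ?F \<and> (LINT x:T|lebesgue. ?F x) = grad_prod T u u" if T: "T \<in> \<A>" for T
  proof -
    interpret full_simplex T using cell[OF T] .
    obtain p where p: "p \<in> polys k" "\<And>x. x \<in> T \<Longrightarrow> u x = p x" using assms[OF T] by blast
    obtain G where G: 
      "\<And>b. b \<in> Basis \<Longrightarrow> (\<lambda>x. G x \<bullet> b) \<in> polys k"
      "\<And>x S. x \<in> interior T \<Longrightarrow> T \<subseteq> S \<Longrightarrow> gradient_within u S x = G x"
      using simplex_gradient[OF p] by metis
    have "T \<subseteq> \<Union>\<A>" using T by auto
    note g = G(2)[OF _ this] and g' = G(2)[OF _ order_refl]
    show ?thesis
      using grad_prod_integral(2,3)[OF G(1) g G(1) g] grad_prod_integral(3)[OF G(1) g' G(1) g']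
      by (simp add: grad_prod_def)
  qed
  have "set_integrable lebesgue (\<Union>T\<in>\<A>. T) ?F"
    using * full_simplex.compact_T[OF cell]
    by (intro set_integrable_UN finite_mesh) (auto intro: fmeasurableD lmeasurable_compact)
  then have "(LINT x:\<Union>\<A>|lebesgue. ?F x) = integral (\<Union>\<A>) ?F"
    using set_lebesgue_integral_eq_integral(2) by auto
  also have "\<dots> = (\<Sum>T\<in>\<A>. LINT x:T|lebesgue. ?F x)"
    by (intro integral_unique has_integral_Union finite_mesh has_integral_set_lebesgue)
      (use * negligible_Int in \<open>auto simp: pairwise_def\<close>)
  finally show ?thesis using * by (simp add: grad_prod_def)
qed

end

section \<open>Hausdorff measure\<close>

lemma hausdorff_measure_sigma:
  "sets (hausdorff_measure n :: 'a::metric_space measure) = sets borel"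
  "space (hausdorff_measure n :: 'a::metric_space measure) = UNIV"
  using sets.sigma_sets_eq[of "borel :: 'a measure"] by (simp_all add: hausdorff_measure_def)

text \<open>\<open>measure_of\<close> yields the null measure unless \<open>hausdorff_outer\<close> is countably additive on the Borel
  sets.  A set of positive measure rules this out, and Caratheodory's criterion is not needed.\<close>

lemma emeasure_hausdorff_measure:
  fixes A B :: "'a::metric_space set"
  assumes "emeasure (hausdorff_measure n) A \<noteq> 0" "B \<in> sets borel"
  shows "emeasure (hausdorff_measure n) B = hausdorff_outer n B"
proof -
  have s: "sigma_sets UNIV (sets borel) = sets (borel :: 'a measure)"
    using sets.sigma_sets_eq[of "borel :: 'a measure"] by simp
  have c: "emeasure (hausdorff_measure n) X =
     (if X \<in> sets borel \<and> measure_space UNIV (sets borel) (hausdorff_outer n :: 'a set \<Rightarrow> _) then hausdorff_outer n X else 0)" for X :: "'a set"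
    unfolding hausdorff_measure_def emeasure_measure_of_conv s ..
  show ?thesis using assms(1)[unfolded c] assms(2) c[of B] by (auto split: if_splits)
qed

text \<open>With \<delta> the diameter of \<open>C\<close>, the thickened set is covered by at most
  5 s / \<delta> balls of radius 2 \<delta>, centred at distance \<delta> from one another along
  \<open>e\<close>. Their total volume is of order s \<delta>^(d-1), that is, \<open>s\<close> times
  the size of \<open>C\<close> up to a constant.\<close>

lemma thick_cover:
  fixes e :: "'a::euclidean_space"
  assumes d: "2 \<le> DIM('a)" and e: "norm e = 1" and s: "0 < s" and C: "bounded C" "diameter C \<le> s"
  obtains D where "D \<in> sets lborel" "{y + t *\<^sub>R e | y t. y \<in> C \<and> \<bar>t\<bar> \<le> s} \<subseteq> D"
    "emeasure lborel D \<le> ennreal (5 * 4 ^ DIM('a) * unit_ball_vol (real DIM('a)) / unit_ball_vol (real (DIM('a) - 1)) * s)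
       * hausdorff_size (DIM('a) - 1) C"
proof (cases "C = {}")
  case True
  then show ?thesis using that[of "{}"] by simp
next
  case ne: False
  then obtain p where p: "p \<in> C" by blast
  let ?\<delta> = "diameter C" and ?d = "DIM('a)"
  have \<delta>0: "0 \<le> ?\<delta>" using diameter_ge_0[OF C(1)] .
  have near: "norm (y - p) \<le> ?\<delta>" if "y \<in> C" for y
    using diameter_bounded_bound[OF C(1) that p] by (simp add: dist_norm)
  show ?thesis
  proof (cases "?\<delta> = 0")
    case True
    \<comment> \<open>Here \<open>C\<close> is a single point, whose size is zero since
      \<open>DIM('a) - 1\<close> is positive. Its thickening is a segment, a null set in dimension
      at least two.\<close>
    let ?D = "closed_segment (p - s *\<^sub>R e) (p + s *\<^sub>R e)"
    have "negligible ?D"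
      by (rule negligible_convex_interior[THEN iffD2]) (auto simp: interior_closed_segment_ge2[OF d])
    then have D0: "emeasure lborel ?D = 0"
      by (simp add: negligible_iff_null_sets null_sets_completion_iff null_setsD1)
    have "{y + t *\<^sub>R e | y t. y \<in> C \<and> \<bar>t\<bar> \<le> s} \<subseteq> ?D"
    proof clarify
      fix y t assume y: "y \<in> C" and t: "\<bar>t\<bar> \<le> s"
      have "y = p" using near[OF y] True by simp
      then show "y + t *\<^sub>R e \<in> ?D"
        unfolding in_segment using t s
        by (intro exI[of _ "(t + s) / (2 * s)"]) (auto simp: field_simps algebra_simps simp flip: scaleR_add_left)
    qed
    then show ?thesis using that[of ?D] D0 by simp
  next
    case False
    then have \<delta>: "0 < ?\<delta>" using \<delta>0 by simp
    define m where "m = \<lceil>s / ?\<delta>\<rceil>"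
    have m: "s / ?\<delta> \<le> of_int m" "of_int m < s / ?\<delta> + 1" unfolding m_def by linarith+
    have sd: "1 \<le> s / ?\<delta>" using C(2) \<delta> by simp
    have m0: "0 \<le> m" using m sd by linarith
    define D where "D = (\<Union>j\<in>{-m..m}. cball (p + (of_int j * ?\<delta>) *\<^sub>R e) (2 * ?\<delta>))"
    have sub: "{y + t *\<^sub>R e | y t. y \<in> C \<and> \<bar>t\<bar> \<le> s} \<subseteq> D"
    proof clarify
      fix y t assume y: "y \<in> C" and t: "\<bar>t\<bar> \<le> s"
      define j where "j = \<lfloor>t / ?\<delta>\<rfloor>"
      have td: "- (s / ?\<delta>) \<le> t / ?\<delta>" "t / ?\<delta> \<le> s / ?\<delta>"
        using divide_right_mono[of "-s" t ?\<delta>] divide_right_mono[of t s ?\<delta>] t \<delta> by auto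
      have j: "of_int j \<le> t / ?\<delta>" "t / ?\<delta> < of_int j + 1" unfolding j_def by linarith+
      have "real_of_int (- m) < of_int j + 1" "real_of_int j \<le> of_int m"
        using j m td by simp_all
      then have "j \<in> {-m..m}" by (simp flip: of_int_minus)
      moreover have "y + t *\<^sub>R e \<in> cball (p + (of_int j * ?\<delta>) *\<^sub>R e) (2 * ?\<delta>)"
      proof -
        have "\<bar>t - of_int j * ?\<delta>\<bar> \<le> ?\<delta>" using j \<delta> by (simp add: field_simps abs_le_iff)
        then have "norm ((y - p) + (t - of_int j * ?\<delta>) *\<^sub>R e) \<le> ?\<delta> + ?\<delta>"
          using near[OF y] e by (intro norm_triangle_mono) auto
        then show ?thesis by (simp add: dist_norm norm_minus_commute[of "p + _"] algebra_simps)
      qed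
      ultimately show "y + t *\<^sub>R e \<in> D" unfolding D_def by blast
    qed
    have "emeasure lborel D \<le> (\<Sum>j\<in>{-m..m}. emeasure lborel (cball (p + (of_int j * ?\<delta>) *\<^sub>R e) (2 * ?\<delta>)))"
      unfolding D_def by (rule emeasure_subadditive_finite) auto
    also have "\<dots> = ennreal (real (card {-m..m}) * (unit_ball_vol (real ?d) * (2 * ?\<delta>) ^ ?d))"
      using \<delta> by (simp add: emeasure_cball ennreal_mult ennreal_of_nat_eq_real_of_nat)
    also have "\<dots> \<le> ennreal ((5 * (s / ?\<delta>)) * (unit_ball_vol (real ?d) * (2 * ?\<delta>) ^ ?d))"
    proof (intro ennreal_leI mult_right_mono)
      \<comment> \<open>The count 2 m + 1 is at most 2 s / \<delta> + 3, and
        \<open>diameter C \<le> s\<close> absorbs the 3.\<close>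
      have "real (card {-m..m}) = 2 * of_int m + 1" using m0 by simp
      then show "real (card {-m..m}) \<le> 5 * (s / ?\<delta>)" using m sd by linarith
    qed (use \<delta> in auto)
    also have "\<dots> = ennreal ((5 * 4 ^ ?d * unit_ball_vol (real ?d) / unit_ball_vol (real (?d - 1)) * s)
        * (unit_ball_vol (real (?d - 1)) / 2 ^ (?d - 1) * ?\<delta> ^ (?d - 1) / 2))"
    proof -
      obtain n where n: "?d = Suc n" using d by (cases ?d) auto
      have "(4::real) ^ Suc n = 2 ^ Suc n * 2 ^ Suc n" by (simp flip: power_mult_distrib)
      moreover have "unit_ball_vol (real n) \<noteq> 0"
        by (intro less_imp_neq[THEN not_sym] unit_ball_vol_pos) simp
      ultimately show ?thesis using \<delta> unfolding n by (simp add: power_mult_distrib field_simps)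
    qed
    also have "\<dots> \<le> ennreal ((5 * 4 ^ ?d * unit_ball_vol (real ?d) / unit_ball_vol (real (?d - 1)) * s)
        * (unit_ball_vol (real (?d - 1)) / 2 ^ (?d - 1) * ?\<delta> ^ (?d - 1)))"
      using \<delta> s by (intro ennreal_leI mult_left_mono) (auto simp: divide_le_eq)
    also have "\<dots> = ennreal (5 * 4 ^ ?d * unit_ball_vol (real ?d) / unit_ball_vol (real (?d - 1)) * s)
       * hausdorff_size (?d - 1) C"
      unfolding hausdorff_size_def using ne s \<delta> by (subst ennreal_mult) auto
    finally show ?thesis using that[of D] sub by (auto simp: D_def)
  qed
qed

text \<open>Thickening in the direction of \<open>e\<close> turns a lower bound on volume into a lower bound on
  surface measure.\<close>

lemma hausdorff_outer_lower:
  fixes e x :: "'a::euclidean_space"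
  assumes d: "2 \<le> DIM('a)" and e: "norm e = 1" and s: "0 < s" and \<rho>: "0 \<le> \<rho>"
    and sub: "cball x \<rho> \<subseteq> {y + t *\<^sub>R e | y t. y \<in> A \<and> \<bar>t\<bar> \<le> s}"
  shows "ennreal (unit_ball_vol (real (DIM('a) - 1)) / (5 * 4 ^ DIM('a)) * \<rho> ^ DIM('a) / s) \<le> hausdorff_outer (DIM('a) - 1) A"
proof -
  let ?d = "DIM('a)"
  let ?K = "5 * 4 ^ ?d * unit_ball_vol (real ?d) / unit_ball_vol (real (?d - 1))"
  have K: "0 < ?K" by simp
  \<comment> \<open>The outer measure is a supremum over scales, so the bound is proved at the
    single scale \<open>s\<close>, where \<open>thick_cover\<close> applies to every set of a
    cover.\<close>
  have "ennreal (unit_ball_vol (real (?d - 1)) / (5 * 4 ^ ?d) * \<rho> ^ ?d / s) \<le> hausdorff_pre (?d - 1) s A"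
    unfolding hausdorff_pre_def
  proof (rule Inf_greatest, clarify)
    fix C :: "nat \<Rightarrow> 'a set"
    assume C: "A \<subseteq> (\<Union>i. C i)" "\<forall>i. bounded (C i) \<and> diameter (C i) \<le> s"
    have "\<forall>i. \<exists>D. D \<in> sets lborel \<and> {y + t *\<^sub>R e | y t. y \<in> C i \<and> \<bar>t\<bar> \<le> s} \<subseteq> D \<and>
       emeasure lborel D \<le> ennreal (?K * s) * hausdorff_size (?d - 1) (C i)"
    proof
      fix i
      have b: "bounded (C i)" "diameter (C i) \<le> s" using C(2) by auto
      show "\<exists>D. D \<in> sets lborel \<and> {y + t *\<^sub>R e | y t. y \<in> C i \<and> \<bar>t\<bar> \<le> s} \<subseteq> D \<and>
       emeasure lborel D \<le> ennreal (?K * s) * hausdorff_size (?d - 1) (C i)"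
        by (rule thick_cover[OF d e s b]) blast
    qed
    from choice[OF this] obtain D where "\<forall>i. D i \<in> sets lborel \<and> {y + t *\<^sub>R e | y t. y \<in> C i \<and> \<bar>t\<bar> \<le> s} \<subseteq> D i \<and>
       emeasure lborel (D i) \<le> ennreal (?K * s) * hausdorff_size (?d - 1) (C i)" by blast
    then have D: "\<And>i. D i \<in> sets lborel"
      "\<And>i. {y + t *\<^sub>R e | y t. y \<in> C i \<and> \<bar>t\<bar> \<le> s} \<subseteq> D i"
      "\<And>i. emeasure lborel (D i) \<le> ennreal (?K * s) * hausdorff_size (?d - 1) (C i)" by blast+
    have "cball x \<rho> \<subseteq> (\<Union>i. D i)"
    proof
      fix z assume "z \<in> cball x \<rho>"
      then obtain y t where z: "z = y + t *\<^sub>R e" "y \<in> A" "\<bar>t\<bar> \<le> s" using sub by blast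
      then obtain i where "y \<in> C i" using C(1) by blast
      then have "z \<in> D i" using D(2)[of i] z by blast
      then show "z \<in> (\<Union>i. D i)" by blast
    qed
    then have "emeasure lborel (cball x \<rho>) \<le> emeasure lborel (\<Union>i. D i)"
      using D(1) by (intro emeasure_mono) auto
    also have "\<dots> \<le> (\<Sum>i. emeasure lborel (D i))"
      using D(1) by (intro emeasure_subadditive_countably) auto
    also have "\<dots> \<le> (\<Sum>i. ennreal (?K * s) * hausdorff_size (?d - 1) (C i))"
      by (intro suminf_le D(3) summableI)
    also have "\<dots> = ennreal (?K * s) * (\<Sum>i. hausdorff_size (?d - 1) (C i))" by (rule ennreal_suminf_cmult)
    finally have le: "ennreal (unit_ball_vol (real ?d) * \<rho> ^ ?d) \<le> ennreal (?K * s) * (\<Sum>i. hausdorff_size (?d - 1) (C i))"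
      using \<rho> by (simp only: emeasure_cball)
    show "ennreal (unit_ball_vol (real (?d - 1)) / (5 * 4 ^ ?d) * \<rho> ^ ?d / s) \<le> (\<Sum>i. hausdorff_size (?d - 1) (C i))"
    proof (cases "(\<Sum>i. hausdorff_size (?d - 1) (C i))" rule: ennreal_cases)
      case (real X)
      have "ennreal (?K * s) * ennreal X = ennreal (?K * s * X)"
        by (rule ennreal_mult[symmetric]) (use K s real in auto)
      then have "unit_ball_vol (real ?d) * \<rho> ^ ?d \<le> ?K * s * X"
        using le K s real by (subst ennreal_le_iff[symmetric]) (simp_all only: mult_nonneg_nonneg less_imp_le)
      then have "unit_ball_vol (real (?d - 1)) / (5 * 4 ^ ?d) * \<rho> ^ ?d / s \<le> X"
        using s by (simp add: field_simps)
      then show ?thesis unfolding real(2) by (rule ennreal_leI)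
    qed simp
  qed
  also have "\<dots> \<le> hausdorff_outer (?d - 1) A"
    unfolding hausdorff_outer_def using s by (intro SUP_upper) auto
  finally show ?thesis .
qed

text \<open>Translating the balls of a packing of a Lipschitz graph in the direction of \<open>e\<close> keeps them
  disjoint, which bounds the number of balls by a volume.\<close>

lemma graph_packing:
  fixes e x :: "'a::euclidean_space"
  assumes e: "norm e = 1" and L: "0 \<le> L" and r: "0 < \<eta>" "\<eta> \<le> r" and A: "A \<subseteq> cball x r"
    and lip: "\<And>p q. p \<in> A \<Longrightarrow> q \<in> A \<Longrightarrow> \<bar>(p - q) \<bullet> e\<bar> \<le> L * norm ((p - q) - ((p - q) \<bullet> e) *\<^sub>R e)"
    and P: "finite P" "P \<subseteq> A" "\<And>p q. p \<in> P \<Longrightarrow> q \<in> P \<Longrightarrow> p \<noteq> q \<Longrightarrow> \<eta> \<le> norm (p - q)"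
  shows "real (card P) * \<eta> ^ (DIM('a) - 1) \<le> (8 + 4 * L) ^ DIM('a) * r ^ (DIM('a) - 1)"
proof -
  let ?d = "DIM('a)" and ?\<omega> = "unit_ball_vol (real DIM('a))"
  \<comment> \<open>About \<open>r / \<eta>\<close> layers give a stack of height comparable to
    \<open>r\<close>; comparing volumes then leaves the exponent \<open>DIM('a) - 1\<close>.\<close>
  define N where "N = nat \<lceil>r / \<eta>\<rceil>"
  have re: "1 \<le> r / \<eta>" using r by simp
  have N: "r / \<eta> \<le> real N" "real N < r / \<eta> + 1" using re unfolding N_def by linarith+
  \<comment> \<open>If balls of different layers met, their unshifted centres would be horizontally
    within \<eta>, hence differ in height by at most \<open>L * \<eta>\<close>, and the relative
    shift would be less than \<open>(1 + L) * \<eta>\<close>. This dictates the step.\<close>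
  let ?c = "\<lambda>(p, j). p + (real j * ((1 + L) * \<eta>)) *\<^sub>R e"
  let ?B = "\<lambda>i. ball (?c i) (\<eta> / 2)"
  have disj: "disjoint_family_on ?B (P \<times> {..<N})"
  proof (unfold disjoint_family_on_def, intro ballI impI equals0I)
    fix u v y assume uv: "u \<in> P \<times> {..<N}" "v \<in> P \<times> {..<N}" "u \<noteq> v" and yuv: "y \<in> ?B u \<inter> ?B v"
    obtain p i q j where u: "u = (p, i)" and v: "v = (q, j)" by fastforce
    have p: "p \<in> P" "q \<in> P" and ne: "\<not> (p = q \<and> i = j)" using uv by (auto simp: u v)
    have y: "y \<in> ball (p + (real i * ((1 + L) * \<eta>)) *\<^sub>R e) (\<eta> / 2)"
        "y \<in> ball (q + (real j * ((1 + L) * \<eta>)) *\<^sub>R e) (\<eta> / 2)" using yuv by (auto simp: u v)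
    define w where "w = p - q"
    define a where "a = (real i - real j) * ((1 + L) * \<eta>)"
    have "dist (p + (real i * ((1 + L) * \<eta>)) *\<^sub>R e) (q + (real j * ((1 + L) * \<eta>)) *\<^sub>R e) < \<eta>"
      using y dist_triangle_half_l by (metis dist_commute mem_ball)
    moreover have "(p + (real i * ((1 + L) * \<eta>)) *\<^sub>R e) - (q + (real j * ((1 + L) * \<eta>)) *\<^sub>R e) = w + a *\<^sub>R e"
      by (simp add: w_def a_def algebra_simps)
    ultimately have lt: "norm (w + a *\<^sub>R e) < \<eta>" by (simp add: dist_norm)
    have ee: "e \<bullet> e = 1" using e by (simp add: dot_square_norm)
    show False
    proof (cases "i = j")
      case True
      then show ?thesis using lt P(3)[OF p] ne by (auto simp: a_def w_def)
    next
      case False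
      let ?z = "w + a *\<^sub>R e"
      have "norm (?z - (?z \<bullet> e) *\<^sub>R e) \<le> norm ?z"
      proof -
        have "(norm (?z - (?z \<bullet> e) *\<^sub>R e))\<^sup>2 = (norm ?z)\<^sup>2 - (?z \<bullet> e)\<^sup>2"
          unfolding power2_norm_eq_inner by (simp only: inner_diff_left inner_diff_right inner_scaleR_left inner_scaleR_right ee inner_commute[of e ?z]) (simp add: power2_eq_square)
        then have "(norm (?z - (?z \<bullet> e) *\<^sub>R e))\<^sup>2 \<le> (norm ?z)\<^sup>2" by simp
        then show ?thesis by (rule power2_le_imp_le) simp
      qed
      moreover have "?z - (?z \<bullet> e) *\<^sub>R e = w - (w \<bullet> e) *\<^sub>R e"
        by (simp add: inner_add_left ee algebra_simps)
      ultimately have "norm (w - (w \<bullet> e) *\<^sub>R e) \<le> \<eta>" using lt by simp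
      then have "\<bar>w \<bullet> e\<bar> \<le> L * \<eta>"
        using lip[of p q] p P(2) L unfolding w_def by (meson mult_left_mono order_trans subsetD)
      moreover have "\<bar>?z \<bullet> e\<bar> < \<eta>"
        using Cauchy_Schwarz_ineq2[of ?z e] e lt by simp
      moreover have "?z \<bullet> e = w \<bullet> e + a" by (simp add: inner_add_left ee)
      ultimately have "\<bar>a\<bar> < \<eta> + L * \<eta>" by linarith
      then have "\<bar>a\<bar> < (1 + L) * \<eta>" by (simp add: distrib_right)
      moreover have "1 * ((1 + L) * \<eta>) \<le> \<bar>real i - real j\<bar> * ((1 + L) * \<eta>)"
        using False L r by (intro mult_right_mono) auto
      ultimately have False using L r by (simp add: a_def abs_mult)
      then show ?thesis ..
    qed
  qed
  let ?R = "(4 + 2 * L) * r"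
  have sub: "(\<Union>i\<in>P \<times> {..<N}. ?B i) \<subseteq> cball x ?R"
  proof clarify
    fix p j y assume p: "p \<in> P" and j: "j < N" and y: "y \<in> ball (p + (real j * ((1 + L) * \<eta>)) *\<^sub>R e) (\<eta> / 2)"
    have "real j \<le> r / \<eta>" using j N(2) by linarith
    then have "real j * ((1 + L) * \<eta>) \<le> r / \<eta> * ((1 + L) * \<eta>)" using L r by (intro mult_right_mono) auto
    then have "real j * ((1 + L) * \<eta>) \<le> (1 + L) * r" using r by (simp add: mult.commute[of r])
    then have "dist (p + (real j * ((1 + L) * \<eta>)) *\<^sub>R e) p \<le> (1 + L) * r"
      using e L r by (simp add: dist_norm)
    moreover have "dist x p \<le> r" using A P(2) p by auto
    moreover have "dist y (p + (real j * ((1 + L) * \<eta>)) *\<^sub>R e) \<le> r" using y r by (simp add: dist_commute)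
    ultimately have "dist x y \<le> r + (1 + L) * r + r"
      using dist_triangle[of x y p] dist_triangle[of y p "p + (real j * ((1 + L) * \<eta>)) *\<^sub>R e"]
      by (simp add: dist_commute)
    also have "\<dots> \<le> ?R" using L r mult_nonneg_nonneg[of L r] by (simp add: algebra_simps)
    finally show "y \<in> cball x ?R" by simp
  qed
  have "real (card P) * real N * (?\<omega> * (\<eta> / 2) ^ ?d) = (\<Sum>i\<in>P \<times> {..<N}. measure lebesgue (?B i))"
    using r by (simp add: content_ball card_cartesian_product)
  also have "\<dots> = measure lebesgue (\<Union>i\<in>P \<times> {..<N}. ?B i)"
    by (rule measure_finite_Union[symmetric]) (use P(1) disj in \<open>auto simp: emeasure_lborel_ball_finite[THEN less_imp_neq, simplified]\<close>)
  also have "\<dots> \<le> measure lebesgue (cball x ?R)"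
    by (rule measure_mono_fmeasurable[OF sub]) (use P(1) in auto)
  also have "\<dots> = ?\<omega> * ?R ^ ?d" using L r by (simp add: content_cball)
  finally have "?\<omega> * (real (card P) * real N * (\<eta> / 2) ^ ?d) \<le> ?\<omega> * ?R ^ ?d" by (simp add: mult_ac)
  then have 1: "real (card P) * real N * (\<eta> / 2) ^ ?d \<le> ?R ^ ?d" by simp
  have "real (card P) * (r / \<eta>) * (\<eta> / 2) ^ ?d \<le> real (card P) * real N * (\<eta> / 2) ^ ?d"
    using N(1) r by (intro mult_right_mono mult_left_mono) auto
  with 1 have 2: "real (card P) * (r / \<eta>) * (\<eta> / 2) ^ ?d \<le> ?R ^ ?d" by linarith
  obtain n where n: "?d = Suc n" by (cases ?d) auto
  have "real (card P) * (r / \<eta>) * (\<eta> / 2) ^ Suc n = r * (real (card P) * \<eta> ^ n) / 2 ^ Suc n"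
    using r by (simp add: power_divide)
  moreover have "?R ^ Suc n = r * ((4 + 2 * L) ^ Suc n * r ^ n)" by (simp add: power_mult_distrib)
  ultimately have "r * (real (card P) * \<eta> ^ n) / 2 ^ Suc n \<le> r * ((4 + 2 * L) ^ Suc n * r ^ n)"
    using 2[unfolded n] by (simp only:)
  then have "r * (real (card P) * \<eta> ^ n) \<le> r * (2 ^ Suc n * (4 + 2 * L) ^ Suc n * r ^ n)"
    by (simp add: pos_divide_le_eq mult_ac)
  then have "real (card P) * \<eta> ^ n \<le> (2 ^ Suc n * (4 + 2 * L) ^ Suc n) * r ^ n"
    using r by simp
  also have "2 ^ Suc n * (4 + 2 * L) ^ Suc n = (8 + 4 * L) ^ Suc n"
    unfolding power_mult_distrib[symmetric] by (simp add: algebra_simps)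
  finally show ?thesis unfolding n by simp
qed

text \<open>A maximal separated subset of \<open>A\<close> is also a net, and
  \<open>graph_packing\<close> bounds its cardinality. The separation is at most
  \<open>\<delta> / 2\<close> to make the covering balls admissible, and at most \<open>r\<close> to
  make the packing bound apply.\<close>

lemma hausdorff_outer_upper:
  fixes e x :: "'a::euclidean_space"
  assumes d: "2 \<le> DIM('a)" and e: "norm e = 1" and L: "0 \<le> L" and r: "0 < r" and A: "A \<subseteq> cball x r"
    and lip: "\<And>p q. p \<in> A \<Longrightarrow> q \<in> A \<Longrightarrow> \<bar>(p - q) \<bullet> e\<bar> \<le> L * norm ((p - q) - ((p - q) \<bullet> e) *\<^sub>R e)"
  shows "hausdorff_outer (DIM('a) - 1) A \<le>
    ennreal (unit_ball_vol (real (DIM('a) - 1)) * (8 + 4 * L) ^ DIM('a) * r ^ (DIM('a) - 1))"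
  unfolding hausdorff_outer_def
proof (rule SUP_least)
  let ?n = "DIM('a) - 1"
  fix \<delta> :: real assume "\<delta> \<in> {0<..}"
  then have \<delta>: "0 < \<delta>" by simp
  define \<eta> where "\<eta> = min (\<delta> / 2) r"
  have \<eta>: "0 < \<eta>" "\<eta> \<le> r" "2 * \<eta> \<le> \<delta>" using \<delta> r by (auto simp: \<eta>_def)
  define Q where "Q P \<longleftrightarrow> finite P \<and> P \<subseteq> A \<and> (\<forall>p\<in>P. \<forall>q\<in>P. p \<noteq> q \<longrightarrow> \<eta> \<le> norm (p - q))" for P
  let ?K = "(8 + 4 * L) ^ DIM('a) * r ^ ?n"
  have card_le: "real (card P) * \<eta> ^ ?n \<le> ?K" if "Q P" for P
    using that graph_packing[OF e L \<eta>(1,2) A lip] unfolding Q_def by blast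
  then have "card P < nat \<lceil>?K / \<eta> ^ ?n\<rceil> + 1" if "Q P" for P
  proof -
    have "real (card P) \<le> ?K / \<eta> ^ ?n" using card_le[OF that] \<eta> by (simp add: pos_le_divide_eq)
    then show ?thesis by linarith
  qed
  moreover have "Q {}" by (simp add: Q_def)
  ultimately obtain P where P: "Q P" "\<And>P'. Q P' \<Longrightarrow> card P' \<le> card P"
    using ex_has_greatest_nat[of Q "{}" card] by (metis Suc_eq_plus1 less_Suc_eq_le)
  have cover: "A \<subseteq> (\<Union>p\<in>P. cball p \<eta>)"
  proof
    fix y assume y: "y \<in> A"
    show "y \<in> (\<Union>p\<in>P. cball p \<eta>)"
    proof (rule ccontr)
      assume n: "\<not> ?thesis"
      then have far: "\<eta> < norm (p - y)" if "p \<in> P" for p using that by (auto simp: dist_norm)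
      then have "y \<notin> P" using \<eta> by fastforce
      moreover have "Q (insert y P)" using P(1) y far unfolding Q_def
        by (auto simp: norm_minus_commute intro: less_imp_le)
      moreover have "finite P" using P(1) by (simp add: Q_def)
      ultimately show False using P(2)[of "insert y P"] by simp
    qed
  qed
  have fin: "finite P" using P(1) by (simp add: Q_def)
  obtain f where f: "bij_betw f {..<card P} P" using ex_bij_betw_nat_finite[OF fin] by (auto simp: lessThan_atLeast0)
  define C where "C i = (if i < card P then cball (f i) \<eta> else {})" for i
  have "A \<subseteq> (\<Union>i. C i)"
  proof
    fix y assume "y \<in> A"
    then obtain p where p: "p \<in> P" "y \<in> cball p \<eta>" using cover by blast
    then have "p \<in> f ` {..<card P}" using bij_betw_imp_surj_on[OF f] by simp
    then obtain i where "i < card P" "f i = p" by auto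
    then have "y \<in> C i" using p(2) by (simp add: C_def)
    then show "y \<in> (\<Union>i. C i)" by blast
  qed
  moreover have "\<forall>i. bounded (C i) \<and> diameter (C i) \<le> \<delta>" using \<eta> by (auto simp: C_def)
  ultimately have "hausdorff_pre ?n \<delta> A \<le> (\<Sum>i. hausdorff_size ?n (C i))"
    unfolding hausdorff_pre_def by (intro Inf_lower CollectI exI[of _ C] conjI refl)
  also have "\<dots> = (\<Sum>i<card P. hausdorff_size ?n (C i))"
    by (rule suminf_finite) (auto simp: C_def hausdorff_size_def)
  also have "\<dots> = (\<Sum>i<card P. ennreal (unit_ball_vol (real ?n) * \<eta> ^ ?n))"
    using \<eta> by (intro sum.cong) (auto simp: C_def hausdorff_size_def power_mult_distrib)
  also have "\<dots> = ennreal (real (card P) * (unit_ball_vol (real ?n) * \<eta> ^ ?n))"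
    using \<eta> by (simp add: ennreal_mult ennreal_of_nat_eq_real_of_nat)
  also have "\<dots> \<le> ennreal (unit_ball_vol (real ?n) * (8 + 4 * L) ^ DIM('a) * r ^ ?n)"
  proof (rule ennreal_leI)
    have "unit_ball_vol (real ?n) * (real (card P) * \<eta> ^ ?n) \<le> unit_ball_vol (real ?n) * ?K"
      using card_le[OF P(1)] by (intro mult_left_mono) auto
    then show "real (card P) * (unit_ball_vol (real ?n) * \<eta> ^ ?n) \<le> unit_ball_vol (real ?n) * (8 + 4 * L) ^ DIM('a) * r ^ ?n"
      by (simp only: mult_ac)
  qed
  finally show "hausdorff_pre ?n \<delta> A \<le> ennreal (unit_ball_vol (real ?n) * (8 + 4 * L) ^ DIM('a) * r ^ ?n)" .
qed

section \<open>Lipschitz charts\<close>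

text \<open>Unlike in \<open>lipschitz_domain\<close>, the neighbourhood is a ball of prescribed
  radius and the Lipschitz constant is a parameter, so that both can be uniform along the
  boundary.\<close>

definition graph_chart :: "'a::euclidean_space set \<Rightarrow> real \<Rightarrow> real \<Rightarrow> 'a \<Rightarrow> 'a \<Rightarrow> ('a \<Rightarrow> real) \<Rightarrow> bool" where
  "graph_chart \<Omega> R L x e g \<longleftrightarrow> norm e = 1 \<and> 0 \<le> L \<and> L-lipschitz_on {y. y \<bullet> e = 0} g \<and>
     \<Omega> \<inter> ball x R = {y\<in>ball x R. y \<bullet> e < g (y - (y \<bullet> e) *\<^sub>R e)}"

text \<open>Compactness of the boundary. A chart valid on the ball of radius
  \<open>2 * \<rho> y\<close> around \<open>y\<close> serves, with the same axis and graph, all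
  boundary points within \<open>\<rho> y\<close> of \<open>y\<close>, on balls of radius at most
  \<open>\<rho> y\<close>.\<close>

lemma lipschitz_domain_charts:
  fixes \<Omega> :: "'a::euclidean_space set"
  assumes "lipschitz_domain \<Omega>" "bounded \<Omega>"
  obtains R L where "0 < R" "0 \<le> L" "\<And>x. x \<in> frontier \<Omega> \<Longrightarrow> \<exists>e g. graph_chart \<Omega> R L x e g"
proof -
  have "\<forall>x\<in>frontier \<Omega>. \<exists>r L. 0 < r \<and> (\<exists>e g. norm e = 1 \<and> L-lipschitz_on {y. y \<bullet> e = 0} g \<and>
     \<Omega> \<inter> ball x (2 * r) = {y\<in>ball x (2 * r). y \<bullet> e < g (y - (y \<bullet> e) *\<^sub>R e)})"
  proof
    fix x assume "x \<in> frontier \<Omega>"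
    then obtain U e L g where U: "open U" "x \<in> U" "norm e = 1" "L-lipschitz_on {y. y \<bullet> e = 0} g"
      "\<Omega> \<inter> U = {y\<in>U. y \<bullet> e < g (y - (y \<bullet> e) *\<^sub>R e)}"
      using assms(1) unfolding lipschitz_domain_def by blast
    then obtain r where r: "0 < r" "ball x r \<subseteq> U" using openE by blast
    have "\<Omega> \<inter> ball x (2 * (r/2)) = {y\<in>ball x (2 * (r/2)). y \<bullet> e < g (y - (y \<bullet> e) *\<^sub>R e)}"
      using U(5) r(2) by auto
    then show "\<exists>r L. 0 < r \<and> (\<exists>e g. norm e = 1 \<and> L-lipschitz_on {y. y \<bullet> e = 0} g \<and>
     \<Omega> \<inter> ball x (2 * r) = {y\<in>ball x (2 * r). y \<bullet> e < g (y - (y \<bullet> e) *\<^sub>R e)})"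
      using U(3,4) r(1) half_gt_zero by blast
  qed
  from bchoice[OF this] obtain \<rho> where "\<forall>x\<in>frontier \<Omega>. \<exists>L. 0 < \<rho> x \<and> (\<exists>e g. norm e = 1 \<and> L-lipschitz_on {y. y \<bullet> e = 0} g \<and>
     \<Omega> \<inter> ball x (2 * \<rho> x) = {y\<in>ball x (2 * \<rho> x). y \<bullet> e < g (y - (y \<bullet> e) *\<^sub>R e)})" ..
  from bchoice[OF this] obtain \<Lambda> where "\<forall>x\<in>frontier \<Omega>. 0 < \<rho> x \<and> (\<exists>e g. norm e = 1 \<and> (\<Lambda> x)-lipschitz_on {y. y \<bullet> e = 0} g \<and>
     \<Omega> \<inter> ball x (2 * \<rho> x) = {y\<in>ball x (2 * \<rho> x). y \<bullet> e < g (y - (y \<bullet> e) *\<^sub>R e)})" ..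
  then have \<rho>: "\<And>x. x \<in> frontier \<Omega> \<Longrightarrow> 0 < \<rho> x"
    "\<And>x. x \<in> frontier \<Omega> \<Longrightarrow> \<exists>e g. norm e = 1 \<and> (\<Lambda> x)-lipschitz_on {y. y \<bullet> e = 0} g \<and>
     \<Omega> \<inter> ball x (2 * \<rho> x) = {y\<in>ball x (2 * \<rho> x). y \<bullet> e < g (y - (y \<bullet> e) *\<^sub>R e)}"
    by simp_all
  have "compact (frontier \<Omega>)" using assms(2) compact_frontier_bounded by blast
  moreover have "frontier \<Omega> \<subseteq> (\<Union>x\<in>frontier \<Omega>. ball x (\<rho> x))" using \<rho>(1) by auto
  ultimately obtain D where D: "D \<subseteq> frontier \<Omega>" "finite D" "frontier \<Omega> \<subseteq> (\<Union>x\<in>D. ball x (\<rho> x))"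
    using compactE_image[of "frontier \<Omega>" "frontier \<Omega>" "\<lambda>x. ball x (\<rho> x)"] by auto
  define R where "R = Min (insert 1 (\<rho> ` D))"
  define L where "L = Max (insert 0 (\<Lambda> ` D))"
  have R: "0 < R" unfolding R_def using D \<rho>(1) by (subst Min_gr_iff) auto
  have L: "0 \<le> L" unfolding L_def using D by (intro Max_ge) auto
  have "\<exists>e g. graph_chart \<Omega> R L x e g" if x: "x \<in> frontier \<Omega>" for x
  proof -
    obtain y where y: "y \<in> D" "x \<in> ball y (\<rho> y)" using D(3) x by blast
    have Ry: "R \<le> \<rho> y" unfolding R_def using D(2) y(1) by (intro Min_le) auto
    have Ly: "\<Lambda> y \<le> L" unfolding L_def using D(2) y(1) by (intro Max_ge) auto
    obtain e g where eg: "norm e = 1" "(\<Lambda> y)-lipschitz_on {y. y \<bullet> e = 0} g"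
      "\<Omega> \<inter> ball y (2 * \<rho> y) = {z\<in>ball y (2 * \<rho> y). z \<bullet> e < g (z - (z \<bullet> e) *\<^sub>R e)}"
      using \<rho>(2) y(1) D(1) by blast
    have "ball x R \<subseteq> ball y (2 * \<rho> y)"
    proof
      fix z assume "z \<in> ball x R"
      then show "z \<in> ball y (2 * \<rho> y)" using y(2) Ry dist_triangle[of y z x] by simp
    qed
    then have "\<Omega> \<inter> ball x R = {z\<in>ball x R. z \<bullet> e < g (z - (z \<bullet> e) *\<^sub>R e)}" using eg(3) by blast
    moreover have "L-lipschitz_on {y. y \<bullet> e = 0} g" using lipschitz_on_mono[OF eg(2)] Ly by auto
    ultimately show ?thesis unfolding graph_chart_def using eg(1) L by blast
  qed
  then show ?thesis using that R L by blast
qed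

locale lipschitz_chart =
  fixes \<Omega> :: "'a::euclidean_space set" and R L :: real and x e :: 'a and g :: "'a \<Rightarrow> real"
  assumes chart: "graph_chart \<Omega> R L x e g" and open_\<Omega>: "open \<Omega>" and x_frontier: "x \<in> frontier \<Omega>" and R_pos: "0 < R"
begin

lemma norm_e: "norm e = 1" and ee: "e \<bullet> e = 1" and L_nonneg: "0 \<le> L"
  using chart by (auto simp: graph_chart_def dot_square_norm)

definition horiz :: "'a \<Rightarrow> 'a" where "horiz v = v - (v \<bullet> e) *\<^sub>R e"

text \<open>The signed height over the graph, negative in the domain. Moving along \<open>e\<close>
  changes it at unit rate, which is how points are pushed onto the boundary.\<close>

definition level :: "'a \<Rightarrow> real" where "level y = y \<bullet> e - g (horiz y)"

lemma horiz_orth: "horiz v \<bullet> e = 0"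
  by (simp add: horiz_def inner_diff_left ee)

lemma horiz_diff: "horiz (v - w) = horiz v - horiz w"
  by (simp add: horiz_def inner_diff_left algebra_simps)

lemma norm_horiz_le: "norm (horiz v) \<le> norm v"
proof -
  have "(norm (horiz v))\<^sup>2 = (norm v)\<^sup>2 - (v \<bullet> e)\<^sup>2"
    unfolding power2_norm_eq_inner horiz_def
    by (simp add: inner_diff_left inner_diff_right ee inner_commute[of e v] power2_eq_square)
  then have "(norm (horiz v))\<^sup>2 \<le> (norm v)\<^sup>2" by simp
  then show ?thesis by (rule power2_le_imp_le) simp
qed

lemma inner_e_le: "\<bar>v \<bullet> e\<bar> \<le> norm v"
  using Cauchy_Schwarz_ineq2[of v e] norm_e by simp

lemma g_lipschitz: "\<bar>g (horiz y) - g (horiz z)\<bar> \<le> L * norm (horiz (y - z))"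
proof -
  have "L-lipschitz_on {y. y \<bullet> e = 0} g" using chart by (simp add: graph_chart_def)
  from lipschitz_onD[OF this, of "horiz y" "horiz z"] show ?thesis
    by (simp add: horiz_orth horiz_diff dist_norm)
qed

lemma level_lipschitz: "\<bar>level y - level z\<bar> \<le> (1 + L) * norm (y - z)"
proof -
  have "\<bar>level y - level z\<bar> \<le> \<bar>(y - z) \<bullet> e\<bar> + \<bar>g (horiz y) - g (horiz z)\<bar>"
    by (simp add: level_def inner_diff_left)
  also have "\<dots> \<le> norm (y - z) + L * norm (y - z)"
    using inner_e_le[of "y - z"] g_lipschitz[of y z] mult_left_mono[OF norm_horiz_le[of "y - z"] L_nonneg] by linarith
  finally show ?thesis by (simp add: distrib_right)
qed

lemma level_continuous: "continuous_on S level"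
  by (rule lipschitz_on_continuous_on[of "1 + L"], rule lipschitz_onI)
    (use level_lipschitz L_nonneg in \<open>auto simp: dist_norm\<close>)

lemma level_shift: "level (y + t *\<^sub>R e) = level y + t"
  by (simp add: level_def horiz_def inner_add_left ee algebra_simps)

lemma in_domain_iff: "y \<in> ball x R \<Longrightarrow> y \<in> \<Omega> \<longleftrightarrow> level y < 0"
  using chart unfolding graph_chart_def level_def horiz_def by force

lemma in_frontier_iff:
  assumes y: "y \<in> ball x R"
  shows "y \<in> frontier \<Omega> \<longleftrightarrow> level y = 0"
proof
  assume f: "y \<in> frontier \<Omega>"
  then have "y \<notin> \<Omega>" using open_\<Omega> by (auto simp: frontier_def interior_open)
  then have "0 \<le> level y" using in_domain_iff[OF y] by simp
  moreover have "\<not> 0 < level y"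
  proof
    assume "0 < level y"
    then have "y \<in> {z. 0 < level z} \<inter> ball x R" using y by simp
    moreover have "open ({z. 0 < level z} \<inter> ball x R)"
      by (intro open_Int open_ball open_Collect_less continuous_on_const level_continuous)
    moreover have "y \<in> closure \<Omega>" using f by (simp add: frontier_def)
    ultimately obtain z where "z \<in> \<Omega>" "z \<in> {z. 0 < level z} \<inter> ball x R"
      by (meson closure_iff_nhds_not_empty disjoint_iff order_refl)
    then show False using in_domain_iff[of z] by simp
  qed
  ultimately show "level y = 0" by simp
next
  assume l: "level y = 0"
  then have "y \<notin> \<Omega>" using in_domain_iff[OF y] by simp
  moreover have "y \<in> closure \<Omega>"
    unfolding closure_approachable
  proof (intro allI impI)
    fix \<epsilon> :: real assume \<epsilon>: "0 < \<epsilon>"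
    define t where "t = min (\<epsilon> / 2) ((R - dist x y) / 2)"
    have t: "0 < t" "t < \<epsilon>" "t < R - dist x y" using \<epsilon> y by (auto simp: t_def min_def)
    let ?z = "y + (- t) *\<^sub>R e"
    have d: "dist ?z y = t" using t norm_e by (simp add: dist_norm)
    have "?z \<in> ball x R" using d t dist_triangle[of x ?z y] by (simp add: dist_commute)
    then have "?z \<in> \<Omega>" using in_domain_iff[of ?z] level_shift[of y "- t"] l t by simp
    then show "\<exists>z\<in>\<Omega>. dist z y < \<epsilon>" using d t(2) by metis
  qed
  ultimately show "y \<in> frontier \<Omega>" using open_\<Omega> by (simp add: frontier_def interior_open)
qed

lemma level_x: "level x = 0"
  using in_frontier_iff[of x] x_frontier R_pos by simp

lemma frontier_graph:
  assumes "p \<in> frontier \<Omega>" "q \<in> frontier \<Omega>" "p \<in> ball x R" "q \<in> ball x R"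
  shows "\<bar>(p - q) \<bullet> e\<bar> \<le> L * norm ((p - q) - ((p - q) \<bullet> e) *\<^sub>R e)"
proof -
  have "level p = 0" "level q = 0" using in_frontier_iff assms by auto
  then have "(p - q) \<bullet> e = g (horiz p) - g (horiz q)" by (simp add: level_def inner_diff_left)
  then show ?thesis using g_lipschitz[of p q] by (simp add: horiz_def)
qed

lemma frontier_measure_upper:
  assumes d: "2 \<le> DIM('a)" and r: "0 < r" "r < R" and A: "A \<subseteq> frontier \<Omega> \<inter> cball x r"
  shows "hausdorff_outer (DIM('a) - 1) A \<le>
    ennreal (unit_ball_vol (real (DIM('a) - 1)) * (8 + 4 * L) ^ DIM('a) * r ^ (DIM('a) - 1))"
proof (rule hausdorff_outer_upper[OF d norm_e L_nonneg r(1)])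
  show "A \<subseteq> cball x r" using A by blast
  have "A \<subseteq> ball x R" using A r by auto
  then show "\<bar>(p - q) \<bullet> e\<bar> \<le> L * norm ((p - q) - ((p - q) \<bullet> e) *\<^sub>R e)" if "p \<in> A" "q \<in> A" for p q
    using frontier_graph[of p q] A that by blast
qed

text \<open>Each point of the ball of radius \<open>r / (2 + L)\<close> is moved along
  \<open>e\<close> onto the graph, by the amount of its level and without leaving
  \<open>cball x r\<close>. So the thickened boundary piece contains a ball, and
  \<open>hausdorff_outer_lower\<close> applies.\<close>

lemma frontier_measure_lower:
  assumes d: "2 \<le> DIM('a)" and r: "0 < r" "r < R"
  shows "ennreal (unit_ball_vol (real (DIM('a) - 1)) / (5 * 4 ^ DIM('a)) / ((2 + L) ^ DIM('a) * (1 + L)) * r ^ (DIM('a) - 1))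
    \<le> hausdorff_outer (DIM('a) - 1) (frontier \<Omega> \<inter> cball x r)"
proof -
  define \<rho> where "\<rho> = r / (2 + L)"
  have \<rho>: "0 < \<rho>" "(2 + L) * \<rho> = r" using r L_nonneg by (auto simp: \<rho>_def)
  have "cball x \<rho> \<subseteq> {y + t *\<^sub>R e | y t. y \<in> frontier \<Omega> \<inter> cball x r \<and> \<bar>t\<bar> \<le> (1 + L) * \<rho>}"
  proof
    fix z assume z: "z \<in> cball x \<rho>"
    define y where "y = z + (- level z) *\<^sub>R e"
    have "\<bar>level z\<bar> \<le> (1 + L) * norm (z - x)" using level_lipschitz[of z x] level_x by simp
    also have "\<dots> \<le> (1 + L) * \<rho>"
      using z L_nonneg by (intro mult_left_mono) (auto simp: dist_norm norm_minus_commute)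
    finally have t: "\<bar>level z\<bar> \<le> (1 + L) * \<rho>" .
    have "dist y z \<le> (1 + L) * \<rho>" using t norm_e by (simp add: y_def dist_norm)
    moreover have "(1 + L) * \<rho> + \<rho> = r" using \<rho>(2) by (simp add: algebra_simps)
    ultimately have "dist x y \<le> r" using z dist_triangle[of x y z] by (simp add: dist_commute)
    then have yc: "y \<in> cball x r" by simp
    then have "y \<in> ball x R" using r by simp
    moreover have "level y = 0" by (simp add: y_def level_shift[of z "- level z", simplified])
    ultimately have "y \<in> frontier \<Omega>" using in_frontier_iff by blast
    moreover have "z = y + level z *\<^sub>R e" by (simp add: y_def)
    ultimately show "z \<in> {y + t *\<^sub>R e | y t. y \<in> frontier \<Omega> \<inter> cball x r \<and> \<bar>t\<bar> \<le> (1 + L) * \<rho>}"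
      using yc t by blast
  qed
  from hausdorff_outer_lower[OF d norm_e _ _ this]
  have "ennreal (unit_ball_vol (real (DIM('a) - 1)) / (5 * 4 ^ DIM('a)) * \<rho> ^ DIM('a) / ((1 + L) * \<rho>))
    \<le> hausdorff_outer (DIM('a) - 1) (frontier \<Omega> \<inter> cball x r)"
    using \<rho> L_nonneg by simp
  moreover obtain n where n: "DIM('a) = Suc n" by (cases "DIM('a)") auto
  have "unit_ball_vol (real n) / (5 * 4 ^ Suc n) * \<rho> ^ Suc n / ((1 + L) * \<rho>) =
     unit_ball_vol (real n) / (5 * 4 ^ Suc n) / ((2 + L) ^ n * (1 + L)) * r ^ n"
    using \<rho>(1) r L_nonneg unfolding \<rho>_def by (simp add: power_divide)
  moreover have "unit_ball_vol (real n) / (5 * 4 ^ Suc n) / ((2 + L) ^ Suc n * (1 + L)) * r ^ n \<le>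
     unit_ball_vol (real n) / (5 * 4 ^ Suc n) / ((2 + L) ^ n * (1 + L)) * r ^ n"
    using r L_nonneg by (intro mult_right_mono divide_left_mono mult_right_mono power_increasing) auto
  ultimately show ?thesis unfolding n by (simp add: order_trans[OF ennreal_leI])
qed

text \<open>Points \<open>w\<close> in the ball at depth \<open>(2 + 2 * L) * r\<close> below
  \<open>x\<close> see every domain point near \<open>x\<close>: the segment falls by at least
  \<open>L\<close> times its horizontal extent and thus cannot cross the graph.\<close>

lemma star_shaped:
  assumes r: "0 < r" "(4 + 2 * L) * r < R" and y: "y \<in> \<Omega>" "y \<in> ball x r"
    and w: "w \<in> ball (x - ((2 + 2 * L) * r) *\<^sub>R e) r"
  shows "closed_segment y w \<subseteq> \<Omega>" "dist y w \<le> (4 + 2 * L) * r"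
proof -
  let ?M = "2 + 2 * L"
  define \<delta> where "\<delta> = w - (x - (?M * r) *\<^sub>R e)"
  have \<delta>: "norm \<delta> < r" using w by (simp add: \<delta>_def dist_norm norm_minus_commute)
  have yx: "norm (y - x) < r" using y(2) by (simp add: dist_norm norm_minus_commute)
  have wy: "w - y = \<delta> - (y - x) - (?M * r) *\<^sub>R e" by (simp add: \<delta>_def)
  have w_dist: "dist x w \<le> (3 + 2 * L) * r"
  proof -
    have "norm (x - w) \<le> norm ((?M * r) *\<^sub>R e) + norm \<delta>"
      using norm_triangle_ineq4[of "(?M * r) *\<^sub>R e" \<delta>] by (simp add: \<delta>_def)
    also have "norm ((?M * r) *\<^sub>R e) = ?M * r" using norm_e r L_nonneg by simp
    finally show ?thesis using \<delta> by (simp add: dist_norm algebra_simps)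
  qed
  then show "dist y w \<le> (4 + 2 * L) * r"
    using dist_triangle[of y w x] y(2) by (simp add: dist_commute algebra_simps)
  have Lr: "0 \<le> L * r" using L_nonneg r by simp
  have "x \<in> ball x R" "y \<in> ball x R" "w \<in> ball x R"
    using y(2) w_dist r Lr R_pos by (auto simp: algebra_simps)
  then have seg: "closed_segment y w \<subseteq> ball x R" using closed_segment_subset[OF _ _ convex_ball] by blast
  \<comment> \<open>The offsets \<delta> and \<open>y - x\<close> are shorter than \<open>r\<close>
    each. Together they cost 2 r of the depth and give a horizontal extent of at most 2 r, so the
    remaining fall of 2 L r balances the Lipschitz bound.\<close>
  have slope: "(w - y) \<bullet> e + L * norm (horiz (w - y)) \<le> 0"
  proof -
    have "(w - y) \<bullet> e = \<delta> \<bullet> e - (y - x) \<bullet> e - ?M * r"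
      unfolding wy by (simp add: inner_diff_left ee)
    then have 1: "(w - y) \<bullet> e \<le> r + r - ?M * r"
      using inner_e_le[of \<delta>] inner_e_le[of "y - x"] \<delta> yx by linarith
    have "horiz (w - y) = horiz (\<delta> - (y - x))"
      unfolding wy by (simp add: horiz_def inner_diff_left ee algebra_simps)
    then have "norm (horiz (w - y)) \<le> norm (\<delta> - (y - x))" using norm_horiz_le by simp
    also have "\<dots> \<le> r + r" using norm_triangle_ineq4[of \<delta> "y - x"] \<delta> yx by linarith
    finally have "L * norm (horiz (w - y)) \<le> L * (r + r)" using L_nonneg by (rule mult_left_mono)
    then show ?thesis using 1 by (simp add: algebra_simps)
  qed
  show "closed_segment y w \<subseteq> \<Omega>"
  proof
    fix z assume z: "z \<in> closed_segment y w"
    then obtain t where t: "0 \<le> t" "t \<le> 1" "z = (1 - t) *\<^sub>R y + t *\<^sub>R w" unfolding in_segment by blast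
    have zy: "z - y = t *\<^sub>R (w - y)" unfolding t(3) by (simp add: algebra_simps)
    have "level z - level y = (z - y) \<bullet> e - (g (horiz z) - g (horiz y))" by (simp add: level_def inner_diff_left)
    also have "\<dots> \<le> (z - y) \<bullet> e + L * norm (horiz (z - y))" using g_lipschitz[of z y] by linarith
    also have "\<dots> = t * ((w - y) \<bullet> e + L * norm (horiz (w - y)))"
    proof -
      have "horiz (z - y) = t *\<^sub>R horiz (w - y)" unfolding zy horiz_def
        by (simp only: inner_scaleR_left scaleR_diff_right[of t "w - y"] scaleR_scaleR)
      then show ?thesis using t(1) by (simp add: zy distrib_left)
    qed
    also have "\<dots> \<le> 0" using slope t(1) by (rule mult_nonneg_nonpos[rotated])
    finally have "level z \<le> level y" by simp
    also have "\<dots> < 0" using in_domain_iff[of y] y r Lr \<open>y \<in> ball x R\<close> by simp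
    finally show "z \<in> \<Omega>" using in_domain_iff z seg by blast
  qed
qed

end

section \<open>Walking through a mesh\<close>

text \<open>A vertex belongs to at most N = \<open>nat \<lfloor>s ^ d\<rfloor>\<close> cells, cells
  linked around it are linked by a chain of at most N squared edge neighbours, and each step changes
  the diameter by at most the factor \<open>s\<close>.\<close>

definition cell_ratio :: "nat \<Rightarrow> real \<Rightarrow> real" where
  "cell_ratio d s = s ^ (nat \<lfloor>s ^ d\<rfloor> * nat \<lfloor>s ^ d\<rfloor>)"

text \<open>The slope of the cut-off times the diameter of its cell: \<open>Suc d\<close> vertex
  terms, each of slope at most \<open>1 / r\<close> on a near cell whose inscribed radius
  \<open>r\<close> is at least that diameter divided by \<open>s * cell_ratio d s\<close>.\<close>

definition walk_ratio :: "nat \<Rightarrow> real \<Rightarrow> real" where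
  "walk_ratio d s = real (Suc d) * s * cell_ratio d s"

lemma cell_ratio_ge_1: "1 \<le> s \<Longrightarrow> 1 \<le> cell_ratio d s"
  unfolding cell_ratio_def by (rule one_le_power)

lemma walk_ratio_pos: "1 \<le> s \<Longrightarrow> 0 < walk_ratio d s"
  using cell_ratio_ge_1[of s d] by (auto simp: walk_ratio_def intro!: mult_pos_pos)

locale regular_mesh = simplicial_mesh \<A> for \<A> :: "'a::euclidean_space set set" +
  fixes s :: real
  assumes s_ge_1: "1 \<le> s"
    and shape: "\<And>T. T \<in> \<A> \<Longrightarrow> \<exists>c r. 0 < r \<and> cball c r \<subseteq> T \<and> diameter T \<le> s * r"
begin

lemma diameter_pos:
  assumes "T \<in> \<A>" shows "0 < diameter T"
proof -
  obtain c r where r: "0 < r" "cball c r \<subseteq> T" using shape[OF assms] by blast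
  have "diameter (cball c r) \<le> diameter T"
    by (rule diameter_subset[OF r(2) compact_imp_bounded[OF full_simplex.compact_T[OF cell[OF assms]]]])
  then show ?thesis using r(1) by simp
qed

definition star :: "'a \<Rightarrow> 'a set set" where "star z = {T\<in>\<A>. z \<in> verts T}"

text \<open>Cells that share an edge at \<open>z\<close> have comparable diameters, whereas cells that share only
  the vertex \<open>z\<close> need not: the mesh may be pinched at \<open>z\<close>.\<close>

definition edge_adj :: "'a \<Rightarrow> ('a set \<times> 'a set) set" where
  "edge_adj z = {(T, T'). T \<in> star z \<and> T' \<in> star z \<and> (\<exists>w. w \<noteq> z \<and> w \<in> verts T \<and> w \<in> verts T')}"

text \<open>A chain stays in the star of one fixed vertex of \<open>T\<close>. This bounds its
  length, and it makes the relation symmetric because the last cell has the same vertex.\<close>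

definition near :: "'a set \<Rightarrow> 'a set set" where
  "near T = {T'\<in>\<A>. \<exists>z\<in>verts T. (T, T') \<in> (edge_adj z)\<^sup>*}"

section \<open>Number and size of the cells near a cell\<close>

lemma finite_star: "finite (star z)" using finite_mesh by (simp add: star_def)

lemma edge_adj_sym: "sym (edge_adj z)" by (auto simp: edge_adj_def sym_def)

lemma edge_adj_subset: "edge_adj z \<subseteq> star z \<times> star z" by (auto simp: edge_adj_def)

lemma rtrancl_edge_adj_star: "(T, T') \<in> (edge_adj z)\<^sup>* \<Longrightarrow> T \<in> star z \<Longrightarrow> T' \<in> star z"
  by (induction rule: rtrancl_induct) (use edge_adj_subset in auto)

lemma near_sym:
  assumes "T \<in> \<A>" "T' \<in> near T" shows "T \<in> near T'"
proof -
  obtain z where z: "z \<in> verts T" "(T, T') \<in> (edge_adj z)\<^sup>*" "T' \<in> \<A>" using assms(2) by (auto simp: near_def)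
  have "T' \<in> star z" using rtrancl_edge_adj_star[OF z(2)] assms(1) z(1) by (simp add: star_def)
  moreover have "(T', T) \<in> (edge_adj z)\<^sup>*" using z(2) sym_rtrancl[OF edge_adj_sym] by (meson symD)
  ultimately show ?thesis using assms(1) by (auto simp: near_def star_def)
qed

lemma near_subset: "near T \<subseteq> \<A>" by (auto simp: near_def)

lemma finite_near: "finite (near T)" using finite_subset[OF near_subset finite_mesh] .

text \<open>Shrinking the cells at \<open>z\<close> towards \<open>z\<close>, all to the smallest
  diameter \<epsilon> among them, gives disjoint balls of radius \<open>\<epsilon> / s\<close> in
  one ball of radius \<epsilon>. The count therefore holds although diameters at \<open>z\<close>
  may be incomparable.\<close>

lemma card_star_le: "real (card (star z)) \<le> s ^ DIM('a)"
proof (cases "star z = {}")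
  case True
  then show ?thesis using s_ge_1 by simp
next
  case False
  let ?d = "DIM('a)" and ?\<omega> = "unit_ball_vol (real DIM('a))"
  define \<epsilon> where "\<epsilon> = Min (diameter ` star z)"
  have in_mesh: "T \<in> \<A>" "z \<in> T" if "T \<in> star z" for T
    using that full_simplex.verts(6)[OF cell] by (auto simp: star_def)
  have \<epsilon>: "0 < \<epsilon>" "\<And>T. T \<in> star z \<Longrightarrow> \<epsilon> \<le> diameter T"
    unfolding \<epsilon>_def using False finite_star diameter_pos in_mesh by (auto simp: Min_gr_iff)
  have "\<exists>c. ball c (\<epsilon> / s) \<subseteq> interior T \<inter> cball z \<epsilon>" if T: "T \<in> star z" for T
  proof -
    interpret full_simplex T using cell in_mesh(1)[OF T] by blast
    obtain c r where r: "0 < r" "cball c r \<subseteq> T" "diameter T \<le> s * r" using shape in_mesh(1)[OF T] by blast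
    define \<theta> where "\<theta> = \<epsilon> / diameter T"
    have h: "0 < diameter T" using diameter_pos in_mesh(1)[OF T] by blast
    have \<theta>: "0 < \<theta>" "\<theta> \<le> 1" "\<theta> * diameter T = \<epsilon>" using \<epsilon> T h by (auto simp: \<theta>_def)
    have sub: "y \<in> T \<and> dist z y \<le> \<epsilon>" if "y \<in> ball (z + \<theta> *\<^sub>R (c - z)) (\<epsilon> / s)" for y
    proof -
      define w where "w = z + (1 / \<theta>) *\<^sub>R (y - z)"
      have y: "y = z + \<theta> *\<^sub>R (w - z)" using \<theta> by (simp add: w_def)
      have "z + \<theta> *\<^sub>R (c - z) - y = \<theta> *\<^sub>R (c - w)" unfolding y by (simp add: algebra_simps)
      then have "\<theta> * norm (c - w) < \<epsilon> / s" using that \<theta> by (simp add: dist_norm)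
      also have "\<dots> \<le> \<theta> * r"
      proof -
        have "\<theta> * diameter T \<le> \<theta> * (s * r)" using r(3) \<theta>(1) by (intro mult_left_mono) auto
        then show ?thesis using s_ge_1 unfolding \<theta>(3) by (simp add: divide_le_eq mult_ac)
      qed
      finally have "w \<in> cball c r" using \<theta> by (simp add: dist_norm)
      then have w: "w \<in> T" using r by auto
      have "y = (1 - \<theta>) *\<^sub>R z + \<theta> *\<^sub>R w" unfolding y by (simp add: algebra_simps)
      then have "y \<in> T" using convexD_alt[OF convex_T in_mesh(2)[OF T] w] \<theta> by simp
      moreover have "norm (w - z) \<le> diameter T"
        using diameter_bounded_bound[OF compact_imp_bounded[OF compact_T] w in_mesh(2)[OF T]] by (simp add: dist_norm)
      then have "\<theta> * norm (w - z) \<le> \<epsilon>" using \<theta>(1) by (simp flip: \<theta>(3))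
      then have "dist z y \<le> \<epsilon>" unfolding y using \<theta>(1) by (simp add: dist_norm)
      ultimately show ?thesis by blast
    qed
    then have "ball (z + \<theta> *\<^sub>R (c - z)) (\<epsilon> / s) \<subseteq> interior T" by (intro interior_maximal) auto
    then show ?thesis using sub by (intro exI[of _ "z + \<theta> *\<^sub>R (c - z)"]) auto
  qed
  then obtain c where c: "\<And>T. T \<in> star z \<Longrightarrow> ball (c T) (\<epsilon> / s) \<subseteq> interior T \<inter> cball z \<epsilon>" by metis
  have disj: "disjoint_family_on (\<lambda>T. ball (c T) (\<epsilon> / s)) (star z)"
    unfolding disjoint_family_on_def
  proof (intro ballI impI)
    fix T T' assume T: "T \<in> star z" "T' \<in> star z" "T \<noteq> T'"
    then have "T \<inter> interior T' = {}" using interior_disjoint in_mesh by blast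
    then show "ball (c T) (\<epsilon> / s) \<inter> ball (c T') (\<epsilon> / s) = {}"
      using c[OF T(1)] c[OF T(2)] interior_subset by blast
  qed
  have "real (card (star z)) * (?\<omega> * (\<epsilon> / s) ^ ?d) = (\<Sum>T\<in>star z. measure lebesgue (ball (c T) (\<epsilon> / s)))"
    using \<epsilon> s_ge_1 by (simp add: content_ball)
  also have "\<dots> = measure lebesgue (\<Union>T\<in>star z. ball (c T) (\<epsilon> / s))"
    by (rule measure_finite_Union[symmetric])
      (use finite_star disj in \<open>auto simp: emeasure_lborel_ball_finite[THEN less_imp_neq, simplified]\<close>)
  also have "\<dots> \<le> measure lebesgue (cball z \<epsilon>)"
    by (rule measure_mono_fmeasurable) (use c finite_star in auto)
  also have "\<dots> = ?\<omega> * \<epsilon> ^ ?d" using \<epsilon> by (simp add: content_cball)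
  finally have "?\<omega> * (real (card (star z)) * (\<epsilon> / s) ^ ?d) \<le> ?\<omega> * \<epsilon> ^ ?d" by (simp only: mult_ac)
  then have "real (card (star z)) * (\<epsilon> / s) ^ ?d \<le> \<epsilon> ^ ?d" by simp
  then show ?thesis using \<epsilon>(1) s_ge_1 by (simp add: power_divide field_simps)
qed

lemma card_near_le: 
  assumes "T \<in> \<A>" shows "real (card (near T)) \<le> real (Suc (DIM('a))) * s ^ DIM('a)"
proof -
  have "near T \<subseteq> (\<Union>z\<in>verts T. star z)"
  proof
    fix T' assume "T' \<in> near T"
    then obtain z where "z \<in> verts T" "(T, T') \<in> (edge_adj z)\<^sup>*" by (auto simp: near_def)
    moreover then have "T' \<in> star z" using rtrancl_edge_adj_star assms by (auto simp: star_def)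
    ultimately show "T' \<in> (\<Union>z\<in>verts T. star z)" by blast
  qed
  moreover have fin: "finite (verts T)" "card (verts T) = Suc (DIM('a))" using full_simplex.verts(1,2)[OF cell[OF assms]] by auto
  ultimately have "card (near T) \<le> card (\<Union>z\<in>verts T. star z)"
    by (intro card_mono) (auto simp: finite_star)
  also have "\<dots> \<le> (\<Sum>z\<in>verts T. card (star z))" by (rule card_UN_le[OF fin(1)])
  finally have "real (card (near T)) \<le> real (\<Sum>z\<in>verts T. card (star z))" by (rule of_nat_mono)
  also have "\<dots> = (\<Sum>z\<in>verts T. real (card (star z)))" by simp
  also have "\<dots> \<le> real (card (verts T)) * s ^ DIM('a)" by (rule sum_bounded_above) (rule card_star_le)
  finally show ?thesis using fin(2) by simp
qed

text \<open>The common edge is at least as long as the inscribed radius of one cell and at most as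
  long as the diameter of the other.\<close>

lemma edge_adj_diameter:
  assumes "(T, T') \<in> edge_adj z" shows "diameter T \<le> s * diameter T'"
proof -
  obtain w where w: "w \<noteq> z" "w \<in> verts T" "w \<in> verts T'" and T: "T \<in> \<A>" "T' \<in> \<A>" "z \<in> verts T" "z \<in> verts T'"
    using assms by (auto simp: edge_adj_def star_def)
  obtain c r where r: "0 < r" "cball c r \<subseteq> T" "diameter T \<le> s * r" using shape[OF T(1)] by blast
  have "r \<le> norm (w - z)" using full_simplex.verts_far[OF cell[OF T(1)] r(1,2) w(2) T(3) w(1)] .
  also have "norm (w - z) \<le> diameter T'"
    using diameter_bounded_bound[OF compact_imp_bounded[OF full_simplex.compact_T[OF cell[OF T(2)]]], of w z]
      w(3) T(4) full_simplex.verts(6)[OF cell[OF T(2)]] by (auto simp: dist_norm)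
  finally have "s * r \<le> s * diameter T'" using s_ge_1 by (intro mult_left_mono) auto
  then show ?thesis using r(3) by linarith
qed

text \<open>A chain can be shortened to at most as many steps as the finite relation
  \<open>edge_adj z\<close> has pairs.\<close>

lemma near_diameter:
  assumes T: "T \<in> \<A>" "T' \<in> near T" shows "diameter T \<le> cell_ratio DIM('a) s * diameter T'"
proof -
  obtain z where z: "(T, T') \<in> (edge_adj z)\<^sup>*" using T(2) by (auto simp: near_def)
  have fin: "finite (edge_adj z)" using finite_subset[OF edge_adj_subset] finite_star by blast
  then obtain n where n: "n \<le> card (edge_adj z)" "(T, T') \<in> edge_adj z ^^ n"
    using z rtrancl_finite_eq_relpow[OF fin] by auto
  have pow: "diameter T \<le> s ^ n * diameter T'" if "(T, T') \<in> edge_adj z ^^ n" for n T'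
    using that
  proof (induction n arbitrary: T')
    case (Suc n)
    then obtain U where U: "(T, U) \<in> edge_adj z ^^ n" "(U, T') \<in> edge_adj z" by auto
    have "diameter T \<le> s ^ n * diameter U" using Suc U by blast
    also have "\<dots> \<le> s ^ n * (s * diameter T')"
      using edge_adj_diameter[OF U(2)] s_ge_1 by (intro mult_left_mono) auto
    finally show ?case by (simp add: mult_ac)
  qed simp
  have "card (star z) \<le> nat \<lfloor>s ^ DIM('a)\<rfloor>" using card_star_le[of z] by (simp add: le_nat_floor)
  moreover have "card (edge_adj z) \<le> card (star z) * card (star z)"
    using card_mono[OF _ edge_adj_subset] finite_star by (metis card_cartesian_product finite_SigmaI)
  ultimately have "n \<le> nat \<lfloor>s ^ DIM('a)\<rfloor> * nat \<lfloor>s ^ DIM('a)\<rfloor>"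
    using n(1) by (meson le_trans mult_le_mono)
  then have "s ^ n \<le> cell_ratio DIM('a) s" unfolding cell_ratio_def using s_ge_1 by (rule power_increasing)
  moreover have "0 \<le> diameter T'" using diameter_pos T(2) near_subset by (meson less_imp_le subsetD)
  ultimately show ?thesis using pow[OF n(2)] mult_right_mono by (meson order_trans)
qed

text \<open>The cut-off \<open>psi T\<close> equals one on \<open>T\<close> and vanishes off the cells of \<open>near T\<close>.  It is
  single-valued only away from the vertices.\<close>

definition psi_cell :: "'a set \<Rightarrow> 'a set \<Rightarrow> 'a \<Rightarrow> real" where
  "psi_cell T T' x = (\<Sum>z\<in>verts T. if (T, T') \<in> (edge_adj z)\<^sup>* then bary T' z x else 0)"

definition vertices :: "'a set" where "vertices = (\<Union>T\<in>\<A>. verts T)"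

definition psi :: "'a set \<Rightarrow> 'a \<Rightarrow> real" where
  "psi T x = psi_cell T (SOME T'. T' \<in> \<A> \<and> x \<in> T') x"

section \<open>The cut-off: consistency off the vertices and slope along segments\<close>

lemma finite_vertices: "finite vertices"
  unfolding vertices_def using finite_mesh full_simplex.verts(1)[OF cell] by blast

text \<open>If the coordinate of \<open>z\<close> at \<open>x\<close> is nonzero and
  \<open>x\<close> is not a vertex, some other vertex \<open>w\<close> has a nonzero coordinate too.
  Both then are vertices of \<open>T''\<close> as well, so \<open>T'\<close> and \<open>T''\<close>
  share the edge from \<open>z\<close> to \<open>w\<close> and lie in the same chain. If the
  coordinate is zero, both sides vanish.\<close>

lemma psi_term_cong:
  assumes T: "T \<in> \<A>" "z \<in> verts T" and T': "T' \<in> \<A>" "x \<in> T'" and T'': "T'' \<in> \<A>" "x \<in> T''"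
    and x: "x \<notin> vertices" and adj: "(T, T') \<in> (edge_adj z)\<^sup>*"
  shows "bary T' z x = (if (T, T'') \<in> (edge_adj z)\<^sup>* then bary T'' z x else 0)"
proof -
  interpret T': full_simplex T' using cell T' by blast
  have z': "z \<in> verts T'" using rtrancl_edge_adj_star[OF adj] T by (auto simp: star_def)
  have face: "T' \<inter> T'' face_of T'" "T' \<inter> T'' face_of T''" using common_face T'(1) T''(1) by auto
  have b: "bary T' w x = (if w \<in> verts T'' then bary T'' w x else 0)" if "w \<in> verts T'" for w
    using bary_common_face[OF cell cell face T'(2) T''(2) that] T'(1) T''(1) by blast
  show ?thesis
  proof (cases "(T, T'') \<in> (edge_adj z)\<^sup>*")
    case True
    then have "z \<in> verts T''" using rtrancl_edge_adj_star[OF True] T by (auto simp: star_def)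
    then show ?thesis using b[OF z'] True by simp
  next
    case False
    have "bary T' z x = 0"
    proof (rule ccontr)
      assume n0: "bary T' z x \<noteq> 0"
      then have z'': "z \<in> verts T''" using b[OF z'] by (auto split: if_splits)
      have "\<exists>w\<in>verts T'. w \<noteq> z \<and> bary T' w x \<noteq> 0"
      proof (rule ccontr)
        assume "\<not> ?thesis"
        then have zero: "\<forall>w\<in>verts T' - {z}. bary T' w x = 0" by auto
        have "(\<Sum>w\<in>verts T'. bary T' w x) = bary T' z x"
          using zero T'.verts(1) z' by (simp add: sum.remove[of _ z])
        then have "bary T' z x = 1" using T'.bary_repr(1)[of x] by simp
        moreover have "(\<Sum>w\<in>verts T'. bary T' w x *\<^sub>R w) = bary T' z x *\<^sub>R z"
          using zero T'.verts(1) z' by (simp add: sum.remove[of _ z])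
        ultimately have "x = z" using T'.bary_repr(2)[of x] by simp
        then show False using x z' T'(1) by (auto simp: vertices_def)
      qed
      then obtain w where w: "w \<in> verts T'" "w \<noteq> z" "bary T' w x \<noteq> 0" by blast
      then have "w \<in> verts T''" using b by (metis (full_types))
      then have "(T', T'') \<in> edge_adj z"
        using w(1,2) z' z'' T'(1) T''(1) by (auto simp: edge_adj_def star_def)
      then show False using False adj by (meson rtrancl.rtrancl_into_rtrancl)
    qed
    then show ?thesis using False by simp
  qed
qed

lemma psi_cell_cong:
  assumes T: "T \<in> \<A>" and T': "T' \<in> \<A>" "x \<in> T'" and T'': "T'' \<in> \<A>" "x \<in> T''" and x: "x \<notin> vertices"
  shows "psi_cell T T' x = psi_cell T T'' x"
  unfolding psi_cell_def
proof (rule sum.cong[OF refl])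
  fix z assume z: "z \<in> verts T"
  show "(if (T, T') \<in> (edge_adj z)\<^sup>* then bary T' z x else 0) = (if (T, T'') \<in> (edge_adj z)\<^sup>* then bary T'' z x else 0)"
    using psi_term_cong[OF T z T' T'' x] psi_term_cong[OF T z T'' T' x] by auto
qed

lemma psi_eq:
  assumes "T \<in> \<A>" "T' \<in> \<A>" "x \<in> T'" "x \<notin> vertices" shows "psi T x = psi_cell T T' x"
proof -
  have "(SOME T'. T' \<in> \<A> \<and> x \<in> T') \<in> \<A> \<and> x \<in> (SOME T'. T' \<in> \<A> \<and> x \<in> T')"
    by (rule someI[of "\<lambda>T'. T' \<in> \<A> \<and> x \<in> T'" T']) (use assms in auto)
  then show ?thesis unfolding psi_def using psi_cell_cong[OF assms(1) _ _ assms(2,3,4)] by blast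
qed

lemma psi_one: "T \<in> \<A> \<Longrightarrow> x \<in> T \<Longrightarrow> x \<notin> vertices \<Longrightarrow> psi T x = 1"
  using psi_eq[of T T x] full_simplex.bary_repr(1)[OF cell, of T x] by (simp add: psi_cell_def)

lemma psi_nonzero:
  assumes "T \<in> \<A>" "x \<in> \<Union>\<A>" "x \<notin> vertices" "psi T x \<noteq> 0"
  shows "x \<in> \<Union>(near T)"
proof -
  obtain T' where T': "T' \<in> \<A>" "x \<in> T'" using assms(2) by blast
  then have "psi_cell T T' x \<noteq> 0" using psi_eq[OF assms(1) T' assms(3)] assms(4) by simp
  then obtain z where "z \<in> verts T" "(if (T, T') \<in> (edge_adj z)\<^sup>* then bary T' z x else 0) \<noteq> 0"
    unfolding psi_cell_def by (rule sum.not_neutral_contains_not_neutral)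
  then have "z \<in> verts T" "(T, T') \<in> (edge_adj z)\<^sup>*" by (auto split: if_splits)
  then show ?thesis using T' by (auto simp: near_def)
qed

lemma psi_cell_lipschitz:
  assumes T: "T \<in> \<A>" and T': "T' \<in> \<A>"
  shows "\<bar>psi_cell T T' x - psi_cell T T' y\<bar> \<le> walk_ratio DIM('a) s / diameter T * norm (x - y)"
proof (cases "T' \<in> near T")
  case False
  then have "psi_cell T T' x = 0" for x using T' by (auto simp: psi_cell_def near_def intro!: sum.neutral)
  then show ?thesis using walk_ratio_pos[OF s_ge_1, of "DIM('a)"] diameter_pos[OF T] by simp
next
  case True
  interpret T': full_simplex T' using cell T' by blast
  obtain c r where r: "0 < r" "cball c r \<subseteq> T'" "diameter T' \<le> s * r" using shape[OF T'] by blast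
  have fin: "finite (verts T)" "card (verts T) = Suc (DIM('a))" using full_simplex.verts(1,2)[OF cell[OF T]] by auto
  have "diameter T \<le> cell_ratio DIM('a) s * (s * r)"
    using near_diameter[OF T True] r(3) cell_ratio_ge_1[OF s_ge_1, of "DIM('a)"] by (meson mult_left_mono order_trans zero_le_one)
  then have hr: "norm (x - y) / r \<le> s * cell_ratio DIM('a) s / diameter T * norm (x - y)"
  proof -
    assume "diameter T \<le> cell_ratio DIM('a) s * (s * r)"
    then have "1 / r \<le> s * cell_ratio DIM('a) s / diameter T"
      using r(1) diameter_pos[OF T] by (simp add: field_simps)
    from mult_right_mono[OF this norm_ge_zero[of "x - y"]] show ?thesis by simp
  qed
  have "\<bar>psi_cell T T' x - psi_cell T T' y\<bar> =
    \<bar>\<Sum>z\<in>verts T. (if (T, T') \<in> (edge_adj z)\<^sup>* then bary T' z x else 0) - (if (T, T') \<in> (edge_adj z)\<^sup>* then bary T' z y else 0)\<bar>"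
    by (simp add: psi_cell_def sum_subtractf)
  also have "\<dots> \<le> (\<Sum>z\<in>verts T. \<bar>(if (T, T') \<in> (edge_adj z)\<^sup>* then bary T' z x else 0) - (if (T, T') \<in> (edge_adj z)\<^sup>* then bary T' z y else 0)\<bar>)"
    by (rule sum_abs)
  also have "\<dots> \<le> real (card (verts T)) * (norm (x - y) / r)"
  proof (rule sum_bounded_above)
    fix z assume z: "z \<in> verts T"
    have "z \<in> verts T'" if "(T, T') \<in> (edge_adj z)\<^sup>*"
      using rtrancl_edge_adj_star[OF that] T z by (auto simp: star_def)
    then show "\<bar>(if (T, T') \<in> (edge_adj z)\<^sup>* then bary T' z x else 0) - (if (T, T') \<in> (edge_adj z)\<^sup>* then bary T' z y else 0)\<bar> \<le> norm (x - y) / r"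
      using T'.bary_lipschitz[OF r(1,2)] r(1) by auto
  qed
  also have "\<dots> \<le> real (Suc DIM('a)) * (s * cell_ratio DIM('a) s / diameter T * norm (x - y))"
    unfolding fin(2) using hr by (intro mult_left_mono) auto
  finally show ?thesis by (simp add: walk_ratio_def mult_ac)
qed

text \<open>The union of the cells need not be convex, so the bound is obtained along the segment:
  its parameter interval is covered by finitely many closed sets, on each of which the segment stays
  in one cell.\<close>

lemma psi_segment:
  assumes T: "T \<in> \<A>" and seg: "closed_segment a b \<subseteq> \<Union>\<A> - vertices"
  shows "\<bar>psi T a - psi T b\<bar> \<le> walk_ratio DIM('a) s / diameter T * norm (a - b)"
proof -
  let ?\<sigma> = "\<lambda>t::real. a + t *\<^sub>R (b - a)"
  let ?K = "walk_ratio DIM('a) s / diameter T"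
  have K: "0 \<le> ?K" using walk_ratio_pos[OF s_ge_1, of "DIM('a)"] diameter_pos[OF T] by simp
  have \<sigma>: "?\<sigma> t \<in> closed_segment a b" if "t \<in> {0..1}" for t
    unfolding in_segment using that by (intro exI[of _ t]) (auto simp: algebra_simps)
  define U where "U T' = {t\<in>{0..1}. ?\<sigma> t \<in> T'}" for T'
  have "(?K * norm (b - a))-lipschitz_on {0..1} (\<lambda>t. psi T (?\<sigma> t))"
  proof (rule lipschitz_on_closed_Union[of \<A> _ U])
    fix T' assume T': "T' \<in> \<A>"
    show "(?K * norm (b - a))-lipschitz_on (U T') (\<lambda>t. psi T (?\<sigma> t))"
    proof (rule lipschitz_onI)
      fix t u assume t: "t \<in> U T'" and u: "u \<in> U T'"
      have e: "psi T (?\<sigma> t) = psi_cell T T' (?\<sigma> t)" if "t \<in> U T'" for t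
        using psi_eq[OF T T'] that \<sigma> seg by (auto simp: U_def)
      have "\<bar>psi T (?\<sigma> t) - psi T (?\<sigma> u)\<bar> \<le> ?K * norm (?\<sigma> t - ?\<sigma> u)"
        unfolding e[OF t] e[OF u] by (rule psi_cell_lipschitz[OF T T'])
      moreover have "?\<sigma> t - ?\<sigma> u = (t - u) *\<^sub>R (b - a)" by (simp add: algebra_simps)
      ultimately show "dist (psi T (?\<sigma> t)) (psi T (?\<sigma> u)) \<le> ?K * norm (b - a) * dist t u"
        by (simp add: dist_real_def mult_ac)
    qed (rule mult_nonneg_nonneg[OF K norm_ge_zero])
    have "closed T'" using full_simplex.closed_T[OF cell[OF T']] .
    then have "closed ({0..1} \<inter> ?\<sigma> -` T')"
      by (intro continuous_closed_preimage) (auto intro!: continuous_intros)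
    moreover have "U T' = {0..1} \<inter> ?\<sigma> -` T'" by (auto simp: U_def)
    ultimately show "closed (U T')" by simp
  next
    show "{0..1} \<subseteq> (\<Union>T'\<in>\<A>. U T')"
    proof
      fix t :: real assume t: "t \<in> {0..1}"
      then have "?\<sigma> t \<in> \<Union>\<A>" using \<sigma> seg by blast
      then show "t \<in> (\<Union>T'\<in>\<A>. U T')" using t by (auto simp: U_def)
    qed
  qed (use finite_mesh mult_nonneg_nonneg[OF K norm_ge_zero[of "b - a"]] in auto)
  from lipschitz_onD[OF this, of 0 1] show ?thesis by (simp add: dist_real_def norm_minus_commute)
qed

text \<open>Along the two segments the cut-off of \<open>T\<close> loses less than one in total,
  starting from one at \<open>a\<close>. Hence it is nonzero at \<open>b\<close>, which happens only
  in cells near \<open>T\<close>.\<close>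

lemma walk:
  assumes T: "T \<in> \<A>" and a: "a \<in> T" and seg: "closed_segment a w \<subseteq> \<Union>\<A> - vertices" "closed_segment b w \<subseteq> \<Union>\<A> - vertices"
    and short: "walk_ratio DIM('a) s * (dist a w + dist b w) < diameter T"
  shows "b \<in> \<Union>(near T)"
proof (rule psi_nonzero[OF T])
  have "a \<in> closed_segment a w" "b \<in> closed_segment b w" by auto
  then show "b \<in> \<Union>\<A>" "b \<notin> vertices" and "psi T b \<noteq> 0"
  proof -
    assume "a \<in> closed_segment a w" "b \<in> closed_segment b w"
    then have av: "a \<notin> vertices" and "b \<in> \<Union>\<A> - vertices" using seg by blast+
    then show "b \<in> \<Union>\<A>" "b \<notin> vertices" by auto
    have "\<bar>psi T a - psi T w\<bar> + \<bar>psi T b - psi T w\<bar> \<le> walk_ratio DIM('a) s / diameter T * (dist a w + dist b w)"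
      using psi_segment[OF T seg(1)] psi_segment[OF T seg(2)] by (simp add: dist_norm distrib_left)
    also have "\<dots> < 1" using short diameter_pos[OF T] by (simp add: field_simps)
    finally show "psi T b \<noteq> 0" using psi_one[OF T a av] by linarith
  qed
qed

end

section \<open>The trace estimate on one cell\<close>

text \<open>A cell may touch the boundary at points that are not accessible from the part of the
  domain inside the cell. The point where a segment from inside first leaves \<Omega> is accessible,
  and the boundary chart will be centred there.\<close>

lemma (in full_simplex) first_exit:
  assumes "open \<Omega>" "T \<inter> \<Omega> \<noteq> {}" "T \<inter> frontier \<Omega> \<noteq> {}"
  obtains x where "x \<in> T \<inter> frontier \<Omega>" "\<And>\<epsilon>. 0 < \<epsilon> \<Longrightarrow> \<exists>a\<in>interior T \<inter> \<Omega>. dist a x < \<epsilon>"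
proof -
  have "\<Omega> \<inter> interior T \<noteq> {}"
    using open_Int_closure_eq_empty[OF assms(1), of "interior T"] closure_interior assms(2) by auto
  then obtain y where y: "y \<in> interior T" "y \<in> \<Omega>" by blast
  obtain p where p: "p \<in> T" "p \<in> frontier \<Omega>" using assms(3) by blast
  have p\<Omega>: "p \<notin> \<Omega>" using p(2) assms(1) by (auto simp: frontier_def interior_open)
  then have py: "0 < norm (p - y)" using y(2) by auto
  let ?f = "\<lambda>t::real. y + t *\<^sub>R (p - y)"
  define K where "K = {0..1} \<inter> ?f -` (- \<Omega>)"
  have "closed K" unfolding K_def
    using assms(1) by (intro continuous_closed_preimage) (auto intro!: continuous_intros)
  moreover have "K \<subseteq> {0..1}" by (auto simp: K_def)
  ultimately have "compact K" using compact_Int_closed[OF compact_Icc, of K 0 1] by (simp add: Int_absorb1)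
  moreover have "1 \<in> K" using p\<Omega> by (simp add: K_def)
  ultimately obtain t0 where t0: "t0 \<in> K" "\<And>t. t \<in> K \<Longrightarrow> t0 \<le> t"
    using compact_attains_inf[of K] by blast
  have t01: "0 \<le> t0" "t0 \<le> 1" "?f t0 \<notin> \<Omega>" using t0(1) by (auto simp: K_def)
  have "t0 \<noteq> 0" using t01(3) y(2) by auto
  then have t0p: "0 < t0" using t01 by simp
  have inside: "?f t \<in> interior T \<inter> \<Omega>" if "0 \<le> t" "t < t0" for t
  proof -
    have "t \<notin> K" using t0(2) that by fastforce
    then have "?f t \<in> \<Omega>" using that t01 by (auto simp: K_def)
    \<comment> \<open>A segment from an interior point to a point of a convex set stays in the
      interior, except possibly at its end.\<close>
    moreover have "p - (1 - t) *\<^sub>R (p - y) \<in> interior T"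
      by (rule mem_interior_convex_shrink[OF convex_T y(1) p(1)]) (use that t01 in auto)
    moreover have "p - (1 - t) *\<^sub>R (p - y) = ?f t" by (simp add: algebra_simps)
    ultimately show ?thesis by simp
  qed
  have near: "\<exists>a\<in>interior T \<inter> \<Omega>. dist a (?f t0) < \<epsilon>" if \<epsilon>: "0 < \<epsilon>" for \<epsilon>
  proof -
    define \<delta> where "\<delta> = \<epsilon> / (2 * norm (p - y))"
    have \<delta>: "0 < \<delta>" using \<epsilon> py by (simp add: \<delta>_def)
    define t where "t = max 0 (t0 - \<delta>)"
    have t: "0 \<le> t" "t < t0" "\<bar>t - t0\<bar> \<le> \<delta>" using \<delta> t0p by (auto simp: t_def)
    have "?f t - ?f t0 = (t - t0) *\<^sub>R (p - y)" by (simp add: algebra_simps)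
    then have "dist (?f t) (?f t0) = \<bar>t - t0\<bar> * norm (p - y)" by (simp add: dist_norm)
    also have "\<dots> \<le> \<delta> * norm (p - y)" using t(3) by (rule mult_right_mono) simp
    also have "\<dots> < \<epsilon>" using \<epsilon> py by (simp add: \<delta>_def)
    finally show ?thesis using inside[OF t(1,2)] by blast
  qed
  have "?f t0 = (1 - t0) *\<^sub>R y + t0 *\<^sub>R p" by (simp add: algebra_simps)
  then have "?f t0 \<in> T" using convexD_alt[OF convex_T _ p(1)] y(1) interior_subset t01 by auto
  moreover have "?f t0 \<in> closure \<Omega>" unfolding closure_approachable using near by blast
  then have "?f t0 \<in> frontier \<Omega>" using t01(3) assms(1) by (simp add: frontier_def interior_open)
  ultimately show ?thesis using that[of "?f t0"] near by blast
qed

text \<open>The lines through \<open>a\<close> or \<open>b\<close> and a point of \<open>V\<close>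
  are null sets in dimension at least two, and finitely many of them cannot cover the open set
  \<open>W\<close>.\<close>

lemma exists_avoiding:
  fixes a b :: "'a::euclidean_space"
  assumes d: "2 \<le> DIM('a)" and V: "finite V" "a \<notin> V" "b \<notin> V" and W: "open W" "W \<noteq> {}"
  obtains w where "w \<in> W" "closed_segment a w \<inter> V = {}" "closed_segment b w \<inter> V = {}"
proof -
  have line: "negligible (affine hull {c, p})" for c p :: 'a
  proof -
    have "interior (affine hull {c, p}) = {}"
    proof (rule ccontr)
      assume "interior (affine hull {c, p}) \<noteq> {}"
      then have "affine hull (affine hull {c, p}) = UNIV" by (rule affine_hull_nonempty_interior)
      then have "affine hull {c, p} = UNIV" by (simp add: hull_hull)
      then have "aff_dim {c, p} = int DIM('a)" using aff_dim_affine_hull[of "{c, p}"] by simp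
      then show False using d by (simp split: if_splits)
    qed
    then show ?thesis
      using negligible_convex_interior[OF affine_imp_convex[OF affine_affine_hull]] by blast
  qed
  have "negligible (\<Union>p\<in>V. affine hull {a, p} \<union> affine hull {b, p})"
    using V(1) by (intro negligible_Union) (auto intro!: negligible_Un line)
  then have "\<not> W \<subseteq> (\<Union>p\<in>V. affine hull {a, p} \<union> affine hull {b, p})"
    using open_not_negligible[OF W] negligible_subset by blast
  then obtain w where w: "w \<in> W" "\<And>p. p \<in> V \<Longrightarrow> w \<notin> affine hull {a, p}" "\<And>p. p \<in> V \<Longrightarrow> w \<notin> affine hull {b, p}"
    by blast
  have seg: "w \<in> affine hull {c, p}" if p: "p \<in> closed_segment c w" "p \<noteq> c" for c p
  proof -
    obtain t where t: "p = (1 - t) *\<^sub>R c + t *\<^sub>R w" using p(1) unfolding in_segment by blast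
    have "t \<noteq> 0" using t p(2) by auto
    have "t *\<^sub>R w = p - (1 - t) *\<^sub>R c" unfolding t by simp
    then have "(1 / t) *\<^sub>R (t *\<^sub>R w) = (1 / t) *\<^sub>R (p - (1 - t) *\<^sub>R c)" by simp
    then have "w = (1 - 1 / t) *\<^sub>R c + (1 / t) *\<^sub>R p"
      using \<open>t \<noteq> 0\<close> by (simp add: scaleR_diff_right scaleR_diff_left diff_divide_distrib)
    then show ?thesis unfolding affine_hull_2 by force
  qed
  show ?thesis
  proof (rule that[OF w(1)])
    show "closed_segment a w \<inter> V = {}" using seg[of _ a] w(2) V(2) by blast
    show "closed_segment b w \<inter> V = {}" using seg[of _ b] w(3) V(3) by blast
  qed
qed

lemma set_integrable_compact_borel:
  fixes f :: "'a::euclidean_space \<Rightarrow> real"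
  assumes M: "sets M = sets borel" and S: "compact S" "emeasure M S < \<infinity>" and f: "continuous_on UNIV f"
  shows "set_integrable M S f"
proof -
  have "bounded (f ` S)"
    using S(1) f by (intro compact_imp_bounded compact_continuous_image) (auto intro: continuous_on_subset)
  then obtain A where A: "\<forall>y\<in>S. norm (f y) \<le> A" unfolding bounded_iff by blast
  have "f \<in> borel_measurable M"
    using borel_measurable_continuous_onI[OF f] measurable_cong_sets[OF M refl] by blast
  moreover have "S \<in> sets M" using S(1) M by (simp add: compact_imp_closed)
  ultimately show ?thesis unfolding set_integrable_def
    using A S(2) by (intro integrableI_bounded_set_indicator[of _ _ _ A]) auto
qed

context regular_mesh
begin

lemma interior_not_vertex:
  assumes "T \<in> \<A>" "a \<in> interior T" shows "a \<notin> vertices"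
proof
  assume "a \<in> vertices"
  then obtain T' where T': "T' \<in> \<A>" "a \<in> verts T'" by (auto simp: vertices_def)
  show False
  proof (cases "T' = T")
    case True
    then show False using T'(2) assms(2) extreme_point_not_in_interior by blast
  next
    case False
    then show False using interior_disjoint[OF T'(1) assms(1)] full_simplex.verts(6)[OF cell[OF T'(1)]] T'(2) assms(2) by blast
  qed
qed

text \<open>A point \<open>b\<close> of the domain near \<open>x\<close> is joined to a fixed
  interior point \<open>a\<close> of \<open>T\<close> through an apex that sees both, so
  \<open>walk\<close> applies to \<open>b\<close>. Boundary points follow because finitely many near
  cells form a closed set.\<close>

lemma cover_frontier:
  assumes d: "2 \<le> DIM('a)" and T: "T \<in> \<A>" and cov: "\<Omega> \<subseteq> \<Union>\<A>" and chart: "lipschitz_chart \<Omega> R L x e g"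
    and app: "\<And>\<epsilon>. 0 < \<epsilon> \<Longrightarrow> \<exists>a\<in>interior T \<inter> \<Omega>. dist a x < \<epsilon>"
    and r: "0 < r" "(4 + 2 * L) * r < R" "walk_ratio DIM('a) s * (2 * ((4 + 2 * L) * r)) < diameter T"
  shows "frontier \<Omega> \<inter> ball x r \<subseteq> \<Union>(near T)"
proof -
  interpret lipschitz_chart \<Omega> R L x e g by (rule chart)
  obtain a where a: "a \<in> interior T" "a \<in> \<Omega>" "a \<in> ball x r" using app[OF r(1)] by (auto simp: dist_commute)
  have av: "a \<notin> vertices" using interior_not_vertex[OF T a(1)] .
  have inner: "b \<in> \<Union>(near T)" if b: "b \<in> \<Omega>" "b \<in> ball x r" "b \<notin> vertices" for b
  proof -
    obtain w where w: "w \<in> ball (x - ((2 + 2 * L) * r) *\<^sub>R e) r"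
      "closed_segment a w \<inter> vertices = {}" "closed_segment b w \<inter> vertices = {}"
      using exists_avoiding[OF d finite_vertices av b(3) open_ball, of "x - ((2 + 2 * L) * r) *\<^sub>R e" r] r(1) by auto
    note sa = star_shaped[OF r(1,2) a(2,3) w(1)] and sb = star_shaped[OF r(1,2) b(1,2) w(1)]
    show ?thesis
    proof (rule walk[OF T])
      show "a \<in> T" using a(1) interior_subset by blast
      show "closed_segment a w \<subseteq> \<Union>\<A> - vertices" "closed_segment b w \<subseteq> \<Union>\<A> - vertices"
        using sa(1) sb(1) w(2,3) cov by blast+
      have "walk_ratio DIM('a) s * (dist a w + dist b w) \<le> walk_ratio DIM('a) s * (2 * ((4 + 2 * L) * r))"
        using sa(2) sb(2) walk_ratio_pos[OF s_ge_1, of "DIM('a)"] by (intro mult_left_mono) auto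
      then show "walk_ratio DIM('a) s * (dist a w + dist b w) < diameter T" using r(3) by linarith
    qed
  qed
  show ?thesis
  proof
    fix p assume p: "p \<in> frontier \<Omega> \<inter> ball x r"
    show "p \<in> \<Union>(near T)"
    proof (rule ccontr)
      assume n: "p \<notin> \<Union>(near T)"
      \<comment> \<open>Were \<open>p\<close> outside this closed set, a nonempty open piece of
        \<Omega> near \<open>p\<close> would consist of mesh vertices only.\<close>
      have "closed (\<Union>(near T))"
        using finite_near near_subset full_simplex.closed_T[OF cell] by (intro closed_Union) auto
      then have o: "open (ball x r \<inter> - \<Union>(near T))" by (intro open_Int open_ball) auto
      have "p \<in> closure \<Omega>" using p by (simp add: frontier_def)
      moreover have "p \<in> ball x r \<inter> - \<Union>(near T)" using p n by blast
      ultimately have "\<Omega> \<inter> (ball x r \<inter> - \<Union>(near T)) \<noteq> {}"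
        using o by (meson closure_iff_nhds_not_empty order_refl)
      moreover have "open (\<Omega> \<inter> (ball x r \<inter> - \<Union>(near T)))" by (rule open_Int[OF open_\<Omega> o])
      ultimately have "\<not> negligible (\<Omega> \<inter> (ball x r \<inter> - \<Union>(near T)))" using open_not_negligible by blast
      moreover have "\<Omega> \<inter> (ball x r \<inter> - \<Union>(near T)) \<subseteq> vertices" using inner by blast
      ultimately show False using negligible_subset[OF negligible_finite[OF finite_vertices]] by blast
    qed
  qed
qed

text \<open>The factor h^(2-d) appears as \<open>diameter T / diameter T ^ (DIM('a) - 1)\<close>,
  which keeps all exponents natural.\<close>

lemma osc_cell:
  assumes k: "1 \<le> k" and T: "T \<in> \<A>" and p: "p \<in> polys k" "\<And>x. x \<in> T \<Longrightarrow> u x = p x" and xy: "x \<in> T" "y \<in> T"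
  shows "(u x - u y)\<^sup>2 \<le> inverse_const k DIM('a) s * s ^ DIM('a) * grad_prod T u u * diameter T / diameter T ^ (DIM('a) - 1)"
proof -
  interpret full_simplex T using cell[OF T] .
  obtain c r where r: "0 < r" "cball c r \<subseteq> T" "diameter T \<le> s * r" using shape[OF T] by blast
  let ?h = "diameter T" and ?C = "inverse_const k DIM('a) s" and ?E = "grad_prod T u u"
  have h: "0 < ?h" using diameter_pos[OF T] .
  have "?h ^ DIM('a) * (u x - u y)\<^sup>2 \<le> (s * r) ^ DIM('a) * (u x - u y)\<^sup>2"
    using r(3) h by (intro mult_right_mono power_mono) auto
  also have "\<dots> = s ^ DIM('a) * (r ^ DIM('a) * (u x - u y)\<^sup>2)" by (simp add: power_mult_distrib)
  also have "\<dots> \<le> s ^ DIM('a) * (?C * ?h\<^sup>2 * ?E)"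
    using energy_osc[OF k p r(1,2) s_ge_1 r(3) xy] s_ge_1 by (intro mult_left_mono) auto
  finally have *: "?h ^ DIM('a) * (u x - u y)\<^sup>2 \<le> s ^ DIM('a) * (?C * ?h\<^sup>2 * ?E)" .
  obtain n where n: "DIM('a) = Suc n" by (cases "DIM('a)") auto
  have "?h * (?h ^ n * (u x - u y)\<^sup>2) \<le> ?h * (?C * s ^ DIM('a) * ?E * ?h)"
    using * by (simp add: n power2_eq_square mult_ac)
  then have "?h ^ n * (u x - u y)\<^sup>2 \<le> ?C * s ^ DIM('a) * ?E * ?h" using h by simp
  then show ?thesis using h by (simp add: n pos_le_divide_eq mult.commute)
qed

text \<open>The value at \<open>x\<close> is compared with the values on \<open>B\<close> through a vertex that \<open>T\<close> shares with
  each of its near cells.\<close>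

lemma trace_cell:
  fixes u :: "'a \<Rightarrow> real" and M :: "'a measure" and k :: nat
  defines "n \<equiv> DIM('a) - 1" and "\<kappa> \<equiv> inverse_const k DIM('a) s * s ^ DIM('a)"
    and "N \<equiv> real (Suc DIM('a)) * s ^ DIM('a)" and "q \<equiv> cell_ratio DIM('a) s"
  assumes k: "1 \<le> k" and M: "sets M = sets borel"
    and poly: "\<And>T. T \<in> \<A> \<Longrightarrow> \<exists>p\<in>polys k. \<forall>x\<in>T. u x = p x"
    and T: "T \<in> \<A>" "x \<in> T" and \<Gamma>: "closed \<Gamma>" and B: "B \<in> sets borel" "B \<subseteq> \<Union>(near T) \<inter> \<Gamma>"
    and C: "0 \<le> C" "\<And>T. T \<in> \<A> \<Longrightarrow> emeasure M (T \<inter> \<Gamma>) \<le> ennreal (C * diameter T ^ n)"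
    and c: "0 < c" "ennreal (c * diameter T ^ n) \<le> emeasure M B"
  shows "c * diameter T ^ n * (u x)\<^sup>2 \<le> (3 + 3 * \<kappa> * C * (q ^ n * N + 1)) *
     (\<Sum>T'\<in>near T. (LINT y:T' \<inter> \<Gamma>|M. u y * u y) + diameter T' * grad_prod T' u u)"
proof -
  let ?h = "diameter" and ?E = "\<lambda>T. grad_prod T u u" and ?I = "\<lambda>T. LINT y:T \<inter> \<Gamma>|M. u y * u y"
  have \<kappa>: "0 < \<kappa>" unfolding \<kappa>_def using inverse_const_pos[OF k s_ge_1, of "DIM('a)"] s_ge_1 by (intro mult_pos_pos) auto
  have q: "1 \<le> q" unfolding q_def using cell_ratio_ge_1[OF s_ge_1] .
  have hpos: "0 < ?h T'" if "T' \<in> \<A>" for T' using diameter_pos[OF that] .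
  have E0: "0 \<le> ?E T'" for T' by (rule grad_prod_nonneg)
  \<comment> \<open>\<open>b T'\<close> collects the squared oscillations over \<open>T\<close> and
    over \<open>T'\<close>; the 3 comes from squaring a sum of three terms.\<close>
  define b where "b T' = 3 * \<kappa> * (?E T * ?h T / ?h T ^ n + ?E T' * ?h T' / ?h T' ^ n)" for T'
  have b0: "0 \<le> b T'" if "T' \<in> \<A>" for T'
    unfolding b_def using \<kappa> E0 hpos[OF that] hpos[OF T(1)] by (intro mult_nonneg_nonneg add_nonneg_nonneg divide_nonneg_nonneg) auto
  have meas: "T' \<inter> \<Gamma> \<in> sets M" if "T' \<in> \<A>" for T'
    using full_simplex.closed_T[OF cell[OF that]] \<Gamma> by (simp add: M closed_Int)
  have fin: "emeasure M (T' \<inter> \<Gamma>) < \<infinity>" if "T' \<in> \<A>" for T'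
    using C(2)[OF that] by (simp add: le_less_trans ennreal_less_top)
  have m_le: "measure M (T' \<inter> \<Gamma>) \<le> C * ?h T' ^ n" if "T' \<in> \<A>" for T'
    using C(2)[OF that] C(1) hpos[OF that] unfolding measure_def by (intro enn2real_leI) auto
  have int: "integrable M (\<lambda>y. indicat_real (T' \<inter> \<Gamma>) y *\<^sub>R (u y * u y))" if T': "T' \<in> \<A>" for T'
  proof -
    obtain p where p: "p \<in> polys k" "\<forall>x\<in>T'. u x = p x" using poly[OF T'] by blast
    have "compact (T' \<inter> \<Gamma>)" using full_simplex.compact_T[OF cell[OF T']] \<Gamma> by (rule compact_Int_closed)
    from set_integrable_compact_borel[OF M this fin[OF T'], of "\<lambda>y. p y * p y"]
    have "integrable M (\<lambda>y. indicat_real (T' \<inter> \<Gamma>) y *\<^sub>R (p y * p y))"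
      unfolding set_integrable_def using polys_continuous[OF p(1)] by (simp add: continuous_on_mult)
    moreover have "(\<lambda>y. indicat_real (T' \<inter> \<Gamma>) y *\<^sub>R (p y * p y)) = (\<lambda>y. indicat_real (T' \<inter> \<Gamma>) y *\<^sub>R (u y * u y))"
      using p(2) by (auto simp: fun_eq_iff indicator_def)
    ultimately show ?thesis by simp
  qed
  have pt: "(u x)\<^sup>2 \<le> 3 * (u y * u y) + b T'" if T': "T' \<in> near T" "y \<in> T'" for T' y
  proof -
    have T'A: "T' \<in> \<A>" using T'(1) near_subset by blast
    obtain z where z: "z \<in> verts T" "(T, T') \<in> (edge_adj z)\<^sup>*" using T'(1) by (auto simp: near_def)
    have "z \<in> verts T'" using rtrancl_edge_adj_star[OF z(2)] T(1) z(1) by (auto simp: star_def)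
    then have zz: "z \<in> T" "z \<in> T'" using z(1) full_simplex.verts(6)[OF cell[OF T(1)]] full_simplex.verts(6)[OF cell[OF T'A]] by auto
    obtain p where p: "p \<in> polys k" "\<And>x. x \<in> T \<Longrightarrow> u x = p x" using poly[OF T(1)] by blast
    obtain p' where p': "p' \<in> polys k" "\<And>x. x \<in> T' \<Longrightarrow> u x = p' x" using poly[OF T'A] by blast
    have 1: "(u x - u z)\<^sup>2 \<le> \<kappa> * (?E T * ?h T / ?h T ^ n)"
      using osc_cell[OF k T(1) p T(2) zz(1)] by (simp add: \<kappa>_def n_def mult_ac)
    have 2: "(u z - u y)\<^sup>2 \<le> \<kappa> * (?E T' * ?h T' / ?h T' ^ n)"
      using osc_cell[OF k T'A p' zz(2) T'(2)] by (simp add: \<kappa>_def n_def mult_ac)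
    have "(a + b + c)\<^sup>2 \<le> 3 * a\<^sup>2 + 3 * b\<^sup>2 + 3 * c\<^sup>2" for a b c :: real
    proof -
      have "0 \<le> (a - b)\<^sup>2 + (b - c)\<^sup>2 + (a - c)\<^sup>2" by simp
      then show ?thesis by (simp add: power2_eq_square algebra_simps)
    qed
    from this[of "u y" "u x - u z" "u z - u y"]
    have "(u x)\<^sup>2 \<le> 3 * (u y)\<^sup>2 + 3 * (u x - u z)\<^sup>2 + 3 * (u z - u y)\<^sup>2" by simp
    then show ?thesis using 1 2 unfolding b_def by (simp add: power2_eq_square distrib_left)
  qed
  have B_meas: "B \<in> sets M" using B(1) M by simp
  have nearA: "T' \<in> \<A>" if "T' \<in> near T" for T' using that near_subset by blast
  have "emeasure M B \<le> emeasure M (\<Union>T'\<in>near T. T' \<inter> \<Gamma>)"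
    using B(2) finite_near meas nearA by (intro emeasure_mono sets.finite_UN) auto
  also have "\<dots> \<le> (\<Sum>T'\<in>near T. emeasure M (T' \<inter> \<Gamma>))"
    using finite_near meas nearA by (intro emeasure_subadditive_finite) auto
  also have "\<dots> < \<infinity>" using fin nearA finite_near by (simp add: ennreal_sum_less_top)
  finally have B_fin: "emeasure M B < \<infinity>" .
  then have c_le: "c * ?h T ^ n \<le> measure M B"
    using c(2) c(1) hpos[OF T(1)] by (simp add: emeasure_eq_ennreal_measure less_top ennreal_le_iff)
  \<comment> \<open>A majorant of the constant \<open>(u x)\<^sup>2\<close> on \<open>B\<close>:
    each point of \<open>B\<close> lies in some near cell, and the terms of all other cells are
    nonnegative.\<close>
  let ?F = "\<lambda>y. \<Sum>T'\<in>near T. 3 * (indicat_real (T' \<inter> \<Gamma>) y *\<^sub>R (u y * u y)) + b T' * indicat_real (T' \<inter> \<Gamma>) y"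
  have term_int: "integrable M (\<lambda>y. 3 * (indicat_real (T' \<inter> \<Gamma>) y *\<^sub>R (u y * u y)) + b T' * indicat_real (T' \<inter> \<Gamma>) y)"
    if "T' \<in> near T" for T'
    using int[OF nearA[OF that]] meas[OF nearA[OF that]] fin[OF nearA[OF that]]
    by (intro Bochner_Integration.integrable_add integrable_mult_right integrable_real_indicator) auto
  have "(LINT y|M. (u x)\<^sup>2 * indicat_real B y) \<le> (LINT y|M. ?F y)"
  proof (rule integral_mono)
    show "integrable M (\<lambda>y. (u x)\<^sup>2 * indicat_real B y)"
      using B_meas B_fin by (intro integrable_mult_right integrable_real_indicator) auto
    show "integrable M ?F" using term_int by (rule Bochner_Integration.integrable_sum)
    fix y assume "y \<in> space M"
    have nn: "0 \<le> 3 * (indicat_real (T' \<inter> \<Gamma>) y *\<^sub>R (u y * u y)) + b T' * indicat_real (T' \<inter> \<Gamma>) y" if "T' \<in> near T" for T'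
      using b0[OF nearA[OF that]] by (simp add: indicator_def)
    show "(u x)\<^sup>2 * indicat_real B y \<le> ?F y"
    proof (cases "y \<in> B")
      case True
      then obtain T' where T': "T' \<in> near T" "y \<in> T'" "y \<in> \<Gamma>" using B(2) by blast
      have "(u x)\<^sup>2 * indicat_real B y \<le> 3 * (indicat_real (T' \<inter> \<Gamma>) y *\<^sub>R (u y * u y)) + b T' * indicat_real (T' \<inter> \<Gamma>) y"
        using pt[OF T'(1,2)] True T' by simp
      also have "\<dots> \<le> ?F y" by (rule member_le_sum[OF T'(1) nn finite_near]) auto
      finally show ?thesis .
    next
      case False
      then show ?thesis using nn by (simp add: sum_nonneg)
    qed
  qed
  also have "(LINT y|M. ?F y) = (\<Sum>T'\<in>near T. 3 * ?I T' + b T' * measure M (T' \<inter> \<Gamma>))"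
  proof (subst Bochner_Integration.integral_sum[OF term_int], assumption, rule sum.cong[OF refl])
    fix T' assume T': "T' \<in> near T"
    show "(LINT y|M. 3 * (indicat_real (T' \<inter> \<Gamma>) y *\<^sub>R (u y * u y)) + b T' * indicat_real (T' \<inter> \<Gamma>) y) = 3 * ?I T' + b T' * measure M (T' \<inter> \<Gamma>)"
      using int[OF nearA[OF T']] meas[OF nearA[OF T']] fin[OF nearA[OF T']]
      by (subst Bochner_Integration.integral_add) (auto simp: set_lebesgue_integral_def intro!: integrable_mult_right integrable_real_indicator)
  qed
  also have "(LINT y|M. (u x)\<^sup>2 * indicat_real B y) = (u x)\<^sup>2 * measure M B"
    using B_meas B_fin by simp
  finally have main: "(u x)\<^sup>2 * measure M B \<le> (\<Sum>T'\<in>near T. 3 * ?I T' + b T' * measure M (T' \<inter> \<Gamma>))" .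
  have I0: "0 \<le> ?I T'" for T' unfolding set_lebesgue_integral_def by (rule Bochner_Integration.integral_nonneg) simp
  \<comment> \<open>The energy of \<open>T\<close> is divided by a power of its own diameter but
    multiplied by the measure of a slice of \<open>T'\<close>; comparability of the two diameters
    removes the quotient.\<close>
  have bm: "b T' * measure M (T' \<inter> \<Gamma>) \<le> 3 * \<kappa> * C * (q ^ n * (?h T * ?E T) + ?h T' * ?E T')" if T': "T' \<in> near T" for T'
  proof -
    have h': "0 < ?h T'" "0 < ?h T" using hpos nearA[OF T'] T(1) by auto
    have "?h T' \<le> q * ?h T" unfolding q_def using near_diameter[OF nearA[OF T'] near_sym[OF T(1) T']] .
    then have "?h T' ^ n \<le> (q * ?h T) ^ n" using h' by (intro power_mono) auto
    then have ratio: "?h T' ^ n / ?h T ^ n \<le> q ^ n" using h' by (simp add: pos_divide_le_eq power_mult_distrib)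
    have "b T' * measure M (T' \<inter> \<Gamma>) \<le> b T' * (C * ?h T' ^ n)"
      using m_le[OF nearA[OF T']] b0[OF nearA[OF T']] by (rule mult_left_mono)
    also have "\<dots> = 3 * \<kappa> * C * ((?h T' ^ n / ?h T ^ n) * (?h T * ?E T) + ?h T' * ?E T')"
      unfolding b_def using h' by (simp add: field_simps)
    also have "\<dots> \<le> 3 * \<kappa> * C * (q ^ n * (?h T * ?E T) + ?h T' * ?E T')"
      using \<kappa> C(1) h' E0 ratio by (intro mult_left_mono add_mono mult_right_mono) auto
    finally show ?thesis .
  qed
  \<comment> \<open>\<open>T\<close> is near itself, so its own energy is among the
    summands.\<close>
  have TT: "T \<in> near T"
  proof -
    obtain z where "z \<in> verts T" using full_simplex.verts(2)[OF cell[OF T(1)]] by (metis card.empty ex_in_conv Suc_neq_Zero)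
    then show ?thesis using T(1) by (auto simp: near_def)
  qed
  let ?S = "\<Sum>T'\<in>near T. ?h T' * ?E T'"
  have hE0: "0 \<le> ?h T' * ?E T'" if "T' \<in> near T" for T'
    using hpos[OF nearA[OF that]] E0[of T'] by simp
  have hE: "?h T * ?E T \<le> ?S"
    using member_le_sum[of T "near T" "\<lambda>T'. ?h T' * ?E T'"] TT finite_near hE0 by blast
  have S0: "0 \<le> ?S" by (rule sum_nonneg) (rule hE0)
  have "(\<Sum>T'\<in>near T. b T' * measure M (T' \<inter> \<Gamma>)) \<le> (\<Sum>T'\<in>near T. 3 * \<kappa> * C * (q ^ n * (?h T * ?E T) + ?h T' * ?E T'))"
    by (rule sum_mono) (rule bm)
  also have "\<dots> = 3 * \<kappa> * C * (q ^ n * (real (card (near T)) * (?h T * ?E T)) + ?S)"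
    unfolding sum_distrib_left[symmetric] sum.distrib sum_constant
    by (simp only: mult_ac)
  also have "\<dots> \<le> 3 * \<kappa> * C * (q ^ n * (N * ?S) + ?S)"
  proof -
    have "real (card (near T)) * (?h T * ?E T) \<le> N * ?S"
      using card_near_le[OF T(1)] hE S0 hpos[OF T(1)] E0[of T] unfolding N_def
      by (intro mult_mono) auto
    then show ?thesis using \<kappa> C(1) q by (intro mult_left_mono add_mono) auto
  qed
  also have "\<dots> = 3 * \<kappa> * C * (q ^ n * N + 1) * ?S" by (simp add: algebra_simps)
  finally have sb: "(\<Sum>T'\<in>near T. b T' * measure M (T' \<inter> \<Gamma>)) \<le> 3 * \<kappa> * C * (q ^ n * N + 1) * ?S" .
  let ?K = "3 * \<kappa> * C * (q ^ n * N + 1)"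
  have K0: "0 \<le> ?K" using \<kappa> C(1) q s_ge_1 by (auto simp: N_def intro!: mult_nonneg_nonneg add_nonneg_nonneg)
  have SI0: "0 \<le> (\<Sum>T'\<in>near T. ?I T')" using I0 by (rule sum_nonneg)
  have "c * ?h T ^ n * (u x)\<^sup>2 \<le> measure M B * (u x)\<^sup>2" using c_le by (rule mult_right_mono) simp
  also have "\<dots> \<le> 3 * (\<Sum>T'\<in>near T. ?I T') + ?K * ?S"
    using main sb by (simp add: sum.distrib sum_distrib_left mult.commute)
  also have "\<dots> \<le> (3 + ?K) * ((\<Sum>T'\<in>near T. ?I T') + ?S)"
  proof -
    have "3 * a + K * b \<le> (3 + K) * (a + b)" if "0 \<le> K * a" "0 \<le> b" for a b K :: real
      using that by (simp add: algebra_simps)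
    then show ?thesis using mult_nonneg_nonneg[OF K0 SI0] S0 by blast
  qed
  finally show ?thesis by (simp add: sum.distrib)
qed

end

section \<open>Lagrange elements\<close>

locale lagrange_mesh = simplicial_mesh \<A> for \<A> :: "'a::euclidean_space set set" +
  fixes k :: nat
  assumes k: "1 \<le> k"
begin

text \<open>This and \<open>nodes\<close> restate \<open>fe_space\<close> and
  \<open>fe_nodes\<close> for an arbitrary mesh, detached from \<Omega>.\<close>

definition fe :: "('a \<Rightarrow> real) set" where
  "fe = {v. (\<forall>x. x \<notin> \<Union>\<A> \<longrightarrow> v x = 0) \<and> continuous_on (\<Union>\<A>) v \<and>
     (\<forall>T\<in>\<A>. \<exists>p\<in>polys k. \<forall>x\<in>T. v x = p x)}"

definition nodes :: "'a set" where "nodes = (\<Union>T\<in>\<A>. lagrange_nodes k T)"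

definition cell_shape :: "'a \<Rightarrow> 'a set \<Rightarrow> 'a \<Rightarrow> real" where
  "cell_shape \<xi> T x = (if \<xi> \<in> T then lagrange_poly k T \<xi> x else 0)"

definition shape_fun :: "'a \<Rightarrow> 'a \<Rightarrow> real" where
  "shape_fun \<xi> x = (if x \<in> \<Union>\<A> then cell_shape \<xi> (SOME T. T \<in> \<A> \<and> x \<in> T) x else 0)"

lemma finite_nodes: "finite nodes"
  unfolding nodes_def using finite_mesh full_simplex.lagrange_nodes_finite(1)[OF cell k] by blast

lemma bary_meet:
  assumes "T \<in> \<A>" "T' \<in> \<A>" "x \<in> T" "x \<in> T'" "z \<in> verts T"
  shows "bary T z x = (if z \<in> verts T' then bary T' z x else 0)"
  using bary_common_face[OF cell cell _ _ assms(3,4,5)] common_face assms by blast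

text \<open>At a common point the coordinates of shared vertices agree in both cells and the
  remaining ones vanish, so they are multiples of \<open>1 / k\<close> in either cell.\<close>

lemma node_in_cell:
  assumes "T \<in> \<A>" "\<xi> \<in> nodes" "\<xi> \<in> T" shows "\<xi> \<in> lagrange_nodes k T"
proof -
  obtain T' where T': "T' \<in> \<A>" "\<xi> \<in> lagrange_nodes k T'" using assms(2) by (auto simp: nodes_def)
  then have \<xi>: "\<xi> \<in> T'" "\<forall>z\<in>verts T'. real k * bary T' z \<xi> \<in> \<nat>"
    using full_simplex.lagrange_nodes_iff[OF cell k] by blast+
  have "real k * bary T z \<xi> \<in> \<nat>" if z: "z \<in> verts T" for z
    using bary_meet[OF assms(1) T'(1) assms(3) \<xi>(1) z] \<xi>(2) by (cases "z \<in> verts T'") auto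
  then show ?thesis using full_simplex.lagrange_nodes_iff[OF cell[OF assms(1)] k] assms(3) by blast
qed

text \<open>Vertices that are not shared have index zero at \<xi> and contribute the factor one; at
  shared vertices the coordinates agree.\<close>

lemma lagrange_poly_cong:
  assumes T: "T \<in> \<A>" "T' \<in> \<A>" and \<xi>: "\<xi> \<in> T" "\<xi> \<in> T'" and x: "x \<in> T" "x \<in> T'"
  shows "lagrange_poly k T \<xi> x = lagrange_poly k T' \<xi> x"
proof -
  have half: "lagrange_poly k T \<xi> x = (\<Prod>z\<in>verts T \<inter> verts T'. (real k * bary T z x) gchoose (lattice_index k T \<xi> z))"
    if T: "T \<in> \<A>" "T' \<in> \<A>" and \<xi>: "\<xi> \<in> T" "\<xi> \<in> T'" and x: "x \<in> T" "x \<in> T'" for T T'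
    unfolding lagrange_poly_def newton_poly_def
  proof (rule prod.mono_neutral_right)
    show "finite (verts T)" using full_simplex.verts(1)[OF cell[OF T(1)]] .
    show "\<forall>z\<in>verts T - verts T \<inter> verts T'. (real k * bary T z x) gchoose (lattice_index k T \<xi> z) = 1"
      using bary_meet[OF T \<xi>] by (auto simp: lattice_index_def)
  qed auto
  have "(\<Prod>z\<in>verts T \<inter> verts T'. (real k * bary T z x) gchoose (lattice_index k T \<xi> z)) =
     (\<Prod>z\<in>verts T' \<inter> verts T. (real k * bary T' z x) gchoose (lattice_index k T' \<xi> z))"
    using bary_meet[OF T \<xi>] bary_meet[OF T x] by (intro prod.cong) (auto simp: lattice_index_def)
  then show ?thesis using half[OF T \<xi> x] half[OF T(2,1) \<xi>(2,1) x(2,1)] by simp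
qed

text \<open>Some vertex of \<open>T\<close> that is not one of \<open>T'\<close> has a nonzero
  coordinate at \<xi>, for otherwise \<xi> would be a convex combination of vertices of
  \<open>T'\<close>. Its coordinate vanishes at \<open>x\<close>, and zero choose a positive index
  is zero.\<close>

lemma lagrange_poly_vanishes:
  assumes T: "T \<in> \<A>" "T' \<in> \<A>" and \<xi>: "\<xi> \<in> nodes" "\<xi> \<in> T" "\<xi> \<notin> T'" and x: "x \<in> T" "x \<in> T'"
  shows "lagrange_poly k T \<xi> x = 0"
proof -
  interpret full_simplex T using cell[OF T(1)] .
  interpret T': full_simplex T' using cell[OF T(2)] .
  have node: "\<xi> \<in> lagrange_nodes k T" using node_in_cell[OF T(1) \<xi>(1,2)] .
  have "\<exists>z\<in>verts T. z \<notin> verts T' \<and> bary T z \<xi> \<noteq> 0"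
  proof (rule ccontr)
    assume "\<not> ?thesis"
    then have zero: "\<forall>z\<in>verts T - verts T \<inter> verts T'. bary T z \<xi> = 0" by auto
    have "(\<Sum>z\<in>verts T. bary T z \<xi>) = (\<Sum>z\<in>verts T \<inter> verts T'. bary T z \<xi>)"
      by (rule sum.mono_neutral_right) (use zero verts(1) in auto)
    then have 1: "(\<Sum>z\<in>verts T \<inter> verts T'. bary T z \<xi>) = 1" using bary_repr(1) by simp
    have "(\<Sum>z\<in>verts T. bary T z \<xi> *\<^sub>R z) = (\<Sum>z\<in>verts T \<inter> verts T'. bary T z \<xi> *\<^sub>R z)"
      by (rule sum.mono_neutral_right) (use zero verts(1) in auto)
    then have 2: "(\<Sum>z\<in>verts T \<inter> verts T'. bary T z \<xi> *\<^sub>R z) = \<xi>" using bary_repr(2)[of \<xi>] by metis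
    have "(\<Sum>z\<in>verts T \<inter> verts T'. bary T z \<xi> *\<^sub>R z) \<in> T'"
      by (rule convex_sum[OF _ T'.convex_T 1]) (use verts(1) bary_nonneg[OF \<xi>(2)] T'.verts(6) in auto)
    then show False using 2 \<xi>(3) by simp
  qed
  then obtain z where z: "z \<in> verts T" "z \<notin> verts T'" "bary T z \<xi> \<noteq> 0" by blast
  have "real (lattice_index k T \<xi> z) \<noteq> 0" using lattice_index(1)[OF k node z(1)] z(3) k by simp
  then obtain m where m: "lattice_index k T \<xi> z = Suc m" using not0_implies_Suc by auto
  have "bary T z x = 0" using bary_meet[OF T x z(1)] z(2) by simp
  then have "(real k * bary T z x) gchoose (lattice_index k T \<xi> z) = 0" by (simp add: m)
  then show ?thesis unfolding lagrange_poly_def newton_poly_def using verts(1) z(1) by (intro prod_zero) auto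
qed

lemma shape_fun_eq:
  assumes \<xi>: "\<xi> \<in> nodes" and T: "T \<in> \<A>" "x \<in> T"
  shows "shape_fun \<xi> x = cell_shape \<xi> T x"
proof -
  define T' where "T' = (SOME T. T \<in> \<A> \<and> x \<in> T)"
  have T': "T' \<in> \<A>" "x \<in> T'" using someI[of "\<lambda>T. T \<in> \<A> \<and> x \<in> T" T] T by (auto simp: T'_def)
  have "cell_shape \<xi> T' x = cell_shape \<xi> T x"
    unfolding cell_shape_def
    using lagrange_poly_cong[OF T'(1) T(1) _ _ T'(2) T(2), of \<xi>]
      lagrange_poly_vanishes[OF T'(1) T(1) \<xi> _ _ T'(2) T(2)]
      lagrange_poly_vanishes[OF T(1) T'(1) \<xi> _ _ T(2) T'(2)] by auto
  then show ?thesis using T by (auto simp: shape_fun_def T'_def)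
qed

lemma cell_shape_polys:
  assumes "\<xi> \<in> nodes" "T \<in> \<A>" shows "cell_shape \<xi> T \<in> polys k"
proof (cases "\<xi> \<in> T")
  case True
  then have "cell_shape \<xi> T = lagrange_poly k T \<xi>" by (simp add: cell_shape_def fun_eq_iff)
  then show ?thesis
    using full_simplex.lagrange_poly_in_polys[OF cell[OF assms(2)] k node_in_cell[OF assms(2,1) True]] by simp
next
  case False
  then have "cell_shape \<xi> T = (\<lambda>x. 0)" by (simp add: cell_shape_def fun_eq_iff)
  then show ?thesis by (simp add: polys_zero)
qed

section \<open>The finite element space and its nodal basis\<close>

lemma fe_poly: "v \<in> fe \<Longrightarrow> T \<in> \<A> \<Longrightarrow> \<exists>p\<in>polys k. \<forall>x\<in>T. v x = p x"
  unfolding fe_def by blast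

lemma fe_zero: "(\<lambda>x. 0) \<in> fe"
  unfolding fe_def using polys_zero by (auto intro!: bexI[of _ "\<lambda>x. 0"])

lemma fe_add:
  assumes "v \<in> fe" "w \<in> fe" shows "(\<lambda>x. v x + w x) \<in> fe"
proof -
  have "\<exists>p\<in>polys k. \<forall>x\<in>T. v x + w x = p x" if T: "T \<in> \<A>" for T
  proof -
    obtain p q where "p \<in> polys k" "q \<in> polys k" "\<forall>x\<in>T. v x = p x" "\<forall>x\<in>T. w x = q x"
      using fe_poly[OF assms(1) T] fe_poly[OF assms(2) T] by blast
    then show ?thesis by (intro bexI[of _ "\<lambda>x. p x + q x"]) (auto intro: polys_add)
  qed
  then show ?thesis using assms unfolding fe_def by (auto intro: continuous_on_add)
qed

lemma fe_cmult:
  assumes "v \<in> fe" shows "(\<lambda>x. a * v x) \<in> fe"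
proof -
  have "\<exists>p\<in>polys k. \<forall>x\<in>T. a * v x = p x" if T: "T \<in> \<A>" for T
  proof -
    obtain p where "p \<in> polys k" "\<forall>x\<in>T. v x = p x" using fe_poly[OF assms T] by blast
    then show ?thesis by (intro bexI[of _ "\<lambda>x. a * p x"]) (auto intro: polys_cmult)
  qed
  then show ?thesis using assms unfolding fe_def by (auto intro: continuous_on_mult_left)
qed

lemma fe_sum: "(\<And>i. i \<in> I \<Longrightarrow> v i \<in> fe) \<Longrightarrow> (\<lambda>x. \<Sum>i\<in>I. c i * v i x) \<in> fe"
proof (induction I rule: infinite_finite_induct)
  case (insert i I)
  have "(\<lambda>x. c i * v i x + (\<Sum>i\<in>I. c i * v i x)) \<in> fe"
    by (rule fe_add[OF fe_cmult]) (use insert in auto)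
  then show ?case using insert by simp
qed (simp_all add: fe_zero)

lemma shape_fun_fe:
  assumes \<xi>: "\<xi> \<in> nodes" shows "shape_fun \<xi> \<in> fe"
proof -
  have eq: "shape_fun \<xi> x = cell_shape \<xi> T x" if "T \<in> \<A>" "x \<in> T" for T x
    using shape_fun_eq[OF \<xi> that] .
  have "continuous_on (\<Union>T\<in>\<A>. T) (shape_fun \<xi>)"
  proof (rule continuous_on_closed_Union[OF finite_mesh])
    show "closed T" if "T \<in> \<A>" for T using full_simplex.closed_T[OF cell[OF that]] .
    show "continuous_on T (shape_fun \<xi>)" if T: "T \<in> \<A>" for T
      by (rule continuous_on_eq[OF polys_continuous[OF cell_shape_polys[OF \<xi> T]]]) (simp add: eq[OF T])
  qed
  moreover have "\<exists>p\<in>polys k. \<forall>x\<in>T. shape_fun \<xi> x = p x" if "T \<in> \<A>" for T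
    using cell_shape_polys[OF \<xi> that] eq[OF that] by blast
  ultimately show ?thesis unfolding fe_def by (auto simp: shape_fun_def)
qed

lemma shape_fun_node:
  assumes "\<xi> \<in> nodes" "\<eta> \<in> nodes" shows "shape_fun \<xi> \<eta> = (if \<eta> = \<xi> then 1 else 0)"
proof -
  obtain T where T: "T \<in> \<A>" "\<eta> \<in> lagrange_nodes k T" using assms(2) by (auto simp: nodes_def)
  then have \<eta>: "\<eta> \<in> T" using full_simplex.lagrange_nodes_iff[OF cell k] by blast
  show ?thesis
    using shape_fun_eq[OF assms(1) T(1) \<eta>] \<eta>
      full_simplex.lagrange_poly_at_node[OF cell[OF T(1)] k node_in_cell[OF T(1) assms(1)] T(2)]
    by (auto simp: cell_shape_def)
qed

lemma fe_unisolvent: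
  assumes "v \<in> fe" "w \<in> fe" "\<And>\<xi>. \<xi> \<in> nodes \<Longrightarrow> v \<xi> = w \<xi>" shows "v = w"
proof
  fix x
  show "v x = w x"
  proof (cases "x \<in> \<Union>\<A>")
    case False
    then show ?thesis using assms(1,2) by (simp add: fe_def)
  next
    case True
    then obtain T where T: "T \<in> \<A>" "x \<in> T" by blast
    interpret full_simplex T using cell[OF T(1)] .
    obtain p where p: "p \<in> polys k" "\<forall>x\<in>T. v x = p x" using fe_poly[OF assms(1) T(1)] by blast
    obtain q where q: "q \<in> polys k" "\<forall>x\<in>T. w x = q x" using fe_poly[OF assms(2) T(1)] by blast
    have "p = q"
    proof (rule polys_unisolvent[OF k p(1) q(1)])
      fix \<xi> assume \<xi>: "\<xi> \<in> lagrange_nodes k T"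
      then have "\<xi> \<in> T" "\<xi> \<in> nodes" using lagrange_nodes_iff[OF k] T(1) by (auto simp: nodes_def)
      then show "p \<xi> = q \<xi>" using p(2) q(2) assms(3) by force
    qed
    then show ?thesis using p(2) q(2) T(2) by simp
  qed
qed

lemma sum_shape_node:
  assumes "N \<subseteq> nodes" "\<eta> \<in> nodes"
  shows "(\<Sum>\<xi>\<in>N. c \<xi> * shape_fun \<xi> \<eta>) = (if \<eta> \<in> N then c \<eta> else 0)"
proof -
  have "(\<Sum>\<xi>\<in>N. c \<xi> * shape_fun \<xi> \<eta>) = (\<Sum>\<xi>\<in>N. if \<xi> = \<eta> then c \<xi> else 0)"
    using shape_fun_node[OF _ assms(2)] assms(1) by (intro sum.cong) auto
  then show ?thesis using finite_subset[OF assms(1) finite_nodes] by simp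
qed

lemma fe_expansion:
  assumes "v \<in> fe" shows "v x = (\<Sum>\<xi>\<in>nodes. v \<xi> * shape_fun \<xi> x)"
proof -
  have "v = (\<lambda>x. \<Sum>\<xi>\<in>nodes. v \<xi> * shape_fun \<xi> x)"
    by (rule fe_unisolvent[OF assms]) (auto intro: fe_sum shape_fun_fe simp: sum_shape_node)
  then show ?thesis by metis
qed

lemma span_fe: "N \<subseteq> nodes \<Longrightarrow> (\<lambda>x. \<Sum>\<xi>\<in>N. c \<xi> * shape_fun \<xi> x) \<in> fe"
  by (intro fe_sum shape_fun_fe) blast

text \<open>Evaluation at a node singles out one coefficient, so both parts are determined by the
  nodal values of \<open>v\<close>.\<close>

lemma decomposition:
  assumes v: "v \<in> fe" and N: "N \<subseteq> nodes"
    and w: "w0 = (\<lambda>x. \<Sum>\<xi>\<in>nodes - N. c0 \<xi> * shape_fun \<xi> x)" "w1 = (\<lambda>x. \<Sum>\<xi>\<in>N. c1 \<xi> * shape_fun \<xi> x)"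
    "v = (\<lambda>x. w0 x + w1 x)"
  shows "w0 = (\<lambda>x. \<Sum>\<xi>\<in>nodes - N. v \<xi> * shape_fun \<xi> x)" "w1 = (\<lambda>x. \<Sum>\<xi>\<in>N. v \<xi> * shape_fun \<xi> x)"
proof -
  have e: "v \<xi> = (if \<xi> \<in> N then c1 \<xi> else c0 \<xi>)" if "\<xi> \<in> nodes" for \<xi>
    using that N sum_shape_node[OF N that, of c1] sum_shape_node[of "nodes - N" \<xi> c0] by (simp add: w)
  have "c0 \<xi> = v \<xi>" if "\<xi> \<in> nodes - N" for \<xi> using e[of \<xi>] that by simp
  then show "w0 = (\<lambda>x. \<Sum>\<xi>\<in>nodes - N. v \<xi> * shape_fun \<xi> x)"
    unfolding w(1) by (intro ext sum.cong refl) metis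
  have "c1 \<xi> = v \<xi>" if "\<xi> \<in> N" for \<xi> using e[of \<xi>] that N by auto
  then show "w1 = (\<lambda>x. \<Sum>\<xi>\<in>N. v \<xi> * shape_fun \<xi> x)"
    unfolding w(2) by (intro ext sum.cong refl) metis
qed

end

section \<open>The boundary part\<close>

text \<open>Valid also when \<open>measure_of\<close> degenerates to the null measure.\<close>

lemma emeasure_hausdorff_measure_le: "emeasure (hausdorff_measure n) A \<le> hausdorff_outer n (A :: 'a::metric_space set)"
  unfolding hausdorff_measure_def emeasure_measure_of_conv by auto

lemma lipschitz_domain_open: "lipschitz_domain \<Omega> \<Longrightarrow> open \<Omega>"
  by (simp add: lipschitz_domain_def)

text \<open>A set smaller than the chart radius \<open>R\<close> lies in a chart ball around any of
  its boundary points. For larger sets the measure of the whole boundary, finite by compactness, is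
  compared with \<open>R ^ (DIM('a) - 1)\<close>.\<close>

lemma boundary_measure_upper:
  fixes \<Omega> :: "'a::euclidean_space set"
  assumes d: "2 \<le> DIM('a)" and \<Omega>: "lipschitz_domain \<Omega>" "bounded \<Omega>"
  obtains C where "0 \<le> C" "\<And>T. bounded T \<Longrightarrow> 0 < diameter T \<Longrightarrow>
    emeasure surface_measure (T \<inter> frontier \<Omega>) \<le> ennreal (C * diameter T ^ (DIM('a) - 1))"
proof -
  let ?n = "DIM('a) - 1" and ?\<Gamma> = "frontier \<Omega>" and ?\<mu> = "surface_measure :: 'a measure"
  obtain R L where RL: "0 < R" "0 \<le> L" "\<And>x. x \<in> ?\<Gamma> \<Longrightarrow> \<exists>e g. graph_chart \<Omega> R L x e g"
    using lipschitz_domain_charts[OF \<Omega>] by metis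
  define cu where "cu = unit_ball_vol (real ?n) * (8 + 4 * L) ^ DIM('a)"
  have cu: "0 \<le> cu" using RL(2) by (simp add: cu_def)
  have local: "emeasure ?\<mu> A \<le> ennreal (cu * r ^ ?n)"
    if x: "x \<in> ?\<Gamma>" and r: "0 < r" "r < R" and A: "A \<subseteq> ?\<Gamma> \<inter> cball x r" for x r A
  proof -
    obtain e g where eg: "graph_chart \<Omega> R L x e g" using RL(3)[OF x] by blast
    interpret lipschitz_chart \<Omega> R L x e g
      by unfold_locales (use eg lipschitz_domain_open[OF \<Omega>(1)] x RL(1) in auto)
    show ?thesis
      using frontier_measure_upper[OF d r A] emeasure_hausdorff_measure_le[of ?n A] unfolding cu_def by (meson order_trans)
  qed
  have "compact ?\<Gamma>" using \<Omega>(2) compact_frontier_bounded by blast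
  moreover have "?\<Gamma> \<subseteq> (\<Union>x\<in>?\<Gamma>. ball x (R / 2))" using RL(1) by auto
  ultimately obtain D where D: "D \<subseteq> ?\<Gamma>" "finite D" "?\<Gamma> \<subseteq> (\<Union>x\<in>D. ball x (R / 2))"
    using compactE_image[of ?\<Gamma> ?\<Gamma> "\<lambda>x. ball x (R / 2)"] by auto
  have meas: "A \<in> sets ?\<mu>" if "closed A" for A using that by (simp add: hausdorff_measure_sigma)
  define G where "G = real (card D) * (cu * (R / 2) ^ ?n)"
  have G: "0 \<le> G" using cu RL(1) by (simp add: G_def)
  have cl: "closed (?\<Gamma> \<inter> cball x (R / 2))" for x by (intro closed_Int frontier_closed closed_cball)
  have "emeasure ?\<mu> ?\<Gamma> \<le> emeasure ?\<mu> (\<Union>x\<in>D. ?\<Gamma> \<inter> cball x (R / 2))"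
    using D(3) ball_subset_cball by (intro emeasure_mono sets.finite_UN D(2) meas cl) blast
  also have "\<dots> \<le> (\<Sum>x\<in>D. emeasure ?\<mu> (?\<Gamma> \<inter> cball x (R / 2)))"
    using meas[OF cl] by (intro emeasure_subadditive_finite D(2)) auto
  also have "\<dots> \<le> (\<Sum>x\<in>D. ennreal (cu * (R / 2) ^ ?n))"
    using D(1) RL(1) by (intro sum_mono local) auto
  also have "\<dots> = ennreal G" unfolding G_def using cu RL(1)
    by (simp add: ennreal_mult ennreal_of_nat_eq_real_of_nat)
  finally have global: "emeasure ?\<mu> ?\<Gamma> \<le> ennreal G" .
  define C where "C = cu + G / R ^ ?n"
  have GR: "0 \<le> G / R ^ ?n" using G RL(1) by simp
  have C: "0 \<le> C" using cu GR by (simp add: C_def)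
  have "emeasure ?\<mu> (T \<inter> ?\<Gamma>) \<le> ennreal (C * diameter T ^ ?n)" if T: "bounded T" "0 < diameter T" for T
  proof (cases "T \<inter> ?\<Gamma> = {}")
    case True
    then show ?thesis by simp
  next
    case False
    then obtain x where x: "x \<in> T" "x \<in> ?\<Gamma>" by blast
    show ?thesis
    proof (cases "diameter T < R")
      case True
      have "T \<inter> ?\<Gamma> \<subseteq> ?\<Gamma> \<inter> cball x (diameter T)"
        using diameter_bounded_bound[OF T(1) x(1)] by auto
      from local[OF x(2) T(2) True this] have "emeasure ?\<mu> (T \<inter> ?\<Gamma>) \<le> ennreal (cu * diameter T ^ ?n)" .
      also have "\<dots> \<le> ennreal (C * diameter T ^ ?n)"
        using T(2) GR by (intro ennreal_leI mult_right_mono) (auto simp: C_def)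
      finally show ?thesis .
    next
      case False
      have "emeasure ?\<mu> (T \<inter> ?\<Gamma>) \<le> emeasure ?\<mu> ?\<Gamma>" by (intro emeasure_mono meas) auto
      also note global
      also have "ennreal G \<le> ennreal (C * diameter T ^ ?n)"
      proof (rule ennreal_leI)
        have "G = G / R ^ ?n * R ^ ?n" using RL(1) by simp
        also have "\<dots> \<le> C * diameter T ^ ?n"
          using False RL(1) cu GR C by (intro mult_mono power_mono) (auto simp: C_def)
        finally show "G \<le> C * diameter T ^ ?n" .
      qed
      finally show ?thesis .
    qed
  qed
  then show ?thesis using that C by blast
qed

text \<open>\<open>trace_cell\<close> divided by the diameter, with \<open>B\<close> taken from the
  chart at an accessible boundary point. The constant is fixed before the mesh is given, so the mesh
  enters it only through \<open>s\<close> and \<open>D\<close>. The premise on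
  \<open>surface_measure\<close> turns the lower bound for the outer measure of \<open>B\<close>
  into one for its measure.\<close>

lemma trace_estimate:
  fixes \<Omega> :: "'a::euclidean_space set" and k :: nat and s D :: real
  assumes d: "2 \<le> DIM('a)" and \<Omega>: "lipschitz_domain \<Omega>" "bounded \<Omega>" and k: "1 \<le> k" and s: "1 \<le> s" and D: "0 < D"
  obtains K where "0 < K"
    "\<And>\<A> u T x. regular_mesh \<A> s \<Longrightarrow> \<Omega> \<subseteq> \<Union>\<A> \<Longrightarrow>
      (\<And>B :: 'a set. B \<in> sets borel \<Longrightarrow> emeasure surface_measure B = hausdorff_outer (DIM('a) - 1) B) \<Longrightarrow>
      (\<And>T. T \<in> \<A> \<Longrightarrow> \<exists>p\<in>polys k. \<forall>x\<in>T. u x = p x) \<Longrightarrow>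
      T \<in> \<A> \<Longrightarrow> diameter T \<le> D \<Longrightarrow> T \<inter> \<Omega> \<noteq> {} \<Longrightarrow> T \<inter> frontier \<Omega> \<noteq> {} \<Longrightarrow> x \<in> T \<Longrightarrow>
      diameter T ^ (DIM('a) - 1) / diameter T * (u x)\<^sup>2 \<le>
        K * (\<Sum>T'\<in>regular_mesh.near \<A> T. inverse (diameter T') * (LINT y:T' \<inter> frontier \<Omega>|surface_measure. u y * u y) + grad_prod T' u u)"
proof -
  let ?n = "DIM('a) - 1" and ?\<Gamma> = "frontier \<Omega>" and ?\<mu> = "surface_measure :: 'a measure"
  obtain R L where RL: "0 < R" "0 \<le> L" "\<And>x. x \<in> ?\<Gamma> \<Longrightarrow> \<exists>e g. graph_chart \<Omega> R L x e g"
    using lipschitz_domain_charts[OF \<Omega>] by metis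
  obtain C where C: "0 \<le> C" "\<And>T. bounded T \<Longrightarrow> 0 < diameter T \<Longrightarrow> emeasure ?\<mu> (T \<inter> ?\<Gamma>) \<le> ennreal (C * diameter T ^ ?n)"
    using boundary_measure_upper[OF d \<Omega>] by metis
  define W where "W = walk_ratio DIM('a) s"
  have W: "0 < W" unfolding W_def using walk_ratio_pos[OF s] .
  \<comment> \<open>The terms are those of the radius \<open>r\<close> below, divided by the
    diameter and by its bound \<open>D\<close> respectively; hence
    \<open>\<epsilon> * diameter T \<le> r\<close>.\<close>
  define \<epsilon> where "\<epsilon> = min (1 / (4 * W * (4 + 2 * L))) (R / (2 * (4 + 2 * L) * D))"
  have \<epsilon>: "0 < \<epsilon>" using W RL D by (simp add: \<epsilon>_def)
  define cl where "cl = unit_ball_vol (real ?n) / (5 * 4 ^ DIM('a)) / ((2 + L) ^ DIM('a) * (1 + L))"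
  have cl: "0 < cl" using RL(2) by (simp add: cl_def)
  define c where "c = cl * (\<epsilon> / 2) ^ ?n"
  have c: "0 < c" using cl \<epsilon> by (simp add: c_def)
  define q where "q = cell_ratio DIM('a) s"
  have q: "1 \<le> q" unfolding q_def using cell_ratio_ge_1[OF s] .
  define \<kappa> where "\<kappa> = inverse_const k DIM('a) s * s ^ DIM('a)"
  have \<kappa>: "0 < \<kappa>" unfolding \<kappa>_def using inverse_const_pos[OF k s, of "DIM('a)"] s by (intro mult_pos_pos) auto
  define K0 where "K0 = 3 + 3 * \<kappa> * C * (q ^ ?n * (real (Suc DIM('a)) * s ^ DIM('a)) + 1)"
  have K0: "0 < K0" unfolding K0_def using \<kappa> C(1) q s
    by (intro add_pos_nonneg mult_nonneg_nonneg add_nonneg_nonneg) auto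
  show ?thesis
  proof (rule that[of "K0 * q / c"])
    show "0 < K0 * q / c" using K0 q c by simp
    fix \<A> u T x
    assume reg: "regular_mesh \<A> s" and cov: "\<Omega> \<subseteq> \<Union>\<A>"
      and gen: "\<And>B :: 'a set. B \<in> sets borel \<Longrightarrow> emeasure ?\<mu> B = hausdorff_outer ?n B"
      and poly: "\<And>T. T \<in> \<A> \<Longrightarrow> \<exists>p\<in>polys k. \<forall>x\<in>T. u x = p x"
      and T: "T \<in> \<A>" and TD: "diameter T \<le> D" and T\<Omega>: "T \<inter> \<Omega> \<noteq> {}" and T\<Gamma>: "T \<inter> ?\<Gamma> \<noteq> {}" and x: "x \<in> T"
    interpret regular_mesh \<A> s by (rule reg)
    let ?h = "diameter T"
    have h: "0 < ?h" using diameter_pos[OF T] .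
    obtain x0 where x0: "x0 \<in> T \<inter> ?\<Gamma>" "\<And>\<epsilon>. 0 < \<epsilon> \<Longrightarrow> \<exists>a\<in>interior T \<inter> \<Omega>. dist a x0 < \<epsilon>"
      using full_simplex.first_exit[OF cell[OF T] lipschitz_domain_open[OF \<Omega>(1)] T\<Omega> T\<Gamma>] by metis
    obtain e g where eg: "graph_chart \<Omega> R L x0 e g" using RL(3) x0(1) by blast
    have chart: "lipschitz_chart \<Omega> R L x0 e g"
      by unfold_locales (use eg lipschitz_domain_open[OF \<Omega>(1)] x0(1) RL(1) in auto)
    \<comment> \<open>The first term keeps the paths short enough for the cut-off, the second keeps
      them inside the chart ball; the factors 4 and 2 leave room for strict inequalities.\<close>
    define r where "r = min (?h / (4 * W * (4 + 2 * L))) (R / (2 * (4 + 2 * L)))"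
    have r0: "0 < r" using h W RL by (simp add: r_def)
    have "r \<le> R / (2 * (4 + 2 * L))" by (simp add: r_def)
    then have "(4 + 2 * L) * r \<le> (4 + 2 * L) * (R / (2 * (4 + 2 * L)))"
      using RL(2) by (intro mult_left_mono) auto
    also have "\<dots> = R / 2" using RL(2) by (simp add: field_simps)
    finally have r1: "(4 + 2 * L) * r < R" using RL(1) by simp
    have "r \<le> ?h / (4 * W * (4 + 2 * L))" by (simp add: r_def)
    then have "W * (2 * ((4 + 2 * L) * r)) \<le> W * (2 * ((4 + 2 * L) * (?h / (4 * W * (4 + 2 * L)))))"
      using RL(2) W by (intro mult_left_mono) auto
    also have "\<dots> = ?h / 2"
    proof -
      have "W * (2 * (b * (h / (4 * W * b)))) = h / 2" if "b \<noteq> 0" for b h :: real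
        using that W by simp
      moreover have "4 + 2 * L \<noteq> 0" using RL(2) by simp
      ultimately show ?thesis by blast
    qed
    finally have r2: "walk_ratio DIM('a) s * (2 * ((4 + 2 * L) * r)) < ?h" using h by (simp add: W_def)
    have r3: "\<epsilon> * ?h \<le> r"
    proof -
      have "\<epsilon> * ?h \<le> 1 / (4 * W * (4 + 2 * L)) * ?h" using h by (intro mult_right_mono) (auto simp: \<epsilon>_def)
      moreover have "\<epsilon> * ?h \<le> R / (2 * (4 + 2 * L) * D) * D"
        using h TD \<epsilon> RL D by (intro mult_mono) (auto simp: \<epsilon>_def)
      ultimately show ?thesis using D by (simp add: r_def)
    qed
    have r4: "r / 2 < R"
    proof -
      have "1 * r \<le> (4 + 2 * L) * r" using RL(2) r0 by (intro mult_right_mono) auto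
      then show ?thesis using r1 r0 by linarith
    qed
    \<comment> \<open>Half the radius, since the boundary measure is bounded below on closed balls
      and the near cells cover an open one.\<close>
    define B where "B = ?\<Gamma> \<inter> cball x0 (r / 2)"
    have "B \<subseteq> ?\<Gamma> \<inter> ball x0 r" using r0 by (auto simp: B_def)
    then have B_sub: "B \<subseteq> \<Union>(near T) \<inter> ?\<Gamma>"
      using cover_frontier[OF d T cov chart x0(2) r0 r1 r2] by blast
    have B_borel: "B \<in> sets borel" unfolding B_def by (intro borel_closed closed_Int frontier_closed closed_cball)
    have B_ge: "ennreal (c * ?h ^ ?n) \<le> emeasure ?\<mu> B"
    proof -
      have "c * ?h ^ ?n = cl * (\<epsilon> * ?h / 2) ^ ?n" by (simp add: c_def power_mult_distrib power_divide)
      also have "\<dots> \<le> cl * (r / 2) ^ ?n"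
        using r3 \<epsilon> h cl by (intro mult_left_mono power_mono) auto
      finally have "ennreal (c * ?h ^ ?n) \<le> ennreal (cl * (r / 2) ^ ?n)" by (rule ennreal_leI)
      also have "\<dots> \<le> hausdorff_outer ?n B"
        unfolding B_def cl_def using lipschitz_chart.frontier_measure_lower[OF chart d _ r4] r0 by simp
      finally show ?thesis using gen[OF B_borel] by simp
    qed
    have Cb: "emeasure ?\<mu> (T' \<inter> ?\<Gamma>) \<le> ennreal (C * diameter T' ^ ?n)" if "T' \<in> \<A>" for T'
      using C(2) compact_imp_bounded[OF full_simplex.compact_T[OF cell[OF that]]] diameter_pos[OF that] by blast
    let ?I = "\<lambda>T'. LINT y:T' \<inter> ?\<Gamma>|?\<mu>. u y * u y"
    have I0: "0 \<le> ?I T'" for T' unfolding set_lebesgue_integral_def by (rule Bochner_Integration.integral_nonneg) simp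
    have main: "c * ?h ^ ?n * (u x)\<^sup>2 \<le> K0 * (\<Sum>T'\<in>near T. ?I T' + diameter T' * grad_prod T' u u)"
      unfolding K0_def \<kappa>_def q_def
      by (rule trace_cell[OF k hausdorff_measure_sigma(1) poly T x frontier_closed B_borel B_sub C(1) Cb c B_ge])
    \<comment> \<open>Division by the diameter of \<open>T\<close> produces the weight of the trace
      term; replacing it by the diameter of \<open>T'\<close> costs the factor
      \<open>q\<close>.\<close>
    have each: "(?I T' + diameter T' * grad_prod T' u u) / ?h \<le> q * (inverse (diameter T') * ?I T' + grad_prod T' u u)"
      if T': "T' \<in> near T" for T'
    proof -
      have T'A: "T' \<in> \<A>" using T' near_subset by blast
      have h': "0 < diameter T'" using diameter_pos[OF T'A] .
      have "diameter T' \<le> q * ?h" unfolding q_def using near_diameter[OF T'A near_sym[OF T T']] .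
      then have inv: "1 / ?h \<le> q * inverse (diameter T')" using h h' by (simp add: field_simps)
      have "(?I T' + diameter T' * grad_prod T' u u) / ?h = 1 / ?h * (?I T' + diameter T' * grad_prod T' u u)" by simp
      also have "\<dots> \<le> q * inverse (diameter T') * (?I T' + diameter T' * grad_prod T' u u)"
        using I0[of T'] h' grad_prod_nonneg[of T' u] inv by (intro mult_right_mono) auto
      also have "\<dots> = q * (inverse (diameter T') * ?I T' + grad_prod T' u u)"
        using h' by (simp add: distrib_left)
      finally show ?thesis .
    qed
    have "?h ^ ?n / ?h * (u x)\<^sup>2 = (c * ?h ^ ?n * (u x)\<^sup>2) / (c * ?h)" using c h by simp
    also have "\<dots> \<le> (K0 * (\<Sum>T'\<in>near T. ?I T' + diameter T' * grad_prod T' u u)) / (c * ?h)"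
      using main c h by (intro divide_right_mono) auto
    also have "\<dots> = K0 / c * (\<Sum>T'\<in>near T. (?I T' + diameter T' * grad_prod T' u u) / ?h)"
      by (simp add: sum_divide_distrib[symmetric])
    also have "\<dots> \<le> K0 / c * (\<Sum>T'\<in>near T. q * (inverse (diameter T') * ?I T' + grad_prod T' u u))"
      using K0 c by (intro mult_left_mono sum_mono each) auto
    also have "\<dots> = K0 * q / c * (\<Sum>T'\<in>near T. inverse (diameter T') * ?I T' + grad_prod T' u u)"
      by (simp add: sum_distrib_left[symmetric])
    finally show "?h ^ ?n / ?h * (u x)\<^sup>2 \<le> K0 * q / c * (\<Sum>T'\<in>near T. inverse (diameter T') * ?I T' + grad_prod T' u u)" .
  qed
qed

locale regular_lagrange_mesh = regular_mesh \<A> s + lagrange_mesh \<A> k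
  for \<A> :: "'a::euclidean_space set set" and s k +
  fixes \<Gamma> :: "'a set" and \<mu> :: "'a measure" and C \<gamma> :: real
  assumes \<Gamma>: "closed \<Gamma>" and \<mu>: "sets \<mu> = sets borel" and C_nonneg: "0 \<le> C" and \<gamma>_pos: "0 < \<gamma>"
    and C: "\<And>T. T \<in> \<A> \<Longrightarrow> emeasure \<mu> (T \<inter> \<Gamma>) \<le> ennreal (C * diameter T ^ (DIM('a) - 1))"
begin

definition cut :: "'a set set" where "cut = {T\<in>\<A>. T \<inter> \<Gamma> \<noteq> {}}"

definition trace :: "('a \<Rightarrow> real) \<Rightarrow> 'a set \<Rightarrow> real" where
  "trace u T = (LINT y:T \<inter> \<Gamma>|\<mu>. u y * u y)"

text \<open>The square of the b-norm, with the energy split over the cells.\<close>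

definition bform :: "('a \<Rightarrow> real) \<Rightarrow> real" where
  "bform u = (\<Sum>T\<in>\<A>. grad_prod T u u) + \<gamma> * (\<Sum>T\<in>cut. inverse (diameter T) * trace u T)"

lemma cut_subset: "cut \<subseteq> \<A>" by (auto simp: cut_def)

lemma trace_nonneg: "0 \<le> trace u T"
  unfolding trace_def set_lebesgue_integral_def by (rule Bochner_Integration.integral_nonneg) simp

lemma trace_finite:
  assumes "T \<in> \<A>" shows "emeasure \<mu> (T \<inter> \<Gamma>) < \<infinity>" "measure \<mu> (T \<inter> \<Gamma>) \<le> C * diameter T ^ (DIM('a) - 1)"
  using C[OF assms] C_nonneg diameter_pos[OF assms]
  by (auto simp: measure_def le_less_trans[OF _ ennreal_less_top] intro!: enn2real_leI)

lemma trace_integrable: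
  assumes "u \<in> fe" "T \<in> \<A>"
  shows "set_integrable \<mu> (T \<inter> \<Gamma>) (\<lambda>y. u y * u y)"
proof -
  obtain p where p: "p \<in> polys k" "\<forall>x\<in>T. u x = p x" using fe_poly[OF assms] by blast
  have "compact (T \<inter> \<Gamma>)" using full_simplex.compact_T[OF cell[OF assms(2)]] \<Gamma> by (rule compact_Int_closed)
  from set_integrable_compact_borel[OF \<mu> this trace_finite(1)[OF assms(2)], of "\<lambda>y. p y * p y"]
  have "set_integrable \<mu> (T \<inter> \<Gamma>) (\<lambda>y. p y * p y)" using polys_continuous[OF p(1)] by (simp add: continuous_on_mult)
  moreover have "(\<lambda>y. indicat_real (T \<inter> \<Gamma>) y *\<^sub>R (p y * p y)) = (\<lambda>y. indicat_real (T \<inter> \<Gamma>) y *\<^sub>R (u y * u y))"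
    using p(2) by (auto simp: fun_eq_iff indicator_def)
  ultimately show ?thesis by (simp add: set_integrable_def)
qed

lemma trace_le:
  assumes u: "u \<in> fe" and T: "T \<in> \<A>" and A: "\<And>x. x \<in> T \<Longrightarrow> \<bar>u x\<bar> \<le> A"
  shows "trace u T \<le> A\<^sup>2 * (C * diameter T ^ (DIM('a) - 1))"
proof -
  have S: "T \<inter> \<Gamma> \<in> sets \<mu>" using full_simplex.closed_T[OF cell[OF T]] \<Gamma> by (simp add: \<mu> closed_Int)
  have "trace u T \<le> (LINT y|\<mu>. A\<^sup>2 * indicat_real (T \<inter> \<Gamma>) y)"
    unfolding trace_def set_lebesgue_integral_def
  proof (rule integral_mono)
    show "integrable \<mu> (\<lambda>y. indicat_real (T \<inter> \<Gamma>) y *\<^sub>R (u y * u y))"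
      using trace_integrable[OF u T] by (simp add: set_integrable_def)
    show "integrable \<mu> (\<lambda>y. A\<^sup>2 * indicat_real (T \<inter> \<Gamma>) y)"
      using S trace_finite(1)[OF T] by (intro integrable_mult_right integrable_real_indicator) auto
    show "indicat_real (T \<inter> \<Gamma>) y *\<^sub>R (u y * u y) \<le> A\<^sup>2 * indicat_real (T \<inter> \<Gamma>) y" for y
    proof (cases "y \<in> T \<inter> \<Gamma>")
      case True
      then have "\<bar>u y\<bar>\<^sup>2 \<le> A\<^sup>2" using A by (intro power_mono) auto
      then show ?thesis using True by (simp add: power2_eq_square)
    qed simp
  qed
  also have "\<dots> = A\<^sup>2 * measure \<mu> (T \<inter> \<Gamma>)" using S trace_finite(1)[OF T] by simp
  also have "\<dots> \<le> A\<^sup>2 * (C * diameter T ^ (DIM('a) - 1))" using trace_finite(2)[OF T] by (intro mult_left_mono) auto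
  finally show ?thesis .
qed

lemma trace_diff:
  assumes u: "u \<in> fe" and w: "w \<in> fe" and uw: "(\<lambda>x. u x - w x) \<in> fe" and T: "T \<in> \<A>"
  shows "trace (\<lambda>x. u x - w x) T \<le> 2 * trace u T + 2 * trace w T"
proof -
  note i = trace_integrable[OF u T] trace_integrable[OF w T] trace_integrable[OF uw T]
  have "trace (\<lambda>x. u x - w x) T \<le> (LINT y:T \<inter> \<Gamma>|\<mu>. 2 * (u y * u y) + 2 * (w y * w y))"
    unfolding trace_def
  proof (rule set_integral_mono[OF i(3)])
    show "set_integrable \<mu> (T \<inter> \<Gamma>) (\<lambda>y. 2 * (u y * u y) + 2 * (w y * w y))"
      using i by (intro set_integral_add set_integrable_mult_right) auto
    show "(u y - w y) * (u y - w y) \<le> 2 * (u y * u y) + 2 * (w y * w y)" for y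
      using zero_le_square[of "u y + w y"] by (simp add: algebra_simps)
  qed
  also have "\<dots> = 2 * trace u T + 2 * trace w T"
    unfolding trace_def using i by (subst set_integral_add) (auto intro: set_integrable_mult_right)
  finally show ?thesis .
qed

lemma bform_nonneg: "0 \<le> bform u"
proof -
  have t: "0 \<le> inverse (diameter T) * trace u T" if "T \<in> cut" for T
    using diameter_pos cut_subset that trace_nonneg[of u T] by (intro mult_nonneg_nonneg) (auto simp: less_imp_le)
  have "0 \<le> (\<Sum>T\<in>\<A>. grad_prod T u u)" by (intro sum_nonneg grad_prod_nonneg)
  then show ?thesis unfolding bform_def
    by (rule add_nonneg_nonneg[OF _ mult_nonneg_nonneg[OF less_imp_le[OF \<gamma>_pos] sum_nonneg[OF t]]])
qed

lemma bform_diff: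
  assumes u: "u \<in> fe" and w: "w \<in> fe" and uw: "(\<lambda>x. u x - w x) \<in> fe"
  shows "bform (\<lambda>x. u x - w x) \<le> 2 * bform u + 2 * bform w"
proof -
  have g: "grad_prod T (\<lambda>x. u x - w x) (\<lambda>x. u x - w x) \<le> 2 * grad_prod T u u + 2 * grad_prod T w w" if T: "T \<in> \<A>" for T
  proof -
    obtain p where p: "p \<in> polys k" "\<And>x. x \<in> T \<Longrightarrow> u x = p x" using fe_poly[OF u T] by blast
    obtain p' where p': "p' \<in> polys k" "\<And>x. x \<in> T \<Longrightarrow> w x = p' x" using fe_poly[OF w T] by blast
    show ?thesis using full_simplex.energy_diff[OF cell[OF T] p p'] .
  qed
  have t: "inverse (diameter T) * trace (\<lambda>x. u x - w x) T \<le> 2 * (inverse (diameter T) * trace u T) + 2 * (inverse (diameter T) * trace w T)"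
    if "T \<in> cut" for T
  proof -
    have T: "T \<in> \<A>" using that cut_subset by blast
    have "inverse (diameter T) * trace (\<lambda>x. u x - w x) T \<le> inverse (diameter T) * (2 * trace u T + 2 * trace w T)"
      using trace_diff[OF u w uw T] diameter_pos[OF T] by (intro mult_left_mono) auto
    then show ?thesis by (simp only: distrib_left mult.left_commute)
  qed
  have 1: "(\<Sum>T\<in>\<A>. grad_prod T (\<lambda>x. u x - w x) (\<lambda>x. u x - w x)) \<le> 2 * (\<Sum>T\<in>\<A>. grad_prod T u u) + 2 * (\<Sum>T\<in>\<A>. grad_prod T w w)"
    using sum_mono[OF g] by (simp add: sum.distrib sum_distrib_left)
  have "(\<Sum>T\<in>cut. inverse (diameter T) * trace (\<lambda>x. u x - w x) T) \<le>
     2 * (\<Sum>T\<in>cut. inverse (diameter T) * trace u T) + 2 * (\<Sum>T\<in>cut. inverse (diameter T) * trace w T)"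
    using sum_mono[OF t] by (simp only: sum.distrib sum_distrib_left)
  from mult_left_mono[OF this less_imp_le[OF \<gamma>_pos]] 1 show ?thesis
    unfolding bform_def by (simp add: distrib_left)
qed

text \<open>By symmetry of \<open>near\<close>, after exchanging the sums each cell is counted at
  most as often as it has near cells, and \<open>card_near_le\<close> bounds that number.\<close>

lemma near_sum_le:
  assumes f: "\<And>T. T \<in> \<A> \<Longrightarrow> 0 \<le> f T" and S: "S \<subseteq> \<A>"
  shows "(\<Sum>T\<in>S. \<Sum>T'\<in>near T. f T') \<le> real (Suc DIM('a)) * s ^ DIM('a) * (\<Sum>T\<in>\<A>. f T)"
proof -
  have "(\<Sum>T\<in>S. \<Sum>T'\<in>near T. f T') \<le> (\<Sum>T\<in>\<A>. \<Sum>T'\<in>near T. f T')"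
    using S finite_mesh f near_subset by (intro sum_mono2) (auto intro!: sum_nonneg)
  also have "\<dots> = (\<Sum>T\<in>\<A>. \<Sum>T'\<in>{T'. T' \<in> \<A> \<and> T' \<in> near T}. f T')"
    using near_subset by (intro sum.cong) auto
  also have "\<dots> = (\<Sum>T'\<in>\<A>. \<Sum>T\<in>{T. T \<in> \<A> \<and> T' \<in> near T}. f T')"
    by (rule sum.swap_restrict[OF finite_mesh finite_mesh])
  also have "\<dots> = (\<Sum>T'\<in>\<A>. \<Sum>T\<in>near T'. f T')"
  proof (rule sum.cong[OF refl])
    fix T' assume T': "T' \<in> \<A>"
    have "{T. T \<in> \<A> \<and> T' \<in> near T} = near T'" using near_sym near_subset T' by blast
    then show "(\<Sum>T\<in>{T. T \<in> \<A> \<and> T' \<in> near T}. f T') = (\<Sum>T\<in>near T'. f T')" by simp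
  qed
  also have "\<dots> = (\<Sum>T'\<in>\<A>. real (card (near T')) * f T')" by simp
  also have "\<dots> \<le> (\<Sum>T'\<in>\<A>. real (Suc DIM('a)) * s ^ DIM('a) * f T')"
    by (intro sum_mono mult_right_mono card_near_le f)
  finally show ?thesis by (simp only: sum_distrib_left)
qed

text \<open>The boundary part vanishes off the cut cells; on a cut cell it is bounded, through its
  nodal values, by the trace estimate.\<close>

lemma boundary_part_bound:
  assumes v: "v \<in> fe" and N: "N \<subseteq> nodes" "\<And>T. T \<in> \<A> \<Longrightarrow> T \<inter> N \<noteq> {} \<Longrightarrow> T \<in> cut"
    and K: "0 \<le> K" "\<And>T x. T \<in> cut \<Longrightarrow> x \<in> T \<Longrightarrow> diameter T ^ (DIM('a) - 1) / diameter T * (v x)\<^sup>2 \<le>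
       K * (\<Sum>T'\<in>near T. inverse (diameter T') * trace v T' + grad_prod T' v v)"
  shows "bform (\<lambda>x. \<Sum>\<xi>\<in>N. v \<xi> * shape_fun \<xi> x) \<le>
    ((nodal_const k DIM('a))\<^sup>2 * (s\<^sup>2 * unit_ball_vol (real DIM('a)) + \<gamma> * C) * K * (real (Suc DIM('a)) * s ^ DIM('a)) * (1 + 1 / \<gamma>)) * bform v"
proof -
  define w where "w = (\<lambda>x. \<Sum>\<xi>\<in>N. v \<xi> * shape_fun \<xi> x)"
  have w: "w \<in> fe" unfolding w_def by (rule span_fe[OF N(1)])
  have wn: "w \<xi> = (if \<xi> \<in> N then v \<xi> else 0)" if "\<xi> \<in> nodes" for \<xi>
    unfolding w_def using sum_shape_node[OF N(1) that] by simp
  let ?A = "nodal_const k DIM('a)" and ?\<omega> = "unit_ball_vol (real DIM('a))" and ?n = "DIM('a) - 1"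
  let ?f = "\<lambda>T'. inverse (diameter T') * trace v T' + grad_prod T' v v"
  let ?S = "\<lambda>T. \<Sum>T'\<in>near T. ?f T'"
  have f0: "0 \<le> ?f T'" if "T' \<in> \<A>" for T'
    using trace_nonneg[of v T'] grad_prod_nonneg[of T' v] diameter_pos[OF that] by auto
  obtain n where n: "DIM('a) = Suc n" by (cases "DIM('a)") auto
  have node_T: "\<xi> \<in> T \<and> \<xi> \<in> nodes" if "T \<in> \<A>" "\<xi> \<in> lagrange_nodes k T" for T \<xi>
    using that full_simplex.lagrange_nodes_iff[OF cell[OF that(1)] k] by (auto simp: nodes_def)
  \<comment> \<open>A cell that is not cut contains no node of \<open>N\<close>; all nodal values
    vanish there, and with them the energy.\<close>
  have off: "grad_prod T w w = 0" if T: "T \<in> \<A>" "T \<notin> cut" for T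
  proof -
    obtain p where p: "p \<in> polys k" "\<And>x. x \<in> T \<Longrightarrow> w x = p x" using fe_poly[OF w T(1)] by blast
    obtain c r where r: "0 < r" "cball c r \<subseteq> T" using shape[OF T(1)] by blast
    have "\<bar>w \<xi>\<bar> \<le> 0" if "\<xi> \<in> lagrange_nodes k T" for \<xi>
      using node_T[OF T(1) that] wn N(2)[OF T(1)] T(2) by auto
    from full_simplex.energy_upper[OF cell[OF T(1)] k p r this] have "grad_prod T w w \<le> 0" by simp
    then show ?thesis using grad_prod_nonneg[of T w] by simp
  qed
  have on: "grad_prod T w w \<le> ?A\<^sup>2 * s\<^sup>2 * ?\<omega> * (K * ?S T) \<and> inverse (diameter T) * trace w T \<le> ?A\<^sup>2 * C * (K * ?S T)"
    if Tc: "T \<in> cut" for T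
  proof -
    have T: "T \<in> \<A>" using Tc cut_subset by blast
    let ?h = "diameter T"
    have h: "0 < ?h" using diameter_pos[OF T] .
    obtain p where p: "p \<in> polys k" "\<And>x. x \<in> T \<Longrightarrow> w x = p x" using fe_poly[OF w T] by blast
    obtain c r where r: "0 < r" "cball c r \<subseteq> T" "?h \<le> s * r" using shape[OF T] by blast
    have S0: "0 \<le> K * ?S T" using K(1) f0 near_subset by (intro mult_nonneg_nonneg sum_nonneg) auto
    \<comment> \<open>\<open>M\<close> is the largest nodal value that the trace estimate permits on
      \<open>T\<close>.\<close>
    define M where "M = sqrt (K * ?S T * ?h / ?h ^ ?n)"
    have M2: "M\<^sup>2 = K * ?S T * ?h / ?h ^ ?n" using S0 h by (simp add: M_def)
    have M0: "0 \<le> M" using S0 h by (simp add: M_def)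
    have node_le: "\<bar>w \<xi>\<bar> \<le> M" if "\<xi> \<in> lagrange_nodes k T" for \<xi>
    proof -
      have "\<bar>w \<xi>\<bar> \<le> \<bar>v \<xi>\<bar>" using wn node_T[OF T that] by auto
      moreover have "?h ^ ?n / ?h * (v \<xi>)\<^sup>2 \<le> K * ?S T" using K(2)[OF Tc] node_T[OF T that] by blast
      then have "(v \<xi>)\<^sup>2 \<le> M\<^sup>2" unfolding M2 using h by (simp add: field_simps)
      then have "\<bar>v \<xi>\<bar> \<le> M" using M0 by (simp add: abs_le_square_iff[symmetric])
      ultimately show ?thesis by linarith
    qed
    have hn: "?h ^ ?n / ?h * M\<^sup>2 = K * ?S T" unfolding M2 using h by simp
    have "grad_prod T w w \<le> (?A * M / r)\<^sup>2 * (?\<omega> * ?h ^ DIM('a))"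
      by (rule full_simplex.energy_upper[OF cell[OF T] k p r(1,2) node_le])
    also have "\<dots> \<le> (?A * M * s / ?h)\<^sup>2 * (?\<omega> * ?h ^ DIM('a))"
    proof (intro mult_right_mono power_mono)
      have "1 / r \<le> s / ?h" using r h by (simp add: field_simps)
      from mult_left_mono[OF this, of "?A * M"] show "?A * M / r \<le> ?A * M * s / ?h"
        using M0 nodal_const_ge_1[OF k, of "DIM('a)"] by simp
    qed (use M0 nodal_const_ge_1[OF k, of "DIM('a)"] r h in auto)
    also have "\<dots> = ?A\<^sup>2 * s\<^sup>2 * ?\<omega> * (?h ^ ?n / ?h * M\<^sup>2)"
      using h by (simp add: n power2_eq_square field_simps)
    finally have 1: "grad_prod T w w \<le> ?A\<^sup>2 * s\<^sup>2 * ?\<omega> * (K * ?S T)" unfolding hn .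
    have wA: "\<bar>w x\<bar> \<le> ?A * M" if "x \<in> T" for x
    proof -
      have "\<bar>p \<xi>\<bar> \<le> M" if "\<xi> \<in> lagrange_nodes k T" for \<xi>
        using node_le[OF that] p(2) node_T[OF T that] by simp
      from full_simplex.nodal_bounds(1)[OF cell[OF T] k p(1) this \<open>x \<in> T\<close> \<open>x \<in> T\<close>]
      show ?thesis using p(2)[OF that] by simp
    qed
    have "inverse ?h * trace w T \<le> inverse ?h * ((?A * M)\<^sup>2 * (C * ?h ^ ?n))"
      using trace_le[OF w T wA] h by (intro mult_left_mono) auto
    also have "\<dots> = ?A\<^sup>2 * C * (?h ^ ?n / ?h * M\<^sup>2)" by (simp add: power_mult_distrib divide_inverse mult_ac)
    finally have 2: "inverse ?h * trace w T \<le> ?A\<^sup>2 * C * (K * ?S T)" unfolding hn .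
    show ?thesis using 1 2 by blast
  qed
  let ?N = "real (Suc DIM('a)) * s ^ DIM('a)"
  have "(\<Sum>T\<in>\<A>. grad_prod T w w) = (\<Sum>T\<in>cut. grad_prod T w w)"
    by (rule sum.mono_neutral_right[OF finite_mesh cut_subset]) (use off in auto)
  then have "bform w = (\<Sum>T\<in>cut. grad_prod T w w + \<gamma> * (inverse (diameter T) * trace w T))"
    by (simp add: bform_def sum.distrib sum_distrib_left)
  also have "\<dots> \<le> (\<Sum>T\<in>cut. ?A\<^sup>2 * (s\<^sup>2 * ?\<omega> + \<gamma> * C) * K * ?S T)"
  proof (rule sum_mono)
    fix T assume "T \<in> cut"
    note o = on[OF this]
    have "\<gamma> * (inverse (diameter T) * trace w T) \<le> \<gamma> * (?A\<^sup>2 * C * (K * ?S T))"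
      using o \<gamma>_pos by (intro mult_left_mono) auto
    then have "grad_prod T w w + \<gamma> * (inverse (diameter T) * trace w T) \<le> ?A\<^sup>2 * s\<^sup>2 * ?\<omega> * (K * ?S T) + \<gamma> * (?A\<^sup>2 * C * (K * ?S T))"
      using o by linarith
    also have "\<dots> = ?A\<^sup>2 * (s\<^sup>2 * ?\<omega> + \<gamma> * C) * K * ?S T"
      by (simp only: distrib_left distrib_right mult_ac)
    finally show "grad_prod T w w + \<gamma> * (inverse (diameter T) * trace w T) \<le> ?A\<^sup>2 * (s\<^sup>2 * ?\<omega> + \<gamma> * C) * K * ?S T" .
  qed
  also have "\<dots> = ?A\<^sup>2 * (s\<^sup>2 * ?\<omega> + \<gamma> * C) * K * (\<Sum>T\<in>cut. ?S T)" by (simp only: sum_distrib_left)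
  also have "\<dots> \<le> ?A\<^sup>2 * (s\<^sup>2 * ?\<omega> + \<gamma> * C) * K * (?N * (\<Sum>T\<in>\<A>. ?f T))"
    using K(1) C_nonneg \<gamma>_pos
    by (intro mult_left_mono near_sum_le f0 cut_subset mult_nonneg_nonneg add_nonneg_nonneg) auto
  also have "\<dots> \<le> ?A\<^sup>2 * (s\<^sup>2 * ?\<omega> + \<gamma> * C) * K * (?N * ((1 + 1 / \<gamma>) * bform v))"
  proof -
    let ?E = "\<Sum>T\<in>\<A>. grad_prod T v v" and ?I = "\<Sum>T\<in>cut. inverse (diameter T) * trace v T"
    \<comment> \<open>The near cells include cells that are not cut, whereas \<open>bform\<close>
      has trace terms on cut cells only; on the others the slice of the boundary is empty.\<close>
    have "(\<Sum>T\<in>\<A>. inverse (diameter T) * trace v T) = ?I"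
    proof (rule sum.mono_neutral_right[OF finite_mesh cut_subset], intro ballI)
      fix T assume "T \<in> \<A> - cut"
      then have "T \<inter> \<Gamma> = {}" by (auto simp: cut_def)
      then show "inverse (diameter T) * trace v T = 0" by (simp add: trace_def set_lebesgue_integral_def)
    qed
    then have e: "(\<Sum>T\<in>\<A>. ?f T) = ?I + ?E" by (simp add: sum.distrib)
    have "0 \<le> inverse (diameter T) * trace v T" if "T \<in> cut" for T
      using trace_nonneg[of v T] diameter_pos that cut_subset by (intro mult_nonneg_nonneg) (auto simp: less_imp_le)
    then have "0 \<le> ?I" by (rule sum_nonneg)
    moreover have "0 \<le> ?E" by (intro sum_nonneg grad_prod_nonneg)
    \<comment> \<open>In \<open>bform\<close> the energy has weight 1 and the trace weight \<gamma>,
      so the factor \<open>1 + 1 / \<gamma>\<close> covers both.\<close>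
    ultimately have "?I + ?E \<le> (1 + 1 / \<gamma>) * bform v"
      unfolding bform_def using \<gamma>_pos by (simp add: field_simps)
    then show ?thesis unfolding e using s_ge_1 K(1) C_nonneg \<gamma>_pos
      by (intro mult_left_mono mult_nonneg_nonneg add_nonneg_nonneg) auto
  qed
  finally show ?thesis unfolding w_def by (simp only: mult_ac)
qed

end

section \<open>The decomposition\<close>

text \<open>The supremum in \<open>inball_diameter\<close> is only approximated: a ball is taken
  whose diameter exceeds half of the guaranteed value, which leads to \<open>4 * \<sigma>\<close>.
  The maximum with one meets the requirement \<open>1 \<le> s\<close> of
  \<open>regular_mesh\<close>.\<close>

lemma shape_regular_inball:
  fixes T :: "'a::euclidean_space set"
  assumes T: "int DIM('a) simplex T" and \<sigma>: "0 < \<sigma>" "diameter T \<le> \<sigma> * inball_diameter T"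
  obtains c r where "0 < r" "cball c r \<subseteq> T" "diameter T \<le> max 1 (4 * \<sigma>) * r"
proof -
  interpret full_simplex T by unfold_locales (rule T)
  have bd: "bounded T" using compact_T compact_imp_bounded by blast
  obtain c0 e where e: "0 < e" "cball c0 e \<subseteq> T"
    using interior_nonempty mem_interior_cball by blast
  have le: "2 * r \<le> diameter T" if "0 \<le> r" "cball c r \<subseteq> T" for c r
    using diameter_subset[OF that(2) bd] that(1) by simp
  have h: "0 < diameter T" using le[of e c0] e by simp
  let ?X = "{2 * r | c r. 0 \<le> r \<and> cball c r \<subseteq> T}"
  have "2 * e \<in> ?X" using e less_imp_le by blast
  then have ne: "?X \<noteq> {}" by blast
  have bdd: "bdd_above ?X" using le by (intro bdd_aboveI[of _ "diameter T"]) blast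
  have "diameter T / (2 * \<sigma>) < diameter T / \<sigma>" using h \<sigma>(1) by (simp add: field_simps)
  also have "\<dots> \<le> Sup ?X" using \<sigma> by (simp add: inball_diameter_def pos_divide_le_eq mult.commute)
  finally obtain c r where r: "0 \<le> r" "cball c r \<subseteq> T" "diameter T / (2 * \<sigma>) < 2 * r"
    using less_cSup_iff[OF ne bdd] by auto
  have "diameter T < 4 * \<sigma> * r" using r(3) \<sigma>(1) by (simp add: field_simps)
  moreover have "4 * \<sigma> * r \<le> max 1 (4 * \<sigma>) * r" using r(1) by (intro mult_right_mono) auto
  moreover have "0 < diameter T / (2 * \<sigma>)" using h \<sigma>(1) by simp
  then have "0 < r" using r(3) by linarith
  ultimately show ?thesis using that[of r c] r(2) by linarith
qed

text \<open>A set is contained in its own thickening, so \<open>hausdorff_outer_lower\<close>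
  applies to a ball inside \<open>S\<close>.\<close>

lemma surface_measure_interior_pos:
  fixes S :: "'a::euclidean_space set"
  assumes d: "2 \<le> DIM('a)" and S: "S \<in> sets borel" "interior S \<noteq> {}"
    and gen: "\<And>B :: 'a set. B \<in> sets borel \<Longrightarrow> emeasure surface_measure B = hausdorff_outer (DIM('a) - 1) B"
  shows "0 < emeasure surface_measure S"
proof -
  obtain x \<rho> where \<rho>: "0 < \<rho>" "cball x \<rho> \<subseteq> S" using S(2) mem_interior_cball by blast
  obtain e :: 'a where e: "e \<in> Basis" using nonempty_Basis by blast
  have "cball x \<rho> \<subseteq> {y + t *\<^sub>R e | y t. y \<in> cball x \<rho> \<and> \<bar>t\<bar> \<le> \<rho>}"
  proof
    fix y assume "y \<in> cball x \<rho>"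
    then show "y \<in> {y + t *\<^sub>R e | y t. y \<in> cball x \<rho> \<and> \<bar>t\<bar> \<le> \<rho>}"
      using \<rho>(1) by (intro CollectI exI[of _ y] exI[of _ "0::real"]) auto
  qed
  from hausdorff_outer_lower[OF d norm_Basis[OF e] \<rho>(1) less_imp_le[OF \<rho>(1)] this]
  have "ennreal (unit_ball_vol (real (DIM('a) - 1)) / (5 * 4 ^ DIM('a)) * \<rho> ^ DIM('a) / \<rho>) \<le> emeasure surface_measure (cball x \<rho>)"
    by (subst gen) auto
  also have "\<dots> \<le> emeasure surface_measure S"
    using \<rho>(2) S(1) by (intro emeasure_mono) (simp_all add: hausdorff_measure_sigma)
  finally have *: "ennreal (unit_ball_vol (real (DIM('a) - 1)) / (5 * 4 ^ DIM('a)) * \<rho> ^ DIM('a) / \<rho>) \<le> emeasure surface_measure S" .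
  have "0 < unit_ball_vol (real (DIM('a) - 1)) / (5 * 4 ^ DIM('a)) * \<rho> ^ DIM('a) / \<rho>"
    using \<rho>(1) by (intro divide_pos_pos mult_pos_pos unit_ball_vol_pos zero_less_power) auto
  then show ?thesis using * by (metis ennreal_less_zero_iff less_le_trans)
qed

text \<open>An active cell meets \<Omega> in positive surface measure, so on Borel sets the measure
  is the outer measure. Then every cell meeting \<Omega> is active: its interior meets the open set
  \<Omega>, and sets with interior points have positive surface measure.\<close>

lemma active_mesh_covers:
  fixes \<Omega> \<Omega>s :: "'a::euclidean_space set"
  assumes d: "2 \<le> DIM('a)" and \<Omega>: "open \<Omega>" "\<Omega> \<subseteq> \<Omega>s" and mesh: "mesh_of \<Omega>s \<T>" and ne: "T0 \<in> active_mesh \<Omega> \<T>"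
  shows "\<And>B :: 'a set. B \<in> sets borel \<Longrightarrow> emeasure surface_measure B = hausdorff_outer (DIM('a) - 1) B"
    and "\<Omega> \<subseteq> \<Union>(active_mesh \<Omega> \<T>)"
proof -
  have "emeasure surface_measure (T0 \<inter> \<Omega>) \<noteq> 0" using ne by (auto simp: active_mesh_def)
  then show gen: "\<And>B :: 'a set. B \<in> sets borel \<Longrightarrow> emeasure surface_measure B = hausdorff_outer (DIM('a) - 1) B"
    by (rule emeasure_hausdorff_measure)
  show "\<Omega> \<subseteq> \<Union>(active_mesh \<Omega> \<T>)"
  proof
    fix y assume y: "y \<in> \<Omega>"
    then have "y \<in> \<Union>\<T>" using \<Omega>(2) closure_subset mesh by (auto simp: mesh_of_def)
    then obtain T where T: "T \<in> \<T>" "y \<in> T" by blast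
    interpret full_simplex T by unfold_locales (use mesh T(1) in \<open>auto simp: mesh_of_def\<close>)
    have "\<Omega> \<inter> interior T \<noteq> {}"
      using open_Int_closure_eq_empty[OF \<Omega>(1), of "interior T"] closure_interior y T(2) by auto
    then have "interior (T \<inter> \<Omega>) \<noteq> {}" using \<Omega>(1) by (simp add: interior_open Int_commute)
    moreover have "T \<inter> \<Omega> \<in> sets borel" using closed_T \<Omega>(1) by auto
    ultimately have "0 < emeasure surface_measure (T \<inter> \<Omega>)"
      using surface_measure_interior_pos[OF d _ _ gen] by blast
    then show "y \<in> \<Union>(active_mesh \<Omega> \<T>)" using T by (auto simp: active_mesh_def)
  qed
qed

lemma active_mesh_regular:
  fixes \<Omega>s :: "'a::euclidean_space set"
  assumes mesh: "mesh_of \<Omega>s \<T>" and reg: "shape_regular \<sigma> \<T>" and \<sigma>: "0 < \<sigma>"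
  shows "regular_mesh (active_mesh \<Omega> \<T>) (max 1 (4 * \<sigma>))"
proof -
  have sub: "active_mesh \<Omega> \<T> \<subseteq> \<T>" by (auto simp: active_mesh_def)
  have tri: "triangulation \<T>" and full: "\<And>T. T \<in> \<T> \<Longrightarrow> int DIM('a) simplex T"
    using mesh by (auto simp: mesh_of_def)
  show ?thesis
  proof
    show "triangulation (active_mesh \<Omega> \<T>)"
      using tri sub unfolding triangulation_def by (meson finite_subset subsetD)
    show "int DIM('a) simplex T" if "T \<in> active_mesh \<Omega> \<T>" for T using full sub that by blast
    show "1 \<le> max 1 (4 * \<sigma>)" by simp
    fix T assume "T \<in> active_mesh \<Omega> \<T>"
    then have T: "T \<in> \<T>" using sub by blast
    then have "diameter T \<le> \<sigma> * inball_diameter T" using reg by (auto simp: shape_regular_def)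
    from shape_regular_inball[OF full[OF T] \<sigma> this]
    show "\<exists>c r. 0 < r \<and> cball c r \<subseteq> T \<and> diameter T \<le> max 1 (4 * \<sigma>) * r" by metis
  qed
qed

text \<open>The dictionary between the concrete spaces and \<open>lagrange_mesh\<close>. Unisolvence
  makes the definite description in \<open>nodal_basis\<close> denote
  \<open>shape_fun\<close>.\<close>

lemma
  fixes \<Omega> :: "'a::euclidean_space set" and \<T> :: "'a set set"
  assumes mesh: "lagrange_mesh (active_mesh \<Omega> \<T>) k"
  shows fe_space_eq: "fe_space k \<Omega> \<T> = lagrange_mesh.fe (active_mesh \<Omega> \<T>) k"
    and fe_nodes_eq: "fe_nodes k \<Omega> \<T> = lagrange_mesh.nodes (active_mesh \<Omega> \<T>) k"
    and nodal_span_eq: "\<And>N. N \<subseteq> fe_nodes k \<Omega> \<T> \<Longrightarrow> nodal_span k \<Omega> \<T> N =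
      {v. \<exists>c. v = (\<lambda>x. \<Sum>\<xi>\<in>N. c \<xi> * lagrange_mesh.shape_fun (active_mesh \<Omega> \<T>) k \<xi> x)}"
proof -
  interpret lagrange_mesh "active_mesh \<Omega> \<T>" k by (rule mesh)
  show fe: "fe_space k \<Omega> \<T> = fe" by (simp add: fe_space_def fe_def fict_domain_def)
  show nodes: "fe_nodes k \<Omega> \<T> = nodes" by (simp add: fe_nodes_def nodes_def)
  have basis: "nodal_basis k \<Omega> \<T> \<xi> = shape_fun \<xi>" if \<xi>: "\<xi> \<in> nodes" for \<xi>
    unfolding nodal_basis_def fe nodes
  proof (rule the_equality)
    show "shape_fun \<xi> \<in> fe \<and> (\<forall>\<eta>\<in>nodes. shape_fun \<xi> \<eta> = (if \<eta> = \<xi> then 1 else 0))"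
      using shape_fun_fe[OF \<xi>] shape_fun_node[OF \<xi>] by blast
    show "\<phi> = shape_fun \<xi>" if "\<phi> \<in> fe \<and> (\<forall>\<eta>\<in>nodes. \<phi> \<eta> = (if \<eta> = \<xi> then 1 else 0))" for \<phi>
      using that shape_fun_node[OF \<xi>] by (intro fe_unisolvent shape_fun_fe \<xi>) auto
  qed
  fix N assume N: "N \<subseteq> fe_nodes k \<Omega> \<T>"
  have "(\<Sum>\<xi>\<in>N. c \<xi> * nodal_basis k \<Omega> \<T> \<xi> x) = (\<Sum>\<xi>\<in>N. c \<xi> * shape_fun \<xi> x)" for c x
    using N basis by (intro sum.cong) (auto simp: nodes)
  then show "nodal_span k \<Omega> \<T> N = {v. \<exists>c. v = (\<lambda>x. \<Sum>\<xi>\<in>N. c \<xi> * shape_fun \<xi> x)}"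
    by (simp add: nodal_span_def)
qed

lemma norms_equivalent_transfer:
  assumes eq: "norms_equivalent c C k \<gamma> \<beta> \<Omega> \<T>" and c: "0 < c" "0 < C"
    and fe: "v \<in> fe_space k \<Omega> \<T>" "v0 \<in> fe_space k \<Omega> \<T>" "vG \<in> fe_space k \<Omega> \<T>"
    and b0: "0 \<le> b_norm \<gamma> \<Omega> \<T> v" "0 \<le> b_norm \<gamma> \<Omega> \<T> v0" "0 \<le> b_norm \<gamma> \<Omega> \<T> vG"
    and b: "(b_norm \<gamma> \<Omega> \<T> v0)\<^sup>2 + (b_norm \<gamma> \<Omega> \<T> vG)\<^sup>2 \<le> K * (b_norm \<gamma> \<Omega> \<T> v)\<^sup>2" and K: "0 \<le> K"
  shows "(a_norm k \<gamma> \<beta> \<Omega> \<T> v0)\<^sup>2 + (a_norm k \<gamma> \<beta> \<Omega> \<T> vG)\<^sup>2 \<le> C\<^sup>2 * K / c\<^sup>2 * (a_norm k \<gamma> \<beta> \<Omega> \<T> v)\<^sup>2"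
proof -
  let ?a = "a_norm k \<gamma> \<beta> \<Omega> \<T>" and ?b = "b_norm \<gamma> \<Omega> \<T>"
  have lo: "c * ?b u \<le> ?a u" and hi: "?a u \<le> C * ?b u" if "u \<in> fe_space k \<Omega> \<T>" for u
    using eq that by (auto simp: norms_equivalent_def)
  have up: "(?a u)\<^sup>2 \<le> C\<^sup>2 * (?b u)\<^sup>2" if u: "u \<in> fe_space k \<Omega> \<T>" "0 \<le> ?b u" for u
  proof -
    \<comment> \<open>Squaring the upper bound takes a nonnegative left side, which the lower bound
      supplies.\<close>
    have "0 \<le> c * ?b u" using c(1) u(2) by simp
    then have "0 \<le> ?a u" using lo[OF u(1)] by linarith
    then have "(?a u)\<^sup>2 \<le> (C * ?b u)\<^sup>2" by (rule power_mono[OF hi[OF u(1)]])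
    then show ?thesis by (simp add: power_mult_distrib)
  qed
  have "(c * ?b v)\<^sup>2 \<le> (?a v)\<^sup>2" using c(1) b0(1) by (intro power_mono lo fe(1)) simp
  then have down: "(?b v)\<^sup>2 \<le> (?a v)\<^sup>2 / c\<^sup>2" using c(1) by (simp add: power_mult_distrib field_simps)
  have "(?a v0)\<^sup>2 + (?a vG)\<^sup>2 \<le> C\<^sup>2 * ((?b v0)\<^sup>2 + (?b vG)\<^sup>2)"
    using up[OF fe(2) b0(2)] up[OF fe(3) b0(3)] by (simp add: distrib_left)
  also have "\<dots> \<le> C\<^sup>2 * (K * (?b v)\<^sup>2)" using b by (intro mult_left_mono) auto
  also have "\<dots> \<le> C\<^sup>2 * (K * ((?a v)\<^sup>2 / c\<^sup>2))" using down K by (intro mult_left_mono) auto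
  finally show ?thesis by simp
qed

theorem theorem3p7:
  fixes \<Omega> \<Omega>s :: "'a::euclidean_space set" and k :: nat and \<gamma> \<beta> \<sigma> c C :: real
  assumes "DIM('a) \<in> {2, 3}"
    and "lipschitz_domain \<Omega>"
    and "polyhedral_domain \<Omega>s" and "\<Omega> \<subseteq> \<Omega>s"
    and "1 \<le> k" and "0 < \<gamma>" and "0 < \<beta>"
    and "0 < \<sigma>"
    and "0 < c" and "0 < C"
  shows "\<exists>K\<^sub>b>0. \<exists>K\<^sub>a>0. \<forall>\<T>.
    mesh_of \<Omega>s \<T> \<and> shape_regular \<sigma> \<T> \<and> boundary_resolved \<Omega> \<T> \<longrightarrow>
    (\<forall>v\<in>fe_space k \<Omega> \<T>.
      (\<exists>!(v0, vG). v0 \<in> fe_interior k \<Omega> \<T> \<and> vG \<in> fe_boundary k \<Omega> \<T> \<and> v = (\<lambda>x. v0 x + vG x)) \<and>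
      (\<forall>v0\<in>fe_interior k \<Omega> \<T>. \<forall>vG\<in>fe_boundary k \<Omega> \<T>. v = (\<lambda>x. v0 x + vG x) \<longrightarrow>
        (b_norm \<gamma> \<Omega> \<T> v0)\<^sup>2 + (b_norm \<gamma> \<Omega> \<T> vG)\<^sup>2 \<le> K\<^sub>b * (b_norm \<gamma> \<Omega> \<T> v)\<^sup>2 \<and>
        (norms_equivalent c C k \<gamma> \<beta> \<Omega> \<T> \<longrightarrow>
          (a_norm k \<gamma> \<beta> \<Omega> \<T> v0)\<^sup>2 + (a_norm k \<gamma> \<beta> \<Omega> \<T> vG)\<^sup>2
            \<le> K\<^sub>a * (a_norm k \<gamma> \<beta> \<Omega> \<T> v)\<^sup>2)))"
proof -
  have d: "2 \<le> DIM('a)" using assms(1) by auto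
  have bds: "bounded \<Omega>s" using assms(3) by (simp add: polyhedral_domain_def)
  have bd: "bounded \<Omega>" using bds assms(4) bounded_subset by blast
  have op: "open \<Omega>" using lipschitz_domain_open[OF assms(2)] .
  define s where "s = max 1 (4 * \<sigma>)"
  have s: "1 \<le> s" by (simp add: s_def)
  \<comment> \<open>All cells lie in \<open>closure \<Omega>s\<close>; the added one makes the bound
    positive.\<close>
  define D where "D = diameter (closure \<Omega>s) + 1"
  have D: "0 < D" using diameter_ge_0[OF bounded_closure[OF bds]] by (simp add: D_def)
  obtain C\<^sub>\<Gamma> where C\<^sub>\<Gamma>: "0 \<le> C\<^sub>\<Gamma>" "\<And>T. bounded T \<Longrightarrow> 0 < diameter T \<Longrightarrow>
    emeasure surface_measure (T \<inter> frontier \<Omega>) \<le> ennreal (C\<^sub>\<Gamma> * diameter T ^ (DIM('a) - 1))"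
    using boundary_measure_upper[OF d assms(2) bd] by metis
  obtain K where K: "0 < K" and trace: "\<And>\<A> u T x. regular_mesh \<A> s \<Longrightarrow> \<Omega> \<subseteq> \<Union>\<A> \<Longrightarrow>
      (\<And>B :: 'a set. B \<in> sets borel \<Longrightarrow> emeasure surface_measure B = hausdorff_outer (DIM('a) - 1) B) \<Longrightarrow>
      (\<And>T. T \<in> \<A> \<Longrightarrow> \<exists>p\<in>polys k. \<forall>x\<in>T. u x = p x) \<Longrightarrow>
      T \<in> \<A> \<Longrightarrow> diameter T \<le> D \<Longrightarrow> T \<inter> \<Omega> \<noteq> {} \<Longrightarrow> T \<inter> frontier \<Omega> \<noteq> {} \<Longrightarrow> x \<in> T \<Longrightarrow>
      diameter T ^ (DIM('a) - 1) / diameter T * (u x)\<^sup>2 \<le>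
        K * (\<Sum>T'\<in>regular_mesh.near \<A> T. inverse (diameter T') * (LINT y:T' \<inter> frontier \<Omega>|surface_measure. u y * u y) + grad_prod T' u u)"
    using trace_estimate[OF d assms(2) bd assms(5) s D] by blast
  define K1 where "K1 = (nodal_const k DIM('a))\<^sup>2 * (s\<^sup>2 * unit_ball_vol (real DIM('a)) + \<gamma> * C\<^sub>\<Gamma>) * K *
    (real (Suc DIM('a)) * s ^ DIM('a)) * (1 + 1 / \<gamma>)"
  have K1: "0 \<le> K1" unfolding K1_def using K s C\<^sub>\<Gamma>(1) assms(6)
    by (intro mult_nonneg_nonneg add_nonneg_nonneg) auto
  \<comment> \<open>The boundary part accounts for \<open>K1\<close>, and the interior part, being a
    difference, for \<open>2 + 2 * K1\<close>.\<close>
  define K\<^sub>b where "K\<^sub>b = 2 + 3 * K1"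
  have K\<^sub>b: "0 < K\<^sub>b" using K1 by (simp add: K\<^sub>b_def)
  have goal: "(\<exists>!(v0, vG). v0 \<in> fe_interior k \<Omega> \<T> \<and> vG \<in> fe_boundary k \<Omega> \<T> \<and> v = (\<lambda>x. v0 x + vG x)) \<and>
      (\<forall>v0\<in>fe_interior k \<Omega> \<T>. \<forall>vG\<in>fe_boundary k \<Omega> \<T>. v = (\<lambda>x. v0 x + vG x) \<longrightarrow>
        (b_norm \<gamma> \<Omega> \<T> v0)\<^sup>2 + (b_norm \<gamma> \<Omega> \<T> vG)\<^sup>2 \<le> K\<^sub>b * (b_norm \<gamma> \<Omega> \<T> v)\<^sup>2 \<and>
        (norms_equivalent c C k \<gamma> \<beta> \<Omega> \<T> \<longrightarrow>
          (a_norm k \<gamma> \<beta> \<Omega> \<T> v0)\<^sup>2 + (a_norm k \<gamma> \<beta> \<Omega> \<T> vG)\<^sup>2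
            \<le> C\<^sup>2 * K\<^sub>b / c\<^sup>2 * (a_norm k \<gamma> \<beta> \<Omega> \<T> v)\<^sup>2))"
    if \<T>: "mesh_of \<Omega>s \<T>" "shape_regular \<sigma> \<T>" "boundary_resolved \<Omega> \<T>" and v: "v \<in> fe_space k \<Omega> \<T>" for \<T> v
  proof -
    let ?\<A> = "active_mesh \<Omega> \<T>"
    interpret mesh: regular_mesh ?\<A> s
      unfolding s_def by (rule active_mesh_regular[OF \<T>(1,2) assms(8)])
    have bdT: "bounded T" if "T \<in> ?\<A>" for T
      using full_simplex.compact_T[OF mesh.cell[OF that]] compact_imp_bounded by blast
    interpret regular_lagrange_mesh ?\<A> s k "frontier \<Omega>" surface_measure C\<^sub>\<Gamma> \<gamma>
      by unfold_locales
        (use assms(5,6) C\<^sub>\<Gamma> bdT mesh.diameter_pos in \<open>auto simp: hausdorff_measure_sigma\<close>)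
    have lm: "lagrange_mesh ?\<A> k" by unfold_locales
    note fe_eq = fe_space_eq[OF lm] and nodes_eq = fe_nodes_eq[OF lm] and span_eq = nodal_span_eq[OF lm]
    have v': "v \<in> fe" using v by (simp add: fe_eq)
    have cut: "cut_mesh \<Omega> \<T> = cut" by (simp add: cut_mesh_def cut_def)
    let ?N = "nodes \<inter> frontier (fict_domain \<Omega> \<T>)"
    have int_eq: "fe_interior k \<Omega> \<T> = {v. \<exists>c. v = (\<lambda>x. \<Sum>\<xi>\<in>nodes - ?N. c \<xi> * shape_fun \<xi> x)}"
      unfolding fe_interior_def nodes_eq by (subst span_eq) (auto simp: nodes_eq Diff_Int2 Diff_Int)
    have bd_eq: "fe_boundary k \<Omega> \<T> = {v. \<exists>c. v = (\<lambda>x. \<Sum>\<xi>\<in>?N. c \<xi> * shape_fun \<xi> x)}"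
      unfolding fe_boundary_def nodes_eq by (subst span_eq) (auto simp: nodes_eq)
    define w0 where "w0 = (\<lambda>x. \<Sum>\<xi>\<in>nodes - ?N. v \<xi> * shape_fun \<xi> x)"
    define wG where "wG = (\<lambda>x. \<Sum>\<xi>\<in>?N. v \<xi> * shape_fun \<xi> x)"
    have w0: "w0 \<in> fe_interior k \<Omega> \<T>" and wG: "wG \<in> fe_boundary k \<Omega> \<T>"
      unfolding w0_def wG_def int_eq bd_eq by blast+
    have w0_fe: "w0 \<in> fe" unfolding w0_def by (rule span_fe) blast
    have wG_fe: "wG \<in> fe" unfolding wG_def by (rule span_fe) blast
    have v_sum: "v x = w0 x + wG x" for x
      unfolding w0_def wG_def fe_expansion[OF v', of x]
      using sum.subset_diff[of ?N nodes "\<lambda>\<xi>. v \<xi> * shape_fun \<xi> x"] finite_nodes by simp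
    have uniq: "v0 = w0 \<and> vG = wG"
      if v0: "v0 \<in> fe_interior k \<Omega> \<T>" and vG: "vG \<in> fe_boundary k \<Omega> \<T>" and e: "v = (\<lambda>x. v0 x + vG x)" for v0 vG
    proof -
      obtain c0 c1 where "v0 = (\<lambda>x. \<Sum>\<xi>\<in>nodes - ?N. c0 \<xi> * shape_fun \<xi> x)" "vG = (\<lambda>x. \<Sum>\<xi>\<in>?N. c1 \<xi> * shape_fun \<xi> x)"
        using v0 vG unfolding int_eq bd_eq by blast
      from decomposition[OF v' _ this e] show ?thesis by (simp add: w0_def wG_def)
    qed
    have bf: "(b_norm \<gamma> \<Omega> \<T> u)\<^sup>2 = bform u" "0 \<le> b_norm \<gamma> \<Omega> \<T> u" if u: "u \<in> fe" for u
    proof -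
      have "b_form \<gamma> \<Omega> \<T> u u = bform u"
        unfolding b_form_def bform_def fict_domain_def weighted_bdry_prod_def cut trace_def
        using mesh.grad_prod_Union[OF fe_poly[OF u]] by simp
      then show "(b_norm \<gamma> \<Omega> \<T> u)\<^sup>2 = bform u" "0 \<le> b_norm \<gamma> \<Omega> \<T> u"
        using bform_nonneg[of u] by (simp_all add: b_norm_def)
    qed
    have main: "bform wG \<le> K1 * bform v"
      unfolding wG_def K1_def
    proof (rule boundary_part_bound[OF v'])
      show "?N \<subseteq> nodes" by blast
      \<comment> \<open>Here \<open>boundary_resolved\<close> enters: an active cell that reaches
        the frontier of the fictitious domain is cut.\<close>
      show "T \<in> cut" if "T \<in> ?\<A>" "T \<inter> ?N \<noteq> {}" for T
        using that \<T>(3) unfolding boundary_resolved_def cut by blast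
      show "0 \<le> K" using K by simp
      fix T x assume T: "T \<in> cut" and x: "x \<in> T"
      have TA: "T \<in> ?\<A>" "T \<inter> frontier \<Omega> \<noteq> {}" using T by (auto simp: cut_def)
      have "T \<in> \<T>" using TA(1) by (simp add: active_mesh_def)
      then have "T \<subseteq> closure \<Omega>s" using \<T>(1) by (auto simp: mesh_of_def)
      then have "diameter T \<le> diameter (closure \<Omega>s)" by (rule diameter_subset[OF _ bounded_closure[OF bds]])
      then have TD: "diameter T \<le> D" by (simp add: D_def)
      have T\<Omega>: "T \<inter> \<Omega> \<noteq> {}" using TA(1) by (auto simp: active_mesh_def)
      show "diameter T ^ (DIM('a) - 1) / diameter T * (v x)\<^sup>2 \<le>
        K * (\<Sum>T'\<in>mesh.near T. inverse (diameter T') * trace v T' + grad_prod T' v v)"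
        unfolding trace_def
        by (rule trace[OF mesh.regular_mesh_axioms active_mesh_covers(2)[OF d op assms(4) \<T>(1) TA(1)]
              active_mesh_covers(1)[OF d op assms(4) \<T>(1) TA(1)] fe_poly[OF v'] TA(1) TD T\<Omega> TA(2) x])
    qed
    have w0_diff: "w0 = (\<lambda>x. v x - wG x)" using v_sum by (simp add: fun_eq_iff)
    have "bform w0 \<le> 2 * bform v + 2 * bform wG"
      using bform_diff[OF v' wG_fe] w0_fe unfolding w0_diff by blast
    then have total: "bform w0 + bform wG \<le> K\<^sub>b * bform v" using main by (simp add: K\<^sub>b_def distrib_right)
    have b_bound: "(b_norm \<gamma> \<Omega> \<T> w0)\<^sup>2 + (b_norm \<gamma> \<Omega> \<T> wG)\<^sup>2 \<le> K\<^sub>b * (b_norm \<gamma> \<Omega> \<T> v)\<^sup>2"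
      using total bf(1)[OF v'] bf(1)[OF w0_fe] bf(1)[OF wG_fe] by simp
    have a_bound: "(a_norm k \<gamma> \<beta> \<Omega> \<T> w0)\<^sup>2 + (a_norm k \<gamma> \<beta> \<Omega> \<T> wG)\<^sup>2 \<le> C\<^sup>2 * K\<^sub>b / c\<^sup>2 * (a_norm k \<gamma> \<beta> \<Omega> \<T> v)\<^sup>2"
      if "norms_equivalent c C k \<gamma> \<beta> \<Omega> \<T>"
      using norms_equivalent_transfer[OF that assms(9,10) _ _ _ _ _ _ b_bound] bf(2)[OF v'] bf(2)[OF w0_fe] bf(2)[OF wG_fe]
        v' w0_fe wG_fe K\<^sub>b by (simp add: fe_eq)
    have "\<exists>!(v0, vG). v0 \<in> fe_interior k \<Omega> \<T> \<and> vG \<in> fe_boundary k \<Omega> \<T> \<and> v = (\<lambda>x. v0 x + vG x)"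
    proof (rule ex1I[of _ "(w0, wG)"])
      show "case (w0, wG) of (v0, vG) \<Rightarrow> v0 \<in> fe_interior k \<Omega> \<T> \<and> vG \<in> fe_boundary k \<Omega> \<T> \<and> v = (\<lambda>x. v0 x + vG x)"
        using w0 wG v_sum by (auto simp: fun_eq_iff)
      show "p = (w0, wG)"
        if "case p of (v0, vG) \<Rightarrow> v0 \<in> fe_interior k \<Omega> \<T> \<and> vG \<in> fe_boundary k \<Omega> \<T> \<and> v = (\<lambda>x. v0 x + vG x)" for p
        using that uniq by (cases p) auto
    qed
    moreover have "(b_norm \<gamma> \<Omega> \<T> v0)\<^sup>2 + (b_norm \<gamma> \<Omega> \<T> vG)\<^sup>2 \<le> K\<^sub>b * (b_norm \<gamma> \<Omega> \<T> v)\<^sup>2 \<and>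
        (norms_equivalent c C k \<gamma> \<beta> \<Omega> \<T> \<longrightarrow>
          (a_norm k \<gamma> \<beta> \<Omega> \<T> v0)\<^sup>2 + (a_norm k \<gamma> \<beta> \<Omega> \<T> vG)\<^sup>2
            \<le> C\<^sup>2 * K\<^sub>b / c\<^sup>2 * (a_norm k \<gamma> \<beta> \<Omega> \<T> v)\<^sup>2)"
      if "v0 \<in> fe_interior k \<Omega> \<T>" "vG \<in> fe_boundary k \<Omega> \<T>" "v = (\<lambda>x. v0 x + vG x)" for v0 vG
      using uniq[OF that] b_bound a_bound by simp
    ultimately show ?thesis by blast
  qed
  show ?thesis
  proof (intro exI conjI allI impI ballI)
    show "0 < K\<^sub>b" by (rule K\<^sub>b)
    show "0 < C\<^sup>2 * K\<^sub>b / c\<^sup>2" using K\<^sub>b assms(9,10) by simp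
  qed (use goal in blast)+
qed

end
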